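(* Each of the $135$ reorientation classes of uniform oriented matroids of rank $5$ on $8$ elements has at most $2C_4(8)$ complete cells. Moreover, the reorientation class of the alternating oriented matroid of rank $5$ on $8$ elements is the only one with exactly $2C_4(8)$ complete cells.
   Context: An oriented matroid $\mathcal{M}$ on ground set $E=\{1,\dots,n\}$ is given by its set $\mathcal{C}$ of signed circuits. It is uniform of rank $r$ if the supports of its circuits are exactly the $(r+1)$-element subsets of $E$. A reorientation on $R\subseteq E$ changes the signs of the elements of $R$ in all circuits; the reorientation class of $\mathcal{M}$ is the set of all its reorientations (up to relabelling/isomorphism). For sign vectors $X,Y$ let $S(X,Y)=\{e: X_eY_e=-\}$. A tope of $\mathcal{M}$ is a sign vector $T\in\{+,-\}^E$ such that for every circuit $X$ both $S(T,X)$ and $S(T,-X)$ are nonempty. A tope $T$ is a complete cell if for every $e\in E$ the sign vector obtained from $T$ by changing the sign of the single entry $e$ is again a tope (equivalently, the corresponding cell of the associated pseudohyperplane arrangement is bounded by every pseudohyperplane). The number of complete cells is the same for all members of a reorientation class. The alternating oriented matroid of rank $r$ on $\{1,\dots,n\}$ is the uniform one whose chirotope satisfies $\chi(b_1,\dots,b_r)=+$ whenever $b_1<\dots<b_r$. For integers $n\ge d+1$, $C_d(n)=\binom{d}{n-d}+\binom{d-1}{n-d-1}+\sum_{i=0}^{d-2}\binom{n-1}{i}$ (with $\binom{a}{b}=0$ for $b>a$); it is the number of complete cells of the cyclic arrangement of $n$ hyperplanes in $\mathbb{P}^d$, so $2C_4(8)=62$. *)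

theory Defs
  imports "HOL-Combinatorics.Permutations"
begin

text \<open>A sign vector on \<open>E\<close> is a function with values in \<open>{-1, 0, 1}\<close>, extended by \<open>0\<close>
  outside \<open>E\<close> so that equality of sign vectors is equality of functions.  The opposite of
  \<open>X\<close> is the pointwise \<open>- X\<close>.\<close>

type_synonym 'a sign_vector = "'a \<Rightarrow> int"

definition supp :: "'a sign_vector \<Rightarrow> 'a set" where
  "supp X = {e. X e \<noteq> 0}"

definition pos :: "'a sign_vector \<Rightarrow> 'a set" where
  "pos X = {e. X e = 1}"

definition neg :: "'a sign_vector \<Rightarrow> 'a set" where
  "neg X = {e. X e = - 1}"

definition sign_vectors :: "'a set \<Rightarrow> 'a sign_vector set" where
  "sign_vectors E = {X. range X \<subseteq> {- 1, 0, 1} \<and> supp X \<subseteq> E}"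

definition sep :: "'a sign_vector \<Rightarrow> 'a sign_vector \<Rightarrow> 'a set" where
  "sep X Y = {e. X e * Y e = - 1}"

locale oriented_matroid =
  fixes E :: "'a set" and \<C> :: "'a sign_vector set"
  assumes finite_ground: "finite E"
    and circuits_sign_vectors: "\<C> \<subseteq> sign_vectors E"
    and circuit_nonempty: "X \<in> \<C> \<Longrightarrow> supp X \<noteq> {}"
    and circuit_symmetric: "X \<in> \<C> \<Longrightarrow> - X \<in> \<C>"
    and circuit_incomparable:
      "\<lbrakk>X \<in> \<C>; Y \<in> \<C>; supp X \<subseteq> supp Y\<rbrakk> \<Longrightarrow> X = Y \<or> X = - Y"
    and circuit_elimination:
      "\<lbrakk>X \<in> \<C>; Y \<in> \<C>; X \<noteq> - Y; e \<in> pos X \<inter> neg Y\<rbrakk> \<Longrightarrow>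
        \<exists>Z\<in>\<C>. pos Z \<subseteq> (pos X \<union> pos Y) - {e} \<and> neg Z \<subseteq> (neg X \<union> neg Y) - {e}"

definition uniform_oriented_matroid :: "'a set \<Rightarrow> nat \<Rightarrow> 'a sign_vector set \<Rightarrow> bool" where
  "uniform_oriented_matroid E r \<C> \<longleftrightarrow>
     oriented_matroid E \<C> \<and> supp ` \<C> = {A. A \<subseteq> E \<and> card A = r + 1}"

definition bases :: "'a set \<Rightarrow> 'a sign_vector set \<Rightarrow> 'a set set" where
  "bases E \<C> = {B. B \<subseteq> E \<and> (\<forall>X\<in>\<C>. \<not> supp X \<subseteq> B) \<and>
                     (\<forall>e\<in>E - B. \<exists>X\<in>\<C>. supp X \<subseteq> insert e B)}"

definition reorient :: "'a set \<Rightarrow> 'a sign_vector \<Rightarrow> 'a sign_vector" where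
  "reorient R X = (\<lambda>e. if e \<in> R then - X e else X e)"

text \<open>As \<open>\<pi>\<close> runs through all permutations of \<open>E\<close>, the vectors \<open>X \<circ> \<pi>\<close> give all relabellings
  of \<open>X\<close>.\<close>

definition reorientation_class :: "'a set \<Rightarrow> 'a sign_vector set \<Rightarrow> 'a sign_vector set set" where
  "reorientation_class E \<C> =
     {(\<lambda>X. reorient R X \<circ> \<pi>) ` \<C> | R \<pi>. R \<subseteq> E \<and> \<pi> permutes E}"

definition uniform_reorientation_classes :: "'a set \<Rightarrow> nat \<Rightarrow> 'a sign_vector set set set" where
  "uniform_reorientation_classes E r =
     reorientation_class E ` {\<C>. uniform_oriented_matroid E r \<C>}"

definition topes :: "'a set \<Rightarrow> 'a sign_vector set \<Rightarrow> 'a sign_vector set" where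
  "topes E \<C> = {T \<in> sign_vectors E. supp T = E \<and>
                  (\<forall>X\<in>\<C>. sep T X \<noteq> {} \<and> sep T (- X) \<noteq> {})}"

definition complete_cells :: "'a set \<Rightarrow> 'a sign_vector set \<Rightarrow> 'a sign_vector set" where
  "complete_cells E \<C> = {T \<in> topes E \<C>. \<forall>e\<in>E. T(e := - T e) \<in> topes E \<C>}"

text \<open>A chirotope of the rank \<open>r\<close> oriented matroid with circuits \<open>\<C>\<close> is an alternating
  sign map on ordered \<open>r\<close>-tuples from \<open>E\<close>, supported on the ordered bases, which is related
  to \<open>\<C>\<close> by the pivoting rule \<open>\<chi>(y, x\<^sub>2, \<dots>, x\<^sub>r) = - X(x) X(y) \<chi>(x, x\<^sub>2, \<dots>, x\<^sub>r)\<close> for the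
  circuits \<open>X\<close> with \<open>x\<close> and \<open>y\<close> in their support, contained in \<open>{x, y, x\<^sub>2, \<dots>, x\<^sub>r}\<close>.
  It is determined by \<open>\<C>\<close> up to a global sign.\<close>

definition is_chirotope ::
    "'a set \<Rightarrow> nat \<Rightarrow> 'a sign_vector set \<Rightarrow> ('a list \<Rightarrow> int) \<Rightarrow> bool" where
  "is_chirotope E r \<C> \<chi> \<longleftrightarrow>
     (\<forall>xs. set xs \<subseteq> E \<and> length xs = r \<longrightarrow>
        \<chi> xs \<in> {- 1, 0, 1} \<and> (\<chi> xs \<noteq> 0 \<longleftrightarrow> distinct xs \<and> set xs \<in> bases E \<C>)) \<and>
     (\<forall>xs i j. set xs \<subseteq> E \<and> length xs = r \<and> i < j \<and> j < r \<longrightarrow>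
        \<chi> (xs[i := xs ! j, j := xs ! i]) = - \<chi> xs) \<and>
     (\<forall>X\<in>\<C>. \<forall>xs x y. set xs \<subseteq> E \<and> length xs + 1 = r \<and> x \<noteq> y \<and>
        x \<in> supp X \<and> y \<in> supp X \<and> supp X \<subseteq> {x, y} \<union> set xs \<longrightarrow>
        \<chi> (y # xs) = - X x * X y * \<chi> (x # xs))"

definition is_alternating :: "nat \<Rightarrow> nat \<Rightarrow> nat sign_vector set \<Rightarrow> bool" where
  "is_alternating n r \<C> \<longleftrightarrow> uniform_oriented_matroid {1..n} r \<C> \<and>
     (\<exists>\<chi>. is_chirotope {1..n} r \<C> \<chi> \<and>
          (\<forall>bs. set bs \<subseteq> {1..n} \<and> length bs = r \<and> sorted_wrt (<) bs \<longrightarrow> \<chi> bs = 1))"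

text \<open>Intended for \<open>n \<ge> d + 1\<close> and \<open>d \<ge> 1\<close>; the range \<open>i < d - 1\<close> is the range
  \<open>0 \<le> i \<le> d - 2\<close>, empty for \<open>d = 1\<close>.\<close>

definition cyclic_cells :: "nat \<Rightarrow> nat \<Rightarrow> nat" where
  "cyclic_cells d n =
     (d choose (n - d)) + ((d - 1) choose (n - d - 1)) + (\<Sum>i<d - 1. (n - 1) choose i)"

end

theory Submission
  imports Defs
begin

text \<open>A uniform oriented matroid of rank \<open>5\<close> on \<open>8\<close> elements is dual to one of rank \<open>3\<close>, that is,
  to a simple arrangement of \<open>8\<close> pseudolines.  Its circuits are the sign vectors \<open>\<chi>(a, b, \<cdot>)\<close> of a
  rank \<open>3\<close> chirotope \<open>\<chi>\<close>, and the circuit axioms amount to the three-term Grassmann-Pluecker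
  relations for \<open>\<chi>\<close>.  Hence the reorientation classes can be enumerated one element at a time:
  every one-element extension of a representative is a solution of these relations, and a
  certificate (a signed permutation) maps it to a representative with one more element.  There
  are \<open>1, 1, 1, 4, 11, 135\<close> representatives for \<open>3, \<dots>, 8\<close> elements.

  The full sign vectors which are not topes are the cells of the arrangement; the number of circuits
  conforming to such a vector is the number of sides of the cell.  Summing over each pseudoline the squares of
  the products of the side numbers of the two cells along an edge, and summing the squares of the results, gives
  an invariant that separates the \<open>135\<close> classes; the complete cells are the sign vectors at Hamming distance
  at least \<open>2\<close> from all cells.\<close>

section \<open>Rank 3 chirotopes and their circuits\<close>

text \<open>The two halves of the count are independent. Certificates bound the number of classes
  from above: a list of representatives is complete as soon as every extension of the previous list
  is mapped into it, and no inequivalence has to be decided on the way. The invariant bounds it from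
  below: its values strictly increase along the 135 tables, each of which is tested against all
  three-term relations. The alternating oriented matroid is never matched with a representative by
  an explicit isomorphism; its own complete cells are counted, and the value 62 identifies its class
  because only one table attains it. Passing to the dual keeps the relations small, five elements
  and six signs at a time. The price is a translation of the circuit axioms. In one direction,
  circuits with disjoint zero sets have to be eliminated, where no single three-term relation
  applies. In the other, signs have to be chosen coherently although each circuit is known only up
  to its opposite.\<close>

text \<open>Signs are truth values, so that \<open>=\<close> is multiplication of signs.  The last clause says that
  the terms \<open>\<chi>(abc)\<chi>(ade)\<close>, \<open>-\<chi>(abd)\<chi>(ace)\<close>, \<open>\<chi>(abe)\<chi>(acd)\<close> do not all have the same sign.\<close>

definition chirotope :: "'a set \<Rightarrow> ('a \<Rightarrow> 'a \<Rightarrow> 'a \<Rightarrow> bool) \<Rightarrow> bool" where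
  "chirotope E \<chi> \<longleftrightarrow>
     (\<forall>a\<in>E. \<forall>b\<in>E. \<forall>c\<in>E. distinct [a, b, c] \<longrightarrow> \<chi> b c a = \<chi> a b c \<and> \<chi> b a c = (\<not> \<chi> a b c)) \<and>
     (\<forall>a\<in>E. \<forall>b\<in>E. \<forall>c\<in>E. \<forall>d\<in>E. \<forall>e\<in>E. distinct [a, b, c, d, e] \<longrightarrow>
        (\<chi> a b c = \<chi> a d e) = (\<chi> a b d = \<chi> a c e) \<or> (\<chi> a b c = \<chi> a d e) \<noteq> (\<chi> a b e = \<chi> a c d))"

lemma chirotope_cyc:
  assumes "chirotope E \<chi>" "a \<in> E" "b \<in> E" "c \<in> E" "a \<noteq> b" "a \<noteq> c" "b \<noteq> c"
  shows "\<chi> b c a = \<chi> a b c" and "\<chi> b a c = (\<not> \<chi> a b c)"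
    and "\<chi> c a b = \<chi> a b c" and "\<chi> a c b = (\<not> \<chi> a b c)" and "\<chi> c b a = (\<not> \<chi> a b c)"
proof -
  have *: "\<chi> y z x = \<chi> x y z \<and> \<chi> y x z = (\<not> \<chi> x y z)"
    if "x \<in> E" "y \<in> E" "z \<in> E" "x \<noteq> y" "x \<noteq> z" "y \<noteq> z" for x y z
  proof -
    have "distinct [x, y, z]" using that by simp
    then show ?thesis using assms(1) that(1-3) unfolding chirotope_def by blast
  qed
  show "\<chi> b c a = \<chi> a b c" "\<chi> b a c = (\<not> \<chi> a b c)" "\<chi> c a b = \<chi> a b c"
    "\<chi> a c b = (\<not> \<chi> a b c)" "\<chi> c b a = (\<not> \<chi> a b c)"
    using *[of a b c] *[of b c a] *[of c a b] assms(2-) by blast+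
qed

lemma chirotope_gp:
  assumes "chirotope E \<chi>" "a \<in> E" "b \<in> E" "c \<in> E" "d \<in> E" "e \<in> E" "distinct [a, b, c, d, e]"
  shows "(\<chi> a b c = \<chi> a d e) = (\<chi> a b d = \<chi> a c e) \<or> (\<chi> a b c = \<chi> a d e) \<noteq> (\<chi> a b e = \<chi> a c d)"
  using assms unfolding chirotope_def by blast

text \<open>A five-element set carries five three-term relations, one for each choice of the common
  element. Rewriting a relation in triples ordered as \<open>a\<close>, \<open>b\<close>,
  \<open>c\<close>, \<open>d\<close>, \<open>e\<close> changes its three products by a common sign,
  so all five have the shape \<open>ok\<close>.\<close>

lemma chirotope_gp5:
  assumes "chirotope E \<chi>" "a \<in> E" "b \<in> E" "c \<in> E" "d \<in> E" "e \<in> E" "distinct [a, b, c, d, e]"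
  defines "ok \<equiv> \<lambda>bc de bd ce be cd. (bc = de) = (bd = ce) \<or> (bc = de) \<noteq> (be = cd)"
  shows "ok (\<chi> a b c) (\<chi> a d e) (\<chi> a b d) (\<chi> a c e) (\<chi> a b e) (\<chi> a c d)"
    "ok (\<chi> a b c) (\<chi> b d e) (\<chi> a b d) (\<chi> b c e) (\<chi> a b e) (\<chi> b c d)"
    "ok (\<chi> a b c) (\<chi> c d e) (\<chi> a c d) (\<chi> b c e) (\<chi> a c e) (\<chi> b c d)"
    "ok (\<chi> a b d) (\<chi> c d e) (\<chi> a c d) (\<chi> b d e) (\<chi> a d e) (\<chi> b c d)"
    "ok (\<chi> a b e) (\<chi> c d e) (\<chi> a c e) (\<chi> b d e) (\<chi> a d e) (\<chi> b c e)"
proof -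
  note cyc = chirotope_cyc[OF assms(1)]
  note in_E = assms(2-6)
  have gp: "(\<chi> p q r = \<chi> p s t) = (\<chi> p q s = \<chi> p r t) \<or> (\<chi> p q r = \<chi> p s t) \<noteq> (\<chi> p q t = \<chi> p r s)"
    if "{p, q, r, s, t} \<subseteq> E" "distinct [p, q, r, s, t]" for p q r s t
    using chirotope_gp[OF assms(1)] that by simp
  have ne: "a \<noteq> b" "a \<noteq> c" "a \<noteq> d" "a \<noteq> e" "b \<noteq> c" "b \<noteq> d" "b \<noteq> e" "c \<noteq> d" "c \<noteq> e" "d \<noteq> e"
    using assms(7) by auto
  show "ok (\<chi> a b c) (\<chi> a d e) (\<chi> a b d) (\<chi> a c e) (\<chi> a b e) (\<chi> a c d)"
    unfolding ok_def by (rule gp) (use assms in auto)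
  have db: "distinct [b, a, c, d, e]" using ne by auto
  have hb: "\<chi> b a c = (\<not> \<chi> a b c)" "\<chi> b d e = (\<chi> b d e)" "\<chi> b a d = (\<not> \<chi> a b d)" "\<chi> b c e = (\<chi> b c e)" "\<chi> b a e = (\<not> \<chi> a b e)" "\<chi> b c d = (\<chi> b c d)"
    using cyc in_E ne by blast+
  show "ok (\<chi> a b c) (\<chi> b d e) (\<chi> a b d) (\<chi> b c e) (\<chi> a b e) (\<chi> b c d)"
    unfolding ok_def using gp[of b a c d e, OF _ db] in_E hb by (simp only: insert_subset empty_subsetI simp_thms; argo)
  have dc: "distinct [c, a, b, d, e]" using ne by auto
  have hc: "\<chi> c a b = (\<chi> a b c)" "\<chi> c d e = (\<chi> c d e)" "\<chi> c a d = (\<not> \<chi> a c d)" "\<chi> c b e = (\<not> \<chi> b c e)" "\<chi> c a e = (\<not> \<chi> a c e)" "\<chi> c b d = (\<not> \<chi> b c d)"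
    using cyc in_E ne by blast+
  show "ok (\<chi> a b c) (\<chi> c d e) (\<chi> a c d) (\<chi> b c e) (\<chi> a c e) (\<chi> b c d)"
    unfolding ok_def using gp[of c a b d e, OF _ dc] in_E hc by (simp only: insert_subset empty_subsetI simp_thms; argo)
  have dd: "distinct [d, a, b, c, e]" using ne by auto
  have hd: "\<chi> d a b = (\<chi> a b d)" "\<chi> d c e = (\<not> \<chi> c d e)" "\<chi> d a c = (\<chi> a c d)" "\<chi> d b e = (\<not> \<chi> b d e)" "\<chi> d a e = (\<not> \<chi> a d e)" "\<chi> d b c = (\<chi> b c d)"
    using cyc in_E ne by blast+
  show "ok (\<chi> a b d) (\<chi> c d e) (\<chi> a c d) (\<chi> b d e) (\<chi> a d e) (\<chi> b c d)"
    unfolding ok_def using gp[of d a b c e, OF _ dd] in_E hd by (simp only: insert_subset empty_subsetI simp_thms; argo)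
  have de: "distinct [e, a, b, c, d]" using ne by auto
  have he: "\<chi> e a b = (\<chi> a b e)" "\<chi> e c d = (\<chi> c d e)" "\<chi> e a c = (\<chi> a c e)" "\<chi> e b d = (\<chi> b d e)" "\<chi> e a d = (\<chi> a d e)" "\<chi> e b c = (\<chi> b c e)"
    using cyc in_E ne by blast+
  show "ok (\<chi> a b e) (\<chi> c d e) (\<chi> a c e) (\<chi> b d e) (\<chi> a d e) (\<chi> b c e)"
    unfolding ok_def using gp[of e a b c d, OF _ de] in_E he by (simp only: insert_subset empty_subsetI simp_thms; argo)
qed

text \<open>The relation with the terms \<open>\<chi>(abe)\<chi>(fgh)\<close>, \<open>-\<chi>(abf)\<chi>(egh)\<close>, \<open>\<chi>(abg)\<chi>(efh)\<close>,
  \<open>-\<chi>(abh)\<chi>(efg)\<close>, reduced to six three-term relations.\<close>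

lemma four_term_bool:
  fixes abe abf abg abh aef aeg aeh afg afh agh efg efh egh fgh :: bool
  assumes "(abe = afg) = (abf = aeg) \<or> (abe = afg) \<noteq> (abg = aef)"
    and "(abe = afh) = (abf = aeh) \<or> (abe = afh) \<noteq> (abh = aef)"
    and "(abe = agh) = (abg = aeh) \<or> (abe = agh) \<noteq> (abh = aeg)"
    and "(aef = egh) = (aeg = efh) \<or> (aef = egh) \<noteq> (aeh = efg)"
    and "(aef = fgh) = (afg = efh) \<or> (aef = fgh) \<noteq> (afh = efg)"
    and "(aeg = fgh) = (afg = egh) \<or> (aeg = fgh) \<noteq> (agh = efg)"
    and "(abe = fgh) = p" "(abf = egh) = (\<not> p)" "(abg = efh) = p" "(abh = efg) = (\<not> p)"
  shows False
  using assms by argo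

text \<open>This is orthogonality in rank 3: the elements \<open>e\<close>, \<open>f\<close>,
  \<open>g\<close>, \<open>h\<close> carry a circuit with signs \<open>\<chi>(fgh)\<close>,
  \<open>-\<chi>(egh)\<close>, \<open>\<chi>(efh)\<close>, \<open>-\<chi>(efg)\<close>, and its
  products with the cocircuit \<open>\<chi>(a, b, \<cdot>)\<close> cannot all agree.\<close>

lemma four_term:
  assumes "chirotope E \<chi>" "a \<in> E" "b \<in> E" "e \<in> E" "f \<in> E" "g \<in> E" "h \<in> E" "distinct [a, b, e, f, g, h]"
    and "(\<chi> a b e = \<chi> f g h) = p" "(\<chi> a b f = \<chi> e g h) = (\<not> p)"
      "(\<chi> a b g = \<chi> e f h) = p" "(\<chi> a b h = \<chi> e f g) = (\<not> p)"
  shows False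
proof -
  have d: "distinct [a, b, e, f, g]" "distinct [a, b, e, f, h]" "distinct [a, b, e, g, h]" "distinct [a, e, f, g, h]"
    using assms(8) by auto
  note gp = chirotope_gp5[OF assms(1)]
  show False
    by (rule four_term_bool[OF gp(1)[OF assms(2-6) d(1)] gp(1)[OF assms(2-5,7) d(2)] gp(1)[OF assms(2-4,6,7) d(3)]
      gp(2)[OF assms(2,4-7) d(4)] gp(3)[OF assms(2,4-7) d(4)] gp(4)[OF assms(2,4-7) d(4)] assms(9-12)])
qed

section \<open>Sign vectors with two zeros and their orthogonality relations\<close>

definition signed :: "'a set \<Rightarrow> ('a \<Rightarrow> 'a \<Rightarrow> 'a \<Rightarrow> bool) \<Rightarrow> bool \<Rightarrow> 'a \<Rightarrow> 'a \<Rightarrow> 'a \<Rightarrow> int" where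
  "signed E \<chi> s a b = (\<lambda>c. if c \<in> E \<and> c \<noteq> a \<and> c \<noteq> b then if \<chi> a b c = s then 1 else - 1 else 0)"

definition circuits :: "'a set \<Rightarrow> ('a \<Rightarrow> 'a \<Rightarrow> 'a \<Rightarrow> bool) \<Rightarrow> ('a \<Rightarrow> int) set" where
  "circuits E \<chi> = {signed E \<chi> True a b | a b. a \<in> E \<and> b \<in> E \<and> a \<noteq> b}"

lemma signed_uminus: "- signed E \<chi> s a b = signed E \<chi> (\<not> s) a b"
  by (auto simp: signed_def fun_eq_iff)

lemma signed_swap:
  assumes "chirotope E \<chi>" "a \<in> E" "b \<in> E" "a \<noteq> b"
  shows "signed E \<chi> s b a = signed E \<chi> (\<not> s) a b"
proof
  fix c
  show "signed E \<chi> s b a c = signed E \<chi> (\<not> s) a b c"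
    using chirotope_cyc(2)[OF assms(1-3), of c] assms by (auto simp: signed_def)
qed

lemma signed_in_circuits:
  assumes "chirotope E \<chi>" "a \<in> E" "b \<in> E" "a \<noteq> b"
  shows "signed E \<chi> s a b \<in> circuits E \<chi>"
  using assms signed_swap[OF assms, of True] unfolding circuits_def by (cases s) (auto, metis)

lemma supp_signed: "supp (signed E \<chi> s a b) = E - {a, b}"
  by (auto simp: supp_def signed_def)

text \<open>The case of a vector with zeros \<open>f\<close> and \<open>b\<close>. If
  \<open>g\<close> or \<open>h\<close> is the other zero, alternation alone gives the claim;
  otherwise the relation centred at \<open>f\<close> decides.\<close>

lemma orthogonal_through:
  assumes \<chi>: "chirotope E \<chi>" and in_E: "b \<in> E" "e \<in> E" "f \<in> E" "g \<in> E" "h \<in> E"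
    and ne: "f \<noteq> b" "e \<noteq> b" "distinct [e, f, g, h]"
    and s: "g = b \<or> (\<chi> f b g = x) = s g" "h = b \<or> (\<chi> f b h = x) = s h"
    and m: "\<chi> e f g = ((s f = s g) = m)" "\<chi> e g h = ((s g = s h) = m)" "\<chi> e h f = ((s h = s f) = m)"
  shows "(\<chi> f g h = (\<chi> f b e = x)) = (((s f = s g) = s h) = m)"
proof -
  note cyc = chirotope_cyc[OF \<chi>]
  have d: "e \<noteq> f" "e \<noteq> g" "e \<noteq> h" "f \<noteq> g" "f \<noteq> h" "g \<noteq> h" using ne by auto
  have feg: "\<chi> f e g = (\<not> \<chi> e f g)" and feh: "\<chi> f e h = \<chi> e h f"
    and fge: "\<chi> f g e = \<chi> e f g" and fhe: "\<chi> f h e = (\<not> \<chi> e h f)" and fhg: "\<chi> f h g = (\<not> \<chi> f g h)"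
    using cyc(2)[of e f g] cyc(3)[of e h f] cyc(1)[of e f g] cyc(5)[of e h f] cyc(4)[of f g h] in_E d by blast+
  consider "g = b" "h \<noteq> b" | "h = b" "g \<noteq> b" | "g \<noteq> b" "h \<noteq> b" using d by auto
  then show ?thesis
  proof cases
    case 1
    then have "(\<chi> f g h = x) = s h" "\<chi> f b e = \<chi> e f g" using s fge by auto
    then show ?thesis using m by argo
  next
    case 2
    then have "(\<chi> f h g = x) = s g" "\<chi> f b e = \<chi> f h e" using s by auto
    then show ?thesis using m fhe fhg by argo
  next
    case 3
    then have "(\<chi> f b g = x) = s g" "(\<chi> f b h = x) = s h" using s by auto
    moreover have "(\<chi> f b e = \<chi> f g h) = (\<chi> f b g = \<chi> f e h) \<or> (\<chi> f b e = \<chi> f g h) \<noteq> (\<chi> f b h = \<chi> f e g)"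
      by (rule chirotope_gp[OF \<chi>]) (use in_E ne d 3 in auto)
    ultimately show ?thesis using m feg feh by argo
  qed
qed

text \<open>The hypotheses \<open>m\<close> give the nonzero terms among those of \<open>f\<close>,
  \<open>g\<close>, \<open>h\<close> in the orthogonality relation one common sign. The term of
  \<open>e\<close> must have the other sign, and this determines \<open>\<chi> f g h\<close>. At a
  zero of the vector the value of \<open>s\<close> is free.\<close>

lemma orthogonal:
  assumes \<chi>: "chirotope E \<chi>" and in_E: "a \<in> E" "b \<in> E" "e \<in> E" "f \<in> E" "g \<in> E" "h \<in> E"
    and ne: "a \<noteq> b" "e \<noteq> a" "e \<noteq> b" "distinct [e, f, g, h]"
    and s: "\<And>z. z \<in> {f, g, h} \<Longrightarrow> z = a \<or> z = b \<or> (\<chi> a b z = x) = s z"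
    and m: "\<chi> e f g = ((s f = s g) = m)" "\<chi> e g h = ((s g = s h) = m)" "\<chi> e h f = ((s h = s f) = m)"
  shows "(\<chi> f g h = (\<chi> a b e = x)) = (((s f = s g) = s h) = m)"
proof -
  note cyc = chirotope_cyc[OF \<chi>]
  have d: "distinct [e, g, h, f]" "distinct [e, h, f, g]" using ne by auto
  have rot: "\<chi> g h f = \<chi> f g h" "\<chi> h f g = \<chi> f g h"
    using cyc(1)[of f g h] cyc(3)[of f g h] in_E ne by auto
  have sw: "\<chi> b a z = (\<not> \<chi> a b z)" if "z \<in> {e, f, g, h}" "z \<noteq> a" "z \<noteq> b" for z
    using cyc(2)[of a b z] in_E ne that by auto
  have swe: "\<chi> b a e = (\<not> \<chi> a b e)" using sw ne by auto
  have s': "z = a \<or> z = b \<or> (\<chi> b a z = (\<not> x)) = s z" if "z \<in> {f, g, h}" for z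
    using s[OF that] sw[of z] that by auto
  \<comment> \<open>A rotation of \<open>f\<close>, \<open>g\<close>, \<open>h\<close> moves a zero
    to the front; \<open>f'\<close>, \<open>g'\<close>, \<open>h'\<close> keep the original triple,
    so that the hypotheses on \<open>s\<close> are passed on unpermuted.\<close>
  have through: "(\<chi> f g h = (\<chi> a b e = x)) = (((s f = s g) = s h) = m)"
    if "f \<in> {a, b}" "distinct [e, f, g, h]" "f \<in> E" "g \<in> E" "h \<in> E"
      "\<chi> e f g = ((s f = s g) = m)" "\<chi> e g h = ((s g = s h) = m)" "\<chi> e h f = ((s h = s f) = m)"
      "{g, h} \<subseteq> {f', g', h'}" "{f', g', h'} = {f, g, h}" "\<And>z. z \<in> {f', g', h'} \<Longrightarrow> z = a \<or> z = b \<or> (\<chi> a b z = x) = s z"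
      "\<And>z. z \<in> {f', g', h'} \<Longrightarrow> z = a \<or> z = b \<or> (\<chi> b a z = (\<not> x)) = s z"
    for f g h f' g' h'
  proof (cases "f = a")
    case True
    have n: "g \<noteq> a" "h \<noteq> a" using that True by auto
    show ?thesis
      using orthogonal_through[OF \<chi> in_E(2,3) that(3-5), of x s m] that(2,6-8) that(11)[of g] that(11)[of h] that(9) n ne True
      by auto
  next
    case False
    then have fb: "f = b" using that by auto
    have n: "g \<noteq> b" "h \<noteq> b" using that fb by auto
    \<comment> \<open>Exchanging \<open>a\<close> and \<open>b\<close> negates the vector; negating
      \<open>x\<close> as well compensates for it.\<close>
    have "(\<chi> f g h = (\<chi> f a e = (\<not> x))) = (((s f = s g) = s h) = m)"
      by (rule orthogonal_through[OF \<chi> in_E(1,3) that(3-5)])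
        (use that(2,6-8) that(12)[of g] that(12)[of h] that(9) n ne fb in auto)
    then show ?thesis unfolding fb swe by (smt (verit))
  qed
  consider "f \<in> {a, b}" | "g \<in> {a, b}" | "h \<in> {a, b}" | "f \<notin> {a, b}" "g \<notin> {a, b}" "h \<notin> {a, b}" by blast
  then show ?thesis
  proof cases
    case 1
    show ?thesis by (rule through[OF 1 ne(4) in_E(4-6) m, of f g h]) (use s s' in auto)
  next
    case 2
    have "(\<chi> g h f = (\<chi> a b e = x)) = (((s g = s h) = s f) = m)"
      by (rule through[OF 2 d(1) in_E(5,6,4) m(2,3,1), of f g h]) (use s s' in auto)
    then show ?thesis using rot by (smt (verit))
  next
    case 3
    have "(\<chi> h f g = (\<chi> a b e = x)) = (((s h = s f) = s g) = m)"
      by (rule through[OF 3 d(2) in_E(6,4,5) m(3,1,2), of f g h]) (use s s' in auto)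
    then show ?thesis using rot by (smt (verit))
  next
    case 4
    then have s4: "(\<chi> a b f = x) = s f" "(\<chi> a b g = x) = s g" "(\<chi> a b h = x) = s h"
      using s by auto
    have efh: "\<chi> e f h = (\<not> \<chi> e h f)"
      using cyc(4)[of e h f] in_E ne by auto
    have d4: "distinct [a, b, e, f, g, h]" using 4 ne by auto
    show ?thesis
    proof (rule ccontr)
      assume n: "\<not> ?thesis"
      have four: "(\<chi> a b f = \<chi> e g h) = (\<not> (\<chi> a b e = \<chi> f g h))"
        "(\<chi> a b g = \<chi> e f h) = (\<chi> a b e = \<chi> f g h)"
        "(\<chi> a b h = \<chi> e f g) = (\<not> (\<chi> a b e = \<chi> f g h))"
        using s4 m efh n by argo+
      show False by (rule four_term[OF \<chi> in_E d4 refl four])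
    qed
  qed
qed

section \<open>Circuit elimination\<close>

lemma tournament_source:
  assumes "finite P" "P \<noteq> {}"
    and asym: "\<And>x y. x \<in> P \<Longrightarrow> y \<in> P \<Longrightarrow> x \<noteq> y \<Longrightarrow> m y x = (\<not> m x y)"
    and acyc: "\<And>x y z. x \<in> P \<Longrightarrow> y \<in> P \<Longrightarrow> z \<in> P \<Longrightarrow> distinct [x, y, z] \<Longrightarrow> m x y \<Longrightarrow> m y z \<Longrightarrow> m x z"
  shows "\<exists>x\<in>P. \<forall>y\<in>P - {x}. m x y"
  using assms
proof (induction P rule: finite_ne_induct)
  case (singleton x)
  show ?case by simp
next
  case (insert x F)
  have "\<exists>x\<in>F. \<forall>y\<in>F - {x}. m x y"
  proof (rule insert.IH)
    show "m y x = (\<not> m x y)" if "x \<in> F" "y \<in> F" "x \<noteq> y" for x y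
      by (rule insert.prems(1)) (use that in auto)
    show "m x z" if "x \<in> F" "y \<in> F" "z \<in> F" "distinct [x, y, z]" "m x y" "m y z" for x y z
      by (rule insert.prems(2)[of x y z]) (use that in auto)
  qed
  then obtain f where f: "f \<in> F" "\<And>y. y \<in> F \<Longrightarrow> y \<noteq> f \<Longrightarrow> m f y" by blast
  have xf: "x \<noteq> f" using insert.hyps f by auto
  show ?case
  proof (cases "m f x")
    case True
    then show ?thesis using f by blast
  next
    case False
    then have mxf: "m x f" using insert.prems(1)[of f x] xf f(1) by blast
    have "m x y" if y: "y \<in> F" for y
    proof (cases "y = f")
      case False
      show ?thesis
        by (rule insert.prems(2)[of x f y]) (use f y False xf mxf insert.hyps in auto)
    qed (use mxf in simp)
    then show ?thesis by blast
  qed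
qed

lemma signed_eq_1 [simp]:
  "signed E \<chi> s a b c = 1 \<longleftrightarrow> c \<in> E \<and> c \<noteq> a \<and> c \<noteq> b \<and> \<chi> a b c = s"
  "signed E \<chi> s a b c = - 1 \<longleftrightarrow> c \<in> E \<and> c \<noteq> a \<and> c \<noteq> b \<and> \<chi> a b c = (\<not> s)"
  "signed E \<chi> s a b c = 0 \<longleftrightarrow> \<not> (c \<in> E \<and> c \<noteq> a \<and> c \<noteq> b)"
  by (auto simp: signed_def)

lemma pos_signed: "pos (signed E \<chi> s a b) = {c \<in> E - {a, b}. \<chi> a b c = s}"
  and neg_signed: "neg (signed E \<chi> s a b) = {c \<in> E - {a, b}. \<chi> a b c = (\<not> s)}"
  by (auto simp: pos_def neg_def)

text \<open>A circuit eliminating \<open>e\<close> is one through \<open>e\<close> whose signs agree with those prescribed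
  by \<open>X\<close> and \<open>Y\<close>.  On the elements with a prescribed sign the relation \<open>m\<close> below is a
  tournament, and orthogonality to \<open>X\<close> and \<open>Y\<close> forbids cyclic triples; its source works.\<close>

lemma elimination_disjoint:
  assumes \<chi>: "chirotope E \<chi>" and "finite E"
    and in_E: "a \<in> E" "b \<in> E" "c \<in> E" "d \<in> E" "e \<in> E" and dist: "distinct [a, b, c, d, e]"
    and X: "\<chi> a b e = x" and Y: "\<chi> c d e = (\<not> y)"
  obtains f s where "f \<in> E" "f \<noteq> e"
    "\<And>g. g \<in> E - {e, f} \<Longrightarrow> \<chi> e f g = s \<Longrightarrow> g \<notin> {a, b} \<and> \<chi> a b g = x \<or> g \<notin> {c, d} \<and> \<chi> c d g = y"
    "\<And>g. g \<in> E - {e, f} \<Longrightarrow> \<chi> e f g = (\<not> s) \<Longrightarrow> g \<notin> {a, b} \<and> \<chi> a b g = (\<not> x) \<or> g \<notin> {c, d} \<and> \<chi> c d g = (\<not> y)"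
proof -
  note cyc = chirotope_cyc[OF \<chi>]
  \<comment> \<open>\<open>P\<close> collects the zeros of \<open>X\<close> and \<open>Y\<close> and
    the elements where both agree; there \<open>s\<close> is the sign that elimination dictates. On
    \<open>P\<close> outside \<open>{a, b}\<close> the sign of \<open>X\<close> is also that of
    \<open>Y\<close>, unless \<open>Y\<close> vanishes.\<close>
  define P where "P = {g \<in> E - {e}. g \<in> {a, b, c, d} \<or> (\<chi> a b g = x) = (\<chi> c d g = y)}"
  define s where "s g = (if g \<in> {a, b} then \<chi> c d g = y else \<chi> a b g = x)" for g
  define m where "m f g \<longleftrightarrow> \<chi> e f g = (s f = s g)" for f g
  have PE: "z \<in> E \<and> z \<noteq> e" if "z \<in> P" for z using that by (auto simp: P_def)
  have sX: "z = a \<or> z = b \<or> (\<chi> a b z = x) = s z" for z by (auto simp: s_def)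
  have sY: "z = c \<or> z = d \<or> (\<chi> c d z = y) = s z" if "z \<in> P" for z
    using that unfolding P_def s_def by auto
  have asym: "m g f = (\<not> m f g)" if "f \<in> P" "g \<in> P" "f \<noteq> g" for f g
  proof -
    have "\<chi> e g f = (\<not> \<chi> e f g)" using cyc(4)[of e f g] PE that in_E by blast
    then show ?thesis unfolding m_def by blast
  qed
  have "\<exists>f\<in>P. \<forall>g\<in>P - {f}. m f g"
  proof (rule tournament_source)
    show "finite P" using \<open>finite E\<close> by (simp add: P_def)
    show "P \<noteq> {}" using in_E dist by (auto simp: P_def)
    show "m g f = (\<not> m f g)" if "f \<in> P" "g \<in> P" "f \<noteq> g" for f g by (rule asym[OF that])
    show "m f h" if fgh: "f \<in> P" "g \<in> P" "h \<in> P" "distinct [f, g, h]" "m f g" "m g h" for f g h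
    proof (rule ccontr)
      assume "\<not> m f h"
      then have hf: "m h f" using asym[of f h] fgh by auto
      have M: "\<chi> e f g = ((s f = s g) = True)" "\<chi> e g h = ((s g = s h) = True)" "\<chi> e h f = ((s h = s f) = True)"
        using fgh(5,6) hf unfolding m_def by blast+
      have E: "f \<in> E" "g \<in> E" "h \<in> E" and d4: "distinct [e, f, g, h]" using PE fgh by auto
      have n: "a \<noteq> b" "e \<noteq> a" "e \<noteq> b" "c \<noteq> d" "e \<noteq> c" "e \<noteq> d" using dist by auto
      \<comment> \<open>Both vectors give an equation with the same right-hand side, but their signs
        at \<open>e\<close> are opposite.\<close>
      have "(\<chi> f g h = (\<chi> a b e = x)) = (((s f = s g) = s h) = True)"
        by (rule orthogonal[OF \<chi> in_E(1,2,5) E n(1-3) d4 sX M])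
      moreover have "(\<chi> f g h = (\<chi> c d e = y)) = (((s f = s g) = s h) = True)"
        by (rule orthogonal[OF \<chi> in_E(3-5) E n(4-6) d4 sY M]) (use fgh in auto)
      ultimately show False using X Y by blast
    qed
  qed
  then obtain f where f: "f \<in> P" and src: "\<And>g. g \<in> P \<Longrightarrow> g \<noteq> f \<Longrightarrow> \<chi> e f g = (s f = s g)"
    unfolding m_def by blast
  have key: "\<chi> e f g = s f \<longleftrightarrow> s g" if "g \<in> P" "g \<noteq> f" for g using src[OF that] by blast
  show thesis
  proof (rule that)
    show "f \<in> E" "f \<noteq> e" using PE[OF f] by auto
    show "g \<notin> {a, b} \<and> \<chi> a b g = x \<or> g \<notin> {c, d} \<and> \<chi> c d g = y" if "g \<in> E - {e, f}" "\<chi> e f g = s f" for g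
    proof (cases "g \<in> P")
      case True
      then have "s g" using key that by auto
      then show ?thesis using True dist unfolding s_def P_def by (auto split: if_splits)
    qed (use that in \<open>auto simp: P_def\<close>)
    show "g \<notin> {a, b} \<and> \<chi> a b g = (\<not> x) \<or> g \<notin> {c, d} \<and> \<chi> c d g = (\<not> y)"
      if "g \<in> E - {e, f}" "\<chi> e f g = (\<not> s f)" for g
    proof (cases "g \<in> P")
      case True
      then have "\<not> s g" using key that by auto
      then show ?thesis using True dist unfolding s_def P_def by (auto split: if_splits)
    qed (use that in \<open>auto simp: P_def\<close>)
  qed
qed

text \<open>A common zero \<open>a\<close> makes the choice of the new circuit immediate: its zeros
  are \<open>e\<close> and \<open>a\<close>, and every element other than \<open>b\<close> and
  \<open>c\<close> is handled by one relation centred at \<open>a\<close>.\<close>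

lemma elimination_sharing:
  assumes \<chi>: "chirotope E \<chi>"
    and in_E: "a \<in> E" "b \<in> E" "c \<in> E" "e \<in> E" and dist: "distinct [a, b, c, e]"
    and X: "\<chi> a b e = x" and Y: "\<chi> a c e = (\<not> y)"
  obtains s where
    "\<And>g. g \<in> E - {e, a} \<Longrightarrow> \<chi> e a g = s \<Longrightarrow> g \<notin> {a, b} \<and> \<chi> a b g = x \<or> g \<notin> {a, c} \<and> \<chi> a c g = y"
    "\<And>g. g \<in> E - {e, a} \<Longrightarrow> \<chi> e a g = (\<not> s) \<Longrightarrow> g \<notin> {a, b} \<and> \<chi> a b g = (\<not> x) \<or> g \<notin> {a, c} \<and> \<chi> a c g = (\<not> y)"
proof -
  note cyc = chirotope_cyc[OF \<chi>]
  have n: "a \<noteq> b" "a \<noteq> c" "a \<noteq> e" "b \<noteq> c" "b \<noteq> e" "c \<noteq> e" using dist by auto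
  have ea: "\<chi> e a z = (\<not> \<chi> a e z)" if "z \<in> E" "z \<noteq> a" "z \<noteq> e" for z
    using cyc(5)[of z a e] cyc(3)[of z a e] cyc(1)[of z a e] cyc(2)[of a e z] that in_E n by blast
  have acb: "\<chi> a c b = (\<not> \<chi> a b c)" and eab: "\<chi> e a b = \<chi> a b e" and eac: "\<chi> e a c = \<chi> a c e"
    using cyc(4)[of a b c] cyc(3)[of a b e] cyc(3)[of a c e] in_E n by blast+
  \<comment> \<open>The flag is matched to \<open>X\<close> at \<open>c\<close>, where
    \<open>Y\<close> vanishes. As \<open>X\<close> and \<open>Y\<close> are opposite at
    \<open>e\<close>, it then also matches \<open>Y\<close> at \<open>b\<close>, where
    \<open>X\<close> vanishes.\<close>
  define s where "s = (\<chi> e a c = (\<chi> a b c = x))"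
  have sc: "(\<chi> e a c = s) = (\<chi> a b c = x)" by (auto simp: s_def)
  have sb: "(\<chi> e a b = s) = (\<chi> a c b = y)" using acb eab eac X Y by (auto simp: s_def)
  have sg: "(\<chi> e a g = s) = (\<chi> a b g = x)"
    if g: "g \<in> E" "g \<noteq> a" "g \<noteq> b" "g \<noteq> c" "g \<noteq> e" and "(\<chi> a b g = x) = (\<chi> a c g = y)" for g
  proof -
    have "(\<chi> a b c = \<chi> a e g) = (\<chi> a b e = \<chi> a c g) \<or> (\<chi> a b c = \<chi> a e g) \<noteq> (\<chi> a b g = \<chi> a c e)"
      by (rule chirotope_gp[OF \<chi>]) (use in_E n g in auto)
    moreover have "\<chi> e a g = (\<not> \<chi> a e g)" using ea g by blast
    ultimately show ?thesis using that(6) X Y sc eac by argo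
  qed
  show thesis
  proof (rule that)
    fix g assume g: "g \<in> E - {e, a}"
    consider "g = b" | "g = c" | "g \<noteq> b" "g \<noteq> c" by blast
    note cases = this
    show "g \<notin> {a, b} \<and> \<chi> a b g = x \<or> g \<notin> {a, c} \<and> \<chi> a c g = y" if "\<chi> e a g = s"
      using cases
    proof cases
      case 3 then show ?thesis using sg[of g] g that n by blast
    qed (use that sb sc n g in auto)
    show "g \<notin> {a, b} \<and> \<chi> a b g = (\<not> x) \<or> g \<notin> {a, c} \<and> \<chi> a c g = (\<not> y)" if "\<chi> e a g = (\<not> s)"
      using cases
    proof cases
      case 3 then show ?thesis using sg[of g] g that n by blast
    qed (use that sb sc n g in auto)
  qed
qed

lemma circuit_elimination_sharing:
  assumes \<chi>: "chirotope E \<chi>"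
    and in_E: "a \<in> E" "b \<in> E" "c \<in> E" and ne: "a \<noteq> b" "a \<noteq> c" "b \<noteq> c"
    and X: "X = signed E \<chi> x a b" and Y: "Y = signed E \<chi> y a c" and e: "e \<in> pos X \<inter> neg Y"
  shows "\<exists>Z\<in>circuits E \<chi>. pos Z \<subseteq> (pos X \<union> pos Y) - {e} \<and> neg Z \<subseteq> (neg X \<union> neg Y) - {e}"
proof -
  have e': "e \<in> E" "e \<noteq> a" "e \<noteq> b" "e \<noteq> c" "\<chi> a b e = x" "\<chi> a c e = (\<not> y)"
    using e unfolding X Y pos_signed neg_signed by auto
  have d: "distinct [a, b, c, e]" using ne e' by auto
  obtain s where s:
    "\<And>g. g \<in> E - {e, a} \<Longrightarrow> \<chi> e a g = s \<Longrightarrow> g \<notin> {a, b} \<and> \<chi> a b g = x \<or> g \<notin> {a, c} \<and> \<chi> a c g = y"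
    "\<And>g. g \<in> E - {e, a} \<Longrightarrow> \<chi> e a g = (\<not> s) \<Longrightarrow> g \<notin> {a, b} \<and> \<chi> a b g = (\<not> x) \<or> g \<notin> {a, c} \<and> \<chi> a c g = (\<not> y)"
    using elimination_sharing[OF \<chi> in_E e'(1) d e'(5,6)] by metis
  show ?thesis
  proof (intro bexI conjI)
    show "signed E \<chi> s e a \<in> circuits E \<chi>" by (rule signed_in_circuits[OF \<chi>]) (use e' in_E in auto)
    show "pos (signed E \<chi> s e a) \<subseteq> (pos X \<union> pos Y) - {e}"
      using s(1) unfolding X Y pos_signed by blast
    show "neg (signed E \<chi> s e a) \<subseteq> (neg X \<union> neg Y) - {e}"
      using s(2) unfolding X Y neg_signed by blast
  qed
qed

lemma circuits_elimination:
  assumes \<chi>: "chirotope E \<chi>" and "finite E"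
    and "X \<in> circuits E \<chi>" "Y \<in> circuits E \<chi>" "X \<noteq> - Y" and e: "e \<in> pos X \<inter> neg Y"
  shows "\<exists>Z\<in>circuits E \<chi>. pos Z \<subseteq> (pos X \<union> pos Y) - {e} \<and> neg Z \<subseteq> (neg X \<union> neg Y) - {e}"
proof -
  obtain a b where ab: "a \<in> E" "b \<in> E" "a \<noteq> b" and X: "X = signed E \<chi> True a b"
    using assms(3) unfolding circuits_def by blast
  obtain c d where cd: "c \<in> E" "d \<in> E" "c \<noteq> d" and Y: "Y = signed E \<chi> True c d"
    using assms(4) unfolding circuits_def by blast
  \<comment> \<open>With these swapped forms a shared zero can always be brought to the front of
    both pairs.\<close>
  have X': "X = signed E \<chi> False b a" using signed_swap[OF \<chi> ab, of False] X by simp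
  have Y': "Y = signed E \<chi> False d c" using signed_swap[OF \<chi> cd, of False] Y by simp
  have e': "e \<in> E" "e \<noteq> a" "e \<noteq> b" "e \<noteq> c" "e \<noteq> d" "\<chi> a b e = True" "\<chi> c d e = (\<not> True)"
    using e unfolding X Y pos_signed neg_signed by auto
  have "X \<noteq> Y" using e by (auto simp: pos_def neg_def)
  note share = circuit_elimination_sharing[OF \<chi> _ _ _ _ _ _ _ _ e]
  consider "distinct [a, b, c, d, e]" | "a = c" "b = d" | "a = d" "b = c" | "a = c" "b \<noteq> d" | "a = d" "b \<noteq> c"
    | "b = c" "a \<noteq> d" | "b = d" "a \<noteq> c"
    using ab(3) cd(3) e' by force
  then show ?thesis
  proof cases
    case 1
    obtain f s where f: "f \<in> E" "f \<noteq> e" and s: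
      "\<And>g. g \<in> E - {e, f} \<Longrightarrow> \<chi> e f g = s \<Longrightarrow> g \<notin> {a, b} \<and> \<chi> a b g = True \<or> g \<notin> {c, d} \<and> \<chi> c d g = True"
      "\<And>g. g \<in> E - {e, f} \<Longrightarrow> \<chi> e f g = (\<not> s) \<Longrightarrow> g \<notin> {a, b} \<and> \<chi> a b g = (\<not> True) \<or> g \<notin> {c, d} \<and> \<chi> c d g = (\<not> True)"
      using elimination_disjoint[OF \<chi> \<open>finite E\<close> ab(1,2) cd(1,2) e'(1) 1 e'(6,7)] by metis
    show ?thesis
    proof (intro bexI conjI)
      show "signed E \<chi> s e f \<in> circuits E \<chi>" by (rule signed_in_circuits[OF \<chi>]) (use e' f in auto)
      show "pos (signed E \<chi> s e f) \<subseteq> (pos X \<union> pos Y) - {e}"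
        using s(1) unfolding X Y pos_signed by blast
      show "neg (signed E \<chi> s e f) \<subseteq> (neg X \<union> neg Y) - {e}"
        using s(2) unfolding X Y neg_signed by blast
    qed
  next
    case 2 then show ?thesis using X Y \<open>X \<noteq> Y\<close> by simp
  next
    case 3 then have "X = - Y" using X' Y by (simp add: signed_uminus)
    then show ?thesis using assms(5) by simp
  next
    case 4 show ?thesis by (rule share[OF _ _ _ _ _ _ X]) (use 4 Y ab cd in auto)
  next
    case 5 show ?thesis by (rule share[OF _ _ _ _ _ _ X, of c]) (use 5 Y' ab cd in auto)
  next
    case 6 show ?thesis by (rule share[OF _ _ _ _ _ _ X', of d]) (use 6 Y ab cd in auto)
  next
    case 7 show ?thesis by (rule share[OF _ _ _ _ _ _ X', of c]) (use 7 Y' ab cd in auto)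
  qed
qed

section \<open>The uniform oriented matroid of a chirotope\<close>

lemma pair_complements:
  assumes "finite E" "card E = r + 3"
  shows "{E - {a, b} | a b. a \<in> E \<and> b \<in> E \<and> a \<noteq> b} = {A. A \<subseteq> E \<and> card A = r + 1}"
proof (intro subset_antisym subsetI)
  fix A assume "A \<in> {E - {a, b} | a b. a \<in> E \<and> b \<in> E \<and> a \<noteq> b}"
  then obtain a b where "A = E - {a, b}" "a \<in> E" "b \<in> E" "a \<noteq> b" by blast
  then show "A \<in> {A. A \<subseteq> E \<and> card A = r + 1}"
    using assms card_Diff_subset[of "{a, b}" E] by auto
next
  fix A assume "A \<in> {A. A \<subseteq> E \<and> card A = r + 1}"
  then have A: "A \<subseteq> E" "card A = r + 1" by auto
  then have "card (E - A) = 2" using assms card_Diff_subset[of A E] finite_subset[of A E] by auto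
  then obtain a b where "E - A = {a, b}" "a \<noteq> b" by (auto simp: card_2_iff)
  then show "A \<in> {E - {a, b} | a b. a \<in> E \<and> b \<in> E \<and> a \<noteq> b}" using A by blast
qed

theorem circuits_uniform_oriented_matroid:
  assumes \<chi>: "chirotope E \<chi>" and "finite E" "card E = r + 3"
  shows "uniform_oriented_matroid E r (circuits E \<chi>)"
  unfolding uniform_oriented_matroid_def
proof
  have supps: "supp ` circuits E \<chi> = {A. A \<subseteq> E \<and> card A = r + 1}"
  proof -
    have "supp ` circuits E \<chi> = {supp (signed E \<chi> True a b) | a b. a \<in> E \<and> b \<in> E \<and> a \<noteq> b}"
      unfolding circuits_def by blast
    then show ?thesis unfolding supp_signed pair_complements[OF assms(2,3)] .
  qed
  then show "supp ` circuits E \<chi> = {A. A \<subseteq> E \<and> card A = r + 1}" .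
  show "oriented_matroid E (circuits E \<chi>)"
  proof
    show "finite E" by fact
    show "circuits E \<chi> \<subseteq> sign_vectors E"
      unfolding circuits_def sign_vectors_def supp_def signed_def by (auto split: if_splits)
    show "supp X \<noteq> {}" if "X \<in> circuits E \<chi>" for X
      using supps that by (metis (mono_tags, lifting) Suc_eq_plus1 card.empty imageI mem_Collect_eq nat.distinct(1))
    show "- X \<in> circuits E \<chi>" if X: "X \<in> circuits E \<chi>" for X
    proof -
      obtain a b where "a \<in> E" "b \<in> E" "a \<noteq> b" "X = signed E \<chi> True a b"
        using X unfolding circuits_def by blast
      then show ?thesis using signed_in_circuits[OF \<chi>] by (simp add: signed_uminus)
    qed
    show "X = Y \<or> X = - Y" if X: "X \<in> circuits E \<chi>" and Y: "Y \<in> circuits E \<chi>" and sub: "supp X \<subseteq> supp Y" for X Y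
    proof -
      obtain a b where ab: "a \<in> E" "b \<in> E" "a \<noteq> b" and X: "X = signed E \<chi> True a b"
        using X unfolding circuits_def by blast
      obtain c d where cd: "c \<in> E" "d \<in> E" "c \<noteq> d" and Y: "Y = signed E \<chi> True c d"
        using Y unfolding circuits_def by blast
      have "E - {a, b} \<subseteq> E - {c, d}" using sub unfolding X Y supp_signed .
      then have "c = a \<and> d = b \<or> c = b \<and> d = a" using ab cd by blast
      then show ?thesis using X Y signed_swap[OF \<chi> ab, of False] by (auto simp: signed_uminus)
    qed
    show "\<exists>Z\<in>circuits E \<chi>. pos Z \<subseteq> (pos X \<union> pos Y) - {e} \<and> neg Z \<subseteq> (neg X \<union> neg Y) - {e}"
      if "X \<in> circuits E \<chi>" "Y \<in> circuits E \<chi>" "X \<noteq> - Y" "e \<in> pos X \<inter> neg Y" for X Y e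
      by (rule circuits_elimination[OF \<chi> \<open>finite E\<close> that])
  qed
qed

section \<open>From a uniform oriented matroid of corank 3 to a chirotope\<close>

locale corank3 = oriented_matroid E C for E :: "'a set" and C +
  assumes supps: "supp ` C = {E - {a, b} | a b. a \<in> E \<and> b \<in> E \<and> a \<noteq> b}"
begin

text \<open>The circuits of \<open>C\<close> are the cocircuits of the dual, which has rank 3 and
  the pairs as hyperplanes.\<close>

definition cocircuit_at :: "'a \<Rightarrow> 'a \<Rightarrow> ('a \<Rightarrow> int) \<Rightarrow> bool" where
  "cocircuit_at a b X \<longleftrightarrow> X \<in> C \<and> supp X = E - {a, b}"

lemma cocircuit_at_ex: "a \<in> E \<Longrightarrow> b \<in> E \<Longrightarrow> a \<noteq> b \<Longrightarrow> \<exists>X. cocircuit_at a b X"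
proof -
  assume "a \<in> E" "b \<in> E" "a \<noteq> b"
  then have "E - {a, b} \<in> supp ` C" unfolding supps by blast
  then show ?thesis unfolding cocircuit_at_def by (metis imageE)
qed

lemma cocircuit_at_uminus: "cocircuit_at a b X \<Longrightarrow> cocircuit_at a b (- X)"
  using circuit_symmetric by (auto simp: cocircuit_at_def supp_def)

lemma cocircuit_at_swap: "cocircuit_at a b X \<Longrightarrow> cocircuit_at b a X"
  by (auto simp: cocircuit_at_def insert_commute)

lemma cocircuit_at_unique: "cocircuit_at a b X \<Longrightarrow> cocircuit_at a b Y \<Longrightarrow> Y = X \<or> Y = - X"
  using circuit_incomparable[of Y X] by (auto simp: cocircuit_at_def)

lemma cocircuit_at_range: "cocircuit_at a b X \<Longrightarrow> X c = 1 \<or> X c = - 1 \<or> X c = 0"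
  using circuits_sign_vectors unfolding cocircuit_at_def sign_vectors_def by auto

lemma cocircuit_at_values:
  assumes "cocircuit_at a b X"
  shows "c \<in> E \<Longrightarrow> c \<noteq> a \<Longrightarrow> c \<noteq> b \<Longrightarrow> X c = 1 \<or> X c = - 1" and "X a = 0" and "X b = 0" and "c \<notin> E \<Longrightarrow> X c = 0"
  using assms cocircuit_at_range[OF assms, of c] unfolding cocircuit_at_def supp_def by auto

text \<open>Ordinary elimination only bounds the support of \<open>Z\<close>. Here the common zero
  \<open>a\<close> and the eliminated \<open>e\<close> are already two zeros, hence all of them, so
  \<open>Z\<close> is nonzero at \<open>b\<close> and \<open>c\<close>, with the only sign available
  there.\<close>

lemma modular_elimination:
  assumes X: "cocircuit_at a b X" and Y: "cocircuit_at a c Y"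
    and in_E: "a \<in> E" "b \<in> E" "c \<in> E" "e \<in> E" and dist: "distinct [a, b, c, e]"
    and Xe: "X e = - Y e"
  shows "\<exists>Z. cocircuit_at a e Z \<and> Z b = Y b \<and> Z c = X c \<and> (\<forall>f\<in>E - {a, e}. X f = Y f \<longrightarrow> Z f = X f)"
proof -
  have gen: "\<exists>Z. cocircuit_at a e Z \<and> Z b = Y b \<and> Z c = X c \<and> (\<forall>f\<in>E - {a, e}. X f = Y f \<longrightarrow> Z f = X f)"
    if X: "cocircuit_at a b X" and Y: "cocircuit_at a c Y" and X1: "X e = 1" and Y1: "Y e = - 1"
      and d: "distinct [a, b, c, e]" and in_E: "a \<in> E" "b \<in> E" "c \<in> E" "e \<in> E"
    for X Y b c
  proof -
    have e: "e \<in> pos X \<inter> neg Y" using X1 Y1 by (simp add: pos_def neg_def)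
    have "X \<noteq> - Y"
    proof
      assume "X = - Y"
      then have "X b = 0 \<longleftrightarrow> Y b = 0" by simp
      then show False using cocircuit_at_values[OF X] cocircuit_at_values(1)[OF Y, of b] d in_E by auto
    qed
    then obtain Z where Z: "Z \<in> C" "pos Z \<subseteq> (pos X \<union> pos Y) - {e}" "neg Z \<subseteq> (neg X \<union> neg Y) - {e}"
      using circuit_elimination[OF _ _ _ e] X Y unfolding cocircuit_at_def by auto
    have Zr: "Z g = 1 \<or> Z g = - 1 \<or> Z g = 0" for g
      using Z(1) circuits_sign_vectors unfolding sign_vectors_def by auto
    have Zp: "X g = 1 \<or> Y g = 1" "g \<noteq> e" if "Z g = 1" for g using Z(2) that by (auto simp: pos_def)
    have Zn: "X g = - 1 \<or> Y g = - 1" "g \<noteq> e" if "Z g = - 1" for g using Z(3) that by (auto simp: neg_def)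
    have Z0: "Z a = 0" "Z e = 0" "\<And>g. g \<notin> E \<Longrightarrow> Z g = 0"
      using Zr Zp Zn cocircuit_at_values(2,4)[OF X] cocircuit_at_values(2,4)[OF Y] by (metis zero_neq_neg_one zero_neq_one)+
    obtain p q where pq: "supp Z = E - {p, q}" "p \<noteq> q" "p \<in> E" "q \<in> E"
      using imageI[OF Z(1), of supp] unfolding supps by blast
    have "a \<notin> supp Z" "e \<notin> supp Z" using Z0 by (auto simp: supp_def)
    then have "{p, q} = {a, e}" using pq in_E d by auto
    then have Zae: "cocircuit_at a e Z" using Z(1) pq(1) by (simp add: cocircuit_at_def)
    note Zv = cocircuit_at_values(1)[OF Zae]
    have Zb: "Z b = Y b"
      using Zv[of b] Zp(1)[of b] Zn(1)[of b] cocircuit_at_values(3)[OF X] in_E d by auto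
    have Zc: "Z c = X c"
      using Zv[of c] Zp(1)[of c] Zn(1)[of c] cocircuit_at_values(3)[OF Y] in_E d by auto
    have "Z f = X f" if "f \<in> E - {a, e}" "X f = Y f" for f
      using Zv[of f] Zp(1)[of f] Zn(1)[of f] that by auto
    then show ?thesis using Zae Zb Zc by blast
  qed
  have "X e = 1 \<and> Y e = - 1 \<or> X e = - 1 \<and> Y e = 1"
    using cocircuit_at_values(1)[OF X, of e] Xe in_E dist by auto
  then show ?thesis
  proof
    assume "X e = 1 \<and> Y e = - 1"
    then show ?thesis using gen[OF X Y _ _ dist in_E] by blast
  next
    assume *: "X e = - 1 \<and> Y e = 1"
    have "distinct [a, c, b, e]" using dist by auto
    from gen[OF Y X _ _ this in_E(1,3,2,4)] * show ?thesis by metis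
  qed
qed

text \<open>Both claims compare signs in such a way that replacing a circuit by its opposite changes
  nothing. Hence \<open>Y\<close> may be negated so that \<open>X\<close> and \<open>Y\<close> are
  opposite at \<open>e\<close> and elimination applies.\<close>

lemma modular_sign:
  assumes X: "cocircuit_at a b X" and Y: "cocircuit_at a c Y" and Z: "cocircuit_at a e Z"
    and in_E: "a \<in> E" "b \<in> E" "c \<in> E" "e \<in> E" and dist: "distinct [a, b, c, e]"
  shows "(Z b = Z c) \<longleftrightarrow> (X c = Y b) \<noteq> (X e = Y e)"
    and "f \<in> E - {a, b, c, e} \<Longrightarrow> (X e = Y e) \<noteq> (X f = Y f) \<Longrightarrow> (Z c = Z f) = (X c = X f)"
proof -
  have v: "X c = 1 \<or> X c = - 1" "X e = 1 \<or> X e = - 1" "Y b = 1 \<or> Y b = - 1" "Y e = 1 \<or> Y e = - 1"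
    using cocircuit_at_values(1)[OF X] cocircuit_at_values(1)[OF Y] in_E dist by auto
  have vf: "X g = 1 \<or> X g = - 1" "Y g = 1 \<or> Y g = - 1" if "g \<in> E - {a, b, c, e}" for g
    using cocircuit_at_values(1)[OF X, of g] cocircuit_at_values(1)[OF Y, of g] that by auto
  have "\<exists>Y'. cocircuit_at a c Y' \<and> X e = - Y' e \<and> (if X e = Y e then Y' = - Y else Y' = Y)"
    using Y cocircuit_at_uminus[OF Y] v by (cases "X e = Y e") auto
  then obtain Y' where Y': "cocircuit_at a c Y'" "X e = - Y' e" "if X e = Y e then Y' = - Y else Y' = Y"
    by blast
  obtain Z' where Z': "cocircuit_at a e Z'" "Z' b = Y' b" "Z' c = X c"
    "\<And>f. f \<in> E - {a, e} \<Longrightarrow> X f = Y' f \<Longrightarrow> Z' f = X f"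
    using modular_elimination[OF X Y'(1) in_E dist Y'(2)] by blast
  have "Z = Z' \<or> Z = - Z'" using cocircuit_at_unique[OF Z'(1) Z] .
  then have eq: "(Z g = Z h) = (Z' g = Z' h)" for g h by auto
  have "(Y' b = X c) = ((X c = Y b) \<noteq> (X e = Y e))"
    using Y'(3) v(1,3) by (cases "X e = Y e") auto
  then show "(Z b = Z c) \<longleftrightarrow> (X c = Y b) \<noteq> (X e = Y e)"
    unfolding eq Z'(2,3) .
  assume f: "f \<in> E - {a, b, c, e}" and ne: "(X e = Y e) \<noteq> (X f = Y f)"
  have "X f = Y' f" using Y'(3) ne vf[OF f] by (cases "X e = Y e") auto
  then have "Z' f = X f" using Z'(4)[of f] f by blast
  then show "(Z c = Z f) = (X c = X f)" unfolding eq Z'(3) by simp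
qed

text \<open>The signs of the circuits are first fixed on those avoiding \<open>q\<close>, relative to \<open>p\<close>, and
  then on the others through their value at \<open>q\<close>.\<close>

lemma ex_chirotope:
  assumes "q \<in> E" "p \<in> E" "q \<noteq> p"
  shows "\<exists>\<chi>. chirotope E \<chi> \<and> C = circuits E \<chi>"
proof -
  have ex_sign: "\<exists>X. cocircuit_at a b X \<and> (X c = 1 \<longleftrightarrow> v)" if abc: "a \<in> E" "b \<in> E" "c \<in> E" "distinct [a, b, c]" for a b c v
  proof -
    obtain X where X: "cocircuit_at a b X" using cocircuit_at_ex[of a b] abc by auto
    have "X c = 1 \<or> X c = - 1" using cocircuit_at_values(1)[OF X, of c] that by auto
    then show ?thesis using X cocircuit_at_uminus[OF X] by (cases "X c = 1 \<longleftrightarrow> v") auto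
  qed
  \<comment> \<open>\<open>U b\<close> will be the circuit with zeros \<open>q\<close> and
    \<open>b\<close>. The one for \<open>p\<close> is arbitrary and fixes the signs of all others
    through antisymmetry against \<open>p\<close>.\<close>
  obtain Up where Up: "cocircuit_at q p Up" using cocircuit_at_ex[OF assms] by blast
  have "\<forall>b. \<exists>X. b \<in> E \<longrightarrow> b \<noteq> q \<longrightarrow> cocircuit_at q b X \<and> (if b = p then X = Up else X p = 1 \<longleftrightarrow> Up b \<noteq> 1)"
  proof
    fix b
    show "\<exists>X. b \<in> E \<longrightarrow> b \<noteq> q \<longrightarrow> cocircuit_at q b X \<and> (if b = p then X = Up else X p = 1 \<longleftrightarrow> Up b \<noteq> 1)"
    proof (cases "b \<in> E \<and> b \<noteq> q \<and> b \<noteq> p")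
      case True
      then obtain X where "cocircuit_at q b X" "X p = 1 \<longleftrightarrow> Up b \<noteq> 1"
        using ex_sign[of q b p "Up b \<noteq> 1"] assms by auto
      then show ?thesis using True by auto
    qed (use Up in auto)
  qed
  then obtain U where "\<forall>b. b \<in> E \<longrightarrow> b \<noteq> q \<longrightarrow> cocircuit_at q b (U b) \<and> (if b = p then U b = Up else U b p = 1 \<longleftrightarrow> Up b \<noteq> 1)"
    by (rule choice[THEN exE])
  then have U: "\<And>b. b \<in> E \<Longrightarrow> b \<noteq> q \<Longrightarrow> cocircuit_at q b (U b)" and UUp: "U p = Up"
    and U_p: "\<And>b. b \<in> E \<Longrightarrow> b \<noteq> q \<Longrightarrow> b \<noteq> p \<Longrightarrow> U b p = 1 \<longleftrightarrow> U p b \<noteq> 1"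
    using assms by auto
  have Uv: "U b c = 1 \<or> U b c = - 1" if "b \<in> E" "c \<in> E" "distinct [q, b, c]" for b c
    using cocircuit_at_values(1)[OF U] that by auto
  have Up_anti: "U b p = - U p b" if "b \<in> E" "b \<noteq> q" "b \<noteq> p" for b
    using U_p[OF that] Uv[of b p] Uv[of p b] that assms by auto
  have U_anti: "U b c = - U c b" if "b \<in> E" "c \<in> E" "distinct [q, b, c]" for b c
  proof -
    consider "c = p" | "b = p" | "b \<noteq> p" "c \<noteq> p" by blast
    then show ?thesis
    proof cases
      case 3
      then have d: "distinct [q, b, c, p]" using that assms by auto
      \<comment> \<open>Since \<open>U b p = U c p\<close> iff \<open>U p b = U p c\<close>, the
        modular relation with \<open>p\<close> excludes \<open>U b c = U c b\<close>.\<close>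
      have "(U p b = U p c) \<longleftrightarrow> (U b c = U c b) \<noteq> (U b p = U c p)"
        by (rule modular_sign(1)[OF U U U]) (use d that assms in auto)
      then have "U b c \<noteq> U c b" using Up_anti[of b] Up_anti[of c] that 3 by auto
      then show ?thesis using Uv[of b c] Uv[of c b] that by auto
    qed (use Up_anti that in auto)
  qed
  have "\<forall>a b. \<exists>X. a \<in> E \<longrightarrow> b \<in> E \<longrightarrow> distinct [q, a, b] \<longrightarrow> cocircuit_at a b X \<and> (X q = 1 \<longleftrightarrow> U a b = 1)"
  proof (intro allI)
    fix a b
    show "\<exists>X. a \<in> E \<longrightarrow> b \<in> E \<longrightarrow> distinct [q, a, b] \<longrightarrow> cocircuit_at a b X \<and> (X q = 1 \<longleftrightarrow> U a b = 1)"
      using ex_sign[of a b q "U a b = 1"] assms by auto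
  qed
  then obtain W where W: "\<And>a b. a \<in> E \<Longrightarrow> b \<in> E \<Longrightarrow> distinct [q, a, b] \<Longrightarrow> cocircuit_at a b (W a b)"
    and Wo: "\<And>a b. a \<in> E \<Longrightarrow> b \<in> E \<Longrightarrow> distinct [q, a, b] \<Longrightarrow> W a b q = 1 \<longleftrightarrow> U a b = 1"
    by metis
  \<comment> \<open>The normalisation is \<open>V a b q = V q a b\<close>, so that triples
    containing \<open>q\<close> obey the cyclic rule.\<close>
  define V where "V a b = (if a = q then U b else if b = q then - U a else W a b)" for a b
  have V: "cocircuit_at a b (V a b)" if "a \<in> E" "b \<in> E" "a \<noteq> b" for a b
    using U W that cocircuit_at_uminus[OF cocircuit_at_swap[OF U]] by (auto simp: V_def)
  have Vv: "V a b c = 1 \<or> V a b c = - 1" if "a \<in> E" "b \<in> E" "c \<in> E" "distinct [a, b, c]" for a b c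
    using cocircuit_at_values(1)[OF V] that by auto
  have Wo': "W a b q = U a b" if "a \<in> E" "b \<in> E" "distinct [q, a, b]" for a b
    using Wo[OF that] Vv[of a b q] Uv[of a b] that assms by (auto simp: V_def)
  have anti1: "V b a = - V a b" if "a \<in> E" "b \<in> E" "a \<noteq> b" for a b
  proof (cases "a = q \<or> b = q")
    case False
    then have ab: "distinct [q, a, b]" "distinct [q, b, a]" using that by auto
    have "W b a q = - W a b q"
      using Wo'[OF that(2,1) ab(2)] Wo'[OF that(1,2) ab(1)] U_anti[OF that(2,1) ab(2)] by simp
    moreover have "W b a = W a b \<or> W b a = - W a b"
      using cocircuit_at_unique[OF cocircuit_at_swap[OF W[OF that(1,2) ab(1)]] W[OF that(2,1) ab(2)]] .
    moreover have "W a b q \<noteq> 0" using Wo'[OF that(1,2) ab(1)] Uv[OF that(1,2) ab(1)] by auto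
    ultimately show ?thesis using False by (auto simp: V_def)
  qed (use that in \<open>auto simp: V_def\<close>)
  have anti2: "V a c b = - V a b c" if "a \<in> E" "b \<in> E" "c \<in> E" "distinct [a, b, c]" for a b c
  proof -
    consider "a = q" | "b = q" | "c = q" | "q \<notin> {a, b, c}" by blast
    then show ?thesis
    proof cases
      case 1 then show ?thesis using U_anti[of b c] that by (auto simp: V_def)
    next
      case 2 then show ?thesis using Wo'[of a c] that by (auto simp: V_def)
    next
      case 3 then show ?thesis using Wo'[of a b] that by (auto simp: V_def)
    next
      case 4
      then have d: "distinct [a, b, c, q]" "distinct [q, a, b]" "distinct [q, a, c]" using that by auto
      \<comment> \<open>For triples avoiding \<open>q\<close>, the modular relation at
        \<open>a\<close> compares \<open>b\<close> and \<open>c\<close> through \<open>q\<close>,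
        where the signs already alternate.\<close>
      have "(V a q b = V a q c) \<longleftrightarrow> (V a b c = V a c b) \<noteq> (V a b q = V a c q)"
        by (rule modular_sign(1)[OF V V V]) (use d that assms in auto)
      moreover have "V a q b = - U a b" "V a q c = - U a c" "V a b q = U a b" "V a c q = U a c"
        using d that Wo'[of a b] Wo'[of a c] by (auto simp: V_def)
      ultimately have "V a b c \<noteq> V a c b" by auto
      then show ?thesis using Vv[of a b c] Vv[of a c b] that by auto
    qed
  qed
  define \<chi> where "\<chi> a b c \<longleftrightarrow> V a b c = 1" for a b c
  have sgn: "signed E \<chi> True a b = V a b" if "a \<in> E" "b \<in> E" "a \<noteq> b" for a b
  proof
    fix c
    show "signed E \<chi> True a b c = V a b c"
      using cocircuit_at_values(1)[OF V[OF that], of c] cocircuit_at_values(2,3)[OF V[OF that]]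
        cocircuit_at_values(4)[OF V[OF that], of c]
      by (cases "c \<in> E") (auto simp: signed_def \<chi>_def)
  qed
  have "chirotope E \<chi>"
    unfolding chirotope_def
  proof (intro conjI ballI impI)
    fix a b c assume abc: "a \<in> E" "b \<in> E" "c \<in> E" "distinct [a, b, c]"
    have "V b a c = - V a b c" using anti1[of a b] abc by auto
    then show "\<chi> b a c = (\<not> \<chi> a b c)" using Vv[OF abc] by (auto simp: \<chi>_def)
    have "V b c a = - V b a c" using anti2[of b a c] abc by auto
    then show "\<chi> b c a = \<chi> a b c" using \<open>V b a c = - V a b c\<close> by (auto simp: \<chi>_def)
  next
    fix a b c d e assume in_E: "a \<in> E" "b \<in> E" "c \<in> E" "d \<in> E" "e \<in> E" and dist: "distinct [a, b, c, d, e]"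
    \<comment> \<open>The second modular relation for circuits with common zero \<open>a\<close> is
      the three-term relation centred at \<open>a\<close>.\<close>
    have "((V a b d = V a c d) \<noteq> (V a b e = V a c e) \<Longrightarrow> (V a d c = V a d e) = (V a b c = V a b e))"
      by (rule modular_sign(2)[OF V V V]) (use in_E dist in auto)
    moreover have "V a d c = - V a c d" using anti2[of a c d] in_E dist by auto
    moreover have "V a b c = 1 \<or> V a b c = - 1" "V a b d = 1 \<or> V a b d = - 1" "V a b e = 1 \<or> V a b e = - 1"
      "V a c d = 1 \<or> V a c d = - 1" "V a c e = 1 \<or> V a c e = - 1" "V a d e = 1 \<or> V a d e = - 1"
      using Vv in_E dist by simp_all
    ultimately show "(\<chi> a b c = \<chi> a d e) = (\<chi> a b d = \<chi> a c e) \<or> (\<chi> a b c = \<chi> a d e) \<noteq> (\<chi> a b e = \<chi> a c d)"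
      unfolding \<chi>_def by (elim disjE) simp_all
  qed
  moreover have "C = circuits E \<chi>"
  proof (intro subset_antisym subsetI)
    fix X assume X: "X \<in> C"
    then obtain a b where ab: "a \<in> E" "b \<in> E" "a \<noteq> b" "supp X = E - {a, b}"
      using imageI[OF X, of supp] unfolding supps by blast
    then have "X = V a b \<or> X = - V a b"
      using cocircuit_at_unique[OF V[OF ab(1-3)], of X] X by (auto simp: cocircuit_at_def)
    then have "X = V a b \<or> X = V b a" using anti1[OF ab(1-3)] by simp
    moreover have "signed E \<chi> True a b \<in> circuits E \<chi>" "signed E \<chi> True b a \<in> circuits E \<chi>"
      unfolding circuits_def using ab(1-3) by blast+
    ultimately show "X \<in> circuits E \<chi>"
      using sgn[OF ab(1-3)] sgn[OF ab(2,1) ab(3)[symmetric]] by auto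
  next
    fix X assume "X \<in> circuits E \<chi>"
    then obtain a b where "a \<in> E" "b \<in> E" "a \<noteq> b" "X = signed E \<chi> True a b"
      unfolding circuits_def by blast
    then show "X \<in> C" using sgn[of a b] V[of a b] by (simp add: cocircuit_at_def)
  qed
  ultimately show ?thesis by blast
qed

end

theorem uniform_oriented_matroid_iff_chirotope:
  assumes "finite E" "card E = r + 3"
  shows "uniform_oriented_matroid E r C \<longleftrightarrow> (\<exists>\<chi>. chirotope E \<chi> \<and> C = circuits E \<chi>)"
proof
  assume "uniform_oriented_matroid E r C"
  then have "oriented_matroid E C" "supp ` C = {E - {a, b} | a b. a \<in> E \<and> b \<in> E \<and> a \<noteq> b}"
    unfolding uniform_oriented_matroid_def pair_complements[OF assms] by auto
  then interpret corank3 E C by (simp add: corank3_def corank3_axioms_def)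
  obtain p q where "p \<in> E" "q \<in> E" "p \<noteq> q"
  proof -
    have "\<not> E \<subseteq> {x}" for x using assms card_mono[of "{x}" E] by auto
    moreover have "E \<noteq> {}" using assms by auto
    ultimately show ?thesis using that by blast
  qed
  then show "\<exists>\<chi>. chirotope E \<chi> \<and> C = circuits E \<chi>" by (rule ex_chirotope)
qed (use circuits_uniform_oriented_matroid assms in blast)

section \<open>Reorientation classes and their invariants\<close>

definition act :: "'a set \<Rightarrow> ('a \<Rightarrow> 'a) \<Rightarrow> 'a sign_vector \<Rightarrow> 'a sign_vector" where
  "act R \<pi> X = reorient R X \<circ> \<pi>"

lemma act_apply: "act R \<pi> X e = (if \<pi> e \<in> R then - X (\<pi> e) else X (\<pi> e))"
  by (simp add: act_def reorient_def)

lemma reorientation_class_act: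
  "reorientation_class E C = {act R \<pi> ` C | R \<pi>. R \<subseteq> E \<and> \<pi> permutes E}"
  by (auto simp: reorientation_class_def act_def)

lemma act_act:
  assumes "\<pi> permutes E"
  shows "act S \<rho> (act R \<pi> X) = act {x. (inv \<pi> x \<in> S) \<noteq> (x \<in> R)} (\<pi> \<circ> \<rho>) X"
  using permutes_inverses[OF assms] by (auto simp: act_apply fun_eq_iff)

lemma act_inverse:
  assumes "\<pi> permutes E"
  shows "act {x. \<pi> x \<in> R} (inv \<pi>) (act R \<pi> X) = X" "act R \<pi> (act {x. \<pi> x \<in> R} (inv \<pi>) X) = X"
  using permutes_inverses[OF assms] by (auto simp: act_apply fun_eq_iff)

lemma reorientation_class_refl: "C \<in> reorientation_class E C"
proof -
  have "act {} id X = X" for X :: "'a \<Rightarrow> int" by (simp add: act_apply fun_eq_iff)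
  then have "C = act {} id ` C" by simp
  then show ?thesis unfolding reorientation_class_act using permutes_id by blast
qed

lemma reorientation_class_trans:
  assumes "D \<in> reorientation_class E C"
  shows "reorientation_class E D \<subseteq> reorientation_class E C"
proof
  fix F assume "F \<in> reorientation_class E D"
  then obtain S \<rho> where S: "S \<subseteq> E" "\<rho> permutes E" and F: "F = act S \<rho> ` D"
    unfolding reorientation_class_act by blast
  obtain R \<pi> where R: "R \<subseteq> E" "\<pi> permutes E" and D: "D = act R \<pi> ` C"
    using assms unfolding reorientation_class_act by blast
  have "F = act {x. (inv \<pi> x \<in> S) \<noteq> (x \<in> R)} (\<pi> \<circ> \<rho>) ` C"
    unfolding F D image_image act_act[OF R(2)] ..
  moreover have "{x. (inv \<pi> x \<in> S) \<noteq> (x \<in> R)} \<subseteq> E"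
    using S(1) R permutes_in_image[OF permutes_inv[OF R(2)]] by auto
  ultimately show "F \<in> reorientation_class E C"
    unfolding reorientation_class_act using permutes_compose[OF S(2) R(2)] by blast
qed

lemma reorientation_class_sym:
  assumes "D \<in> reorientation_class E C"
  shows "C \<in> reorientation_class E D"
proof -
  obtain R \<pi> where R: "R \<subseteq> E" "\<pi> permutes E" and D: "D = act R \<pi> ` C"
    using assms unfolding reorientation_class_act by blast
  have "C = act {x. \<pi> x \<in> R} (inv \<pi>) ` D"
    unfolding D image_image act_inverse[OF R(2)] by simp
  moreover have "{x. \<pi> x \<in> R} \<subseteq> E" using R permutes_in_image[OF R(2)] by auto
  ultimately show ?thesis
    unfolding reorientation_class_act using permutes_inv[OF R(2)] by blast
qed

lemma reorientation_class_eq: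
  "D \<in> reorientation_class E C \<Longrightarrow> reorientation_class E D = reorientation_class E C"
  using reorientation_class_trans reorientation_class_sym by blast

section \<open>Isomorphisms of chirotopes\<close>

definition isomorphism :: "'a set \<Rightarrow> ('a \<Rightarrow> 'a \<Rightarrow> 'a \<Rightarrow> bool) \<Rightarrow> ('a \<Rightarrow> 'a \<Rightarrow> 'a \<Rightarrow> bool) \<Rightarrow> ('a \<Rightarrow> bool) \<Rightarrow> ('a \<Rightarrow> 'a) \<Rightarrow> bool" where
  "isomorphism E \<chi> \<psi> r \<pi> \<longleftrightarrow> \<pi> permutes E \<and>
     (\<forall>a\<in>E. \<forall>b\<in>E. \<forall>c\<in>E. distinct [a, b, c] \<longrightarrow> \<psi> a b c = (((r a = r b) = r c) = \<chi> (\<pi> a) (\<pi> b) (\<pi> c)))"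

lemma isomorphismD:
  assumes "isomorphism E \<chi> \<psi> r \<pi>"
  shows "\<pi> permutes E" and "a \<in> E \<Longrightarrow> b \<in> E \<Longrightarrow> c \<in> E \<Longrightarrow> distinct [a, b, c] \<Longrightarrow>
    \<psi> a b c = (((r a = r b) = r c) = \<chi> (\<pi> a) (\<pi> b) (\<pi> c))"
  using assms unfolding isomorphism_def by blast+

lemma isomorphism_trans:
  assumes "isomorphism E \<chi> \<psi> r \<pi>" "isomorphism E \<psi> \<omega> s \<rho>"
  shows "isomorphism E \<chi> \<omega> (\<lambda>a. s a = r (\<rho> a)) (\<pi> \<circ> \<rho>)"
  unfolding isomorphism_def
proof (intro conjI ballI impI)
  show "\<pi> \<circ> \<rho> permutes E"
    using permutes_compose isomorphismD(1) assms by blast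
  fix a b c assume abc: "a \<in> E" "b \<in> E" "c \<in> E" "distinct [a, b, c]"
  have \<rho>: "\<rho> permutes E" using isomorphismD(1) assms by blast
  have im: "\<rho> a \<in> E" "\<rho> b \<in> E" "\<rho> c \<in> E" "distinct [\<rho> a, \<rho> b, \<rho> c]"
    using abc permutes_in_image[OF \<rho>] inj_eq[OF permutes_inj[OF \<rho>]] by auto
  have "\<omega> a b c = (((s a = s b) = s c) = \<psi> (\<rho> a) (\<rho> b) (\<rho> c))"
    by (rule isomorphismD(2)[OF assms(2) abc])
  moreover have "\<psi> (\<rho> a) (\<rho> b) (\<rho> c) = (((r (\<rho> a) = r (\<rho> b)) = r (\<rho> c)) = \<chi> (\<pi> (\<rho> a)) (\<pi> (\<rho> b)) (\<pi> (\<rho> c)))"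
    by (rule isomorphismD(2)[OF assms(1) im])
  ultimately show "\<omega> a b c = ((((s a = r (\<rho> a)) = (s b = r (\<rho> b))) = (s c = r (\<rho> c))) =
      \<chi> ((\<pi> \<circ> \<rho>) a) ((\<pi> \<circ> \<rho>) b) ((\<pi> \<circ> \<rho>) c))"
    unfolding comp_apply by argo
qed

text \<open>Each of the three products in a relation contains \<open>a\<close> twice and
  \<open>b\<close>, \<open>c\<close>, \<open>d\<close>, \<open>e\<close> once, so a reorientation
  multiplies all three by the same sign.\<close>

lemma isomorphism_chirotope:
  assumes "isomorphism E \<chi> \<psi> r \<pi>" and \<chi>: "chirotope E \<chi>"
  shows "chirotope E \<psi>"
  unfolding chirotope_def
proof (intro conjI ballI impI)
  have \<pi>: "\<pi> permutes E" using isomorphismD(1) assms by blast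
  note iso = isomorphismD(2)[OF assms(1)]
  have \<pi>E: "\<pi> a \<in> E" if "a \<in> E" for a using permutes_in_image[OF \<pi>] that by simp
  have \<pi>i: "\<pi> a = \<pi> b \<longleftrightarrow> a = b" for a b using inj_eq[OF permutes_inj[OF \<pi>]] by auto
  {
    fix a b c assume abc: "a \<in> E" "b \<in> E" "c \<in> E" "distinct [a, b, c]"
    then have perms: "distinct [b, c, a]" "distinct [b, a, c]" by auto
    note e = iso[OF abc] iso[OF abc(2,3,1) perms(1)] iso[OF abc(2,1,3) perms(2)]
    have "\<chi> (\<pi> b) (\<pi> c) (\<pi> a) = \<chi> (\<pi> a) (\<pi> b) (\<pi> c)" "\<chi> (\<pi> b) (\<pi> a) (\<pi> c) = (\<not> \<chi> (\<pi> a) (\<pi> b) (\<pi> c))"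
      using chirotope_cyc(1,2)[OF \<chi> \<pi>E[OF abc(1)] \<pi>E[OF abc(2)] \<pi>E[OF abc(3)]] abc(4) \<pi>i by auto
    then show "\<psi> b c a = \<psi> a b c" "\<psi> b a c = (\<not> \<psi> a b c)" using e by argo+
  }
  fix a b c d e assume in_E: "a \<in> E" "b \<in> E" "c \<in> E" "d \<in> E" "e \<in> E" and dist: "distinct [a, b, c, d, e]"
  let ?x = "\<lambda>b c. \<chi> (\<pi> a) (\<pi> b) (\<pi> c)"
  have gp: "(?x b c = ?x d e) = (?x b d = ?x c e) \<or> (?x b c = ?x d e) \<noteq> (?x b e = ?x c d)"
    by (rule chirotope_gp[OF \<chi>]) (use \<pi>E in_E dist \<pi>i in auto)
  have i: "\<psi> a u v = (((r a = r u) = r v) = ?x u v)" if "u \<in> E" "v \<in> E" "distinct [a, u, v]" for u v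
    using iso in_E(1) that by blast
  have "distinct [a, b, c]" "distinct [a, d, e]" "distinct [a, b, d]" "distinct [a, c, e]" "distinct [a, b, e]" "distinct [a, c, d]"
    using dist by auto
  note j = i[OF in_E(2,3) this(1)] i[OF in_E(4,5) this(2)] i[OF in_E(2,4) this(3)] i[OF in_E(3,5) this(4)]
    i[OF in_E(2,5) this(5)] i[OF in_E(3,4) this(6)]
  show "(\<psi> a b c = \<psi> a d e) = (\<psi> a b d = \<psi> a c e) \<or> (\<psi> a b c = \<psi> a d e) \<noteq> (\<psi> a b e = \<psi> a c d)"
    using gp unfolding j by argo
qed

text \<open>The zeros \<open>\<pi> a\<close>, \<open>\<pi> b\<close> are carried to
  \<open>a\<close>, \<open>b\<close>. An element is reoriented when \<open>r\<close> is false; the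
  signs of the two elements outside the support survive as the global sign
  \<open>r a = r b\<close>.\<close>

lemma isomorphism_circuits:
  assumes "isomorphism E \<chi> \<psi> r \<pi>" and \<chi>: "chirotope E \<chi>"
  shows "circuits E \<psi> \<in> reorientation_class E (circuits E \<chi>)"
proof -
  have \<pi>: "\<pi> permutes E" using isomorphismD(1) assms by blast
  note iso = isomorphismD(2)[OF assms(1)]
  have \<pi>E: "\<pi> a \<in> E \<longleftrightarrow> a \<in> E" for a using permutes_in_image[OF \<pi>] .
  have \<pi>i: "\<pi> a = \<pi> b \<longleftrightarrow> a = b" for a b using inj_eq[OF permutes_inj[OF \<pi>]] by auto
  have \<psi>: "chirotope E \<psi>" by (rule isomorphism_chirotope[OF assms])
  define R where "R = \<pi> ` {e \<in> E. \<not> r e}"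
  have R: "\<pi> e \<in> R \<longleftrightarrow> e \<in> E \<and> \<not> r e" for e
    unfolding R_def using \<pi>i by auto
  have act: "act R \<pi> (signed E \<chi> s (\<pi> a) (\<pi> b)) = signed E \<psi> ((r a = r b) = s) a b"
    if "a \<in> E" "b \<in> E" "a \<noteq> b" for a b s
  proof
    fix c
    show "act R \<pi> (signed E \<chi> s (\<pi> a) (\<pi> b)) c = signed E \<psi> ((r a = r b) = s) a b c"
    proof (cases "c \<in> E \<and> c \<noteq> a \<and> c \<noteq> b")
      case True
      then have "\<psi> a b c = (((r a = r b) = r c) = \<chi> (\<pi> a) (\<pi> b) (\<pi> c))"
        by (intro iso) (use that in auto)
      then show ?thesis using True \<pi>E \<pi>i
        by (cases "r c"; cases "r a"; cases "r b"; cases s) (simp_all add: act_apply R signed_def)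
    qed (auto simp: act_apply signed_def R \<pi>E \<pi>i)
  qed
  have "act R \<pi> ` circuits E \<chi> = circuits E \<psi>"
  proof (intro subset_antisym subsetI)
    fix Y assume "Y \<in> act R \<pi> ` circuits E \<chi>"
    then obtain a' b' where "a' \<in> E" "b' \<in> E" "a' \<noteq> b'" "Y = act R \<pi> (signed E \<chi> True a' b')"
      unfolding circuits_def by blast
    moreover obtain a b where "a' = \<pi> a" "b' = \<pi> b" using permutes_surj[OF \<pi>] by (metis surjD)
    ultimately show "Y \<in> circuits E \<psi>"
      using act[of a b] \<pi>E \<pi>i signed_in_circuits[OF \<psi>] by simp
  next
    fix Y assume "Y \<in> circuits E \<psi>"
    then obtain a b where ab: "a \<in> E" "b \<in> E" "a \<noteq> b" "Y = signed E \<psi> True a b"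
      unfolding circuits_def by blast
    then have "Y = act R \<pi> (signed E \<chi> (r a = r b) (\<pi> a) (\<pi> b))"
      by (subst act) auto
    moreover have "signed E \<chi> (r a = r b) (\<pi> a) (\<pi> b) \<in> circuits E \<chi>"
      by (rule signed_in_circuits[OF \<chi>]) (use ab \<pi>E \<pi>i in auto)
    ultimately show "Y \<in> act R \<pi> ` circuits E \<chi>" by blast
  qed
  moreover have "R \<subseteq> E" using \<pi>E by (auto simp: R_def)
  ultimately show ?thesis unfolding reorientation_class_act using \<pi> by blast
qed

section \<open>Counts invariant under reorientation and relabelling\<close>

definition conformal :: "'a sign_vector set \<Rightarrow> 'a sign_vector \<Rightarrow> nat" where
  "conformal C T = card {X \<in> C. sep T X = {}}"

definition full_vectors :: "'a set \<Rightarrow> 'a sign_vector set" where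
  "full_vectors E = {T \<in> sign_vectors E. supp T = E}"

definition flip :: "'a \<Rightarrow> 'a sign_vector \<Rightarrow> 'a sign_vector" where
  "flip e T = T(e := - T e)"

text \<open>For a cell \<open>T\<close> of the dual arrangement \<open>conformal C T\<close> counts its sides; it is \<open>0\<close> for topes.\<close>

definition edge_invariant :: "'a set \<Rightarrow> 'a sign_vector set \<Rightarrow> nat" where
  "edge_invariant E C =
     (\<Sum>e\<in>E. (\<Sum>T\<in>full_vectors E. (conformal C T * conformal C (flip e T))\<^sup>2)\<^sup>2)"

lemma act_flip:
  assumes "\<pi> permutes E"
  shows "act R \<pi> (flip (\<pi> e) T) = flip e (act R \<pi> T)"
  using inj_eq[OF permutes_inj[OF assms]] by (auto simp: act_apply flip_def fun_eq_iff)

lemma act_sep: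
  assumes "\<pi> permutes E"
  shows "sep (act R \<pi> T) (act R \<pi> X) = \<pi> -` sep T X"
  by (auto simp: sep_def act_apply)

lemma act_inj:
  assumes "\<pi> permutes E"
  shows "inj (act R \<pi>)"
  using act_inverse(1)[OF assms] by (metis injI)

lemma act_full_vectors:
  assumes "\<pi> permutes E"
  shows "act R \<pi> T \<in> full_vectors E \<longleftrightarrow> T \<in> full_vectors E"
proof -
  have sub: "act R \<pi> T \<in> full_vectors E" if "T \<in> full_vectors E" "\<pi> permutes E" for R \<pi> T
  proof -
    have T: "T e = - 1 \<or> T e = 0 \<or> T e = 1" "T e \<noteq> 0 \<longleftrightarrow> e \<in> E" for e
      using that(1) by (auto simp: full_vectors_def sign_vectors_def supp_def)
    have "act R \<pi> T e = - 1 \<or> act R \<pi> T e = 0 \<or> act R \<pi> T e = 1" "act R \<pi> T e \<noteq> 0 \<longleftrightarrow> e \<in> E" for e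
      using T[of "\<pi> e"] permutes_in_image[OF that(2)] by (auto simp: act_apply)
    then show ?thesis by (auto simp: full_vectors_def sign_vectors_def supp_def)
  qed
  show ?thesis
    using sub[OF _ assms] sub[OF _ permutes_inv[OF assms]] act_inverse(1)[OF assms] by metis
qed

lemma act_image_eqI:
  assumes "\<pi> permutes E" "\<And>T. act R \<pi> T \<in> B \<longleftrightarrow> T \<in> A"
  shows "act R \<pi> ` A = B"
proof (intro subset_antisym subsetI)
  fix T assume "T \<in> B"
  then have "act {x. \<pi> x \<in> R} (inv \<pi>) T \<in> A"
    using assms(2)[of "act {x. \<pi> x \<in> R} (inv \<pi>) T"] act_inverse(2)[OF assms(1)] by simp
  then show "T \<in> act R \<pi> ` A" by (rule rev_image_eqI) (simp add: act_inverse(2)[OF assms(1)])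
qed (use assms(2) in blast)

lemma act_image_full_vectors:
  assumes "\<pi> permutes E"
  shows "act R \<pi> ` full_vectors E = full_vectors E"
  by (rule act_image_eqI[OF assms act_full_vectors[OF assms]])

lemma conformal_act:
  assumes "\<pi> permutes E"
  shows "conformal (act R \<pi> ` C) (act R \<pi> T) = conformal C T"
proof -
  have "sep (act R \<pi> T) (act R \<pi> X) = {} \<longleftrightarrow> sep T X = {}" for X
    unfolding act_sep[OF assms] using permutes_surj[OF assms]
    by (metis surj_image_vimage_eq image_empty vimage_empty)
  then have "{X \<in> act R \<pi> ` C. sep (act R \<pi> T) X = {}} = act R \<pi> ` {X \<in> C. sep T X = {}}"
    by auto
  then show ?thesis
    unfolding conformal_def using card_image[OF inj_on_subset[OF act_inj[OF assms]]] by simp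
qed

text \<open>Flipping \<open>\<pi> e\<close> before the action is flipping \<open>e\<close> after it,
  so the inner sums are permuted by \<open>\<pi>\<close> and the outer sum is unchanged.\<close>

lemma edge_invariant_class:
  assumes "D \<in> reorientation_class E C"
  shows "edge_invariant E D = edge_invariant E C"
proof -
  obtain R \<pi> where \<pi>: "\<pi> permutes E" and D: "D = act R \<pi> ` C"
    using assms unfolding reorientation_class_act by blast
  note inj = inj_on_subset[OF act_inj[OF \<pi>] subset_UNIV]
  have "(\<Sum>T\<in>full_vectors E. (conformal D T * conformal D (flip e T))\<^sup>2) =
      (\<Sum>T\<in>full_vectors E. (conformal C T * conformal C (flip (\<pi> e) T))\<^sup>2)" for e
    by (subst act_image_full_vectors[OF \<pi>, of R, symmetric], subst sum.reindex[OF inj])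
      (simp add: act_flip[OF \<pi>, symmetric] D conformal_act[OF \<pi>])
  then have "edge_invariant E D =
      (\<Sum>e\<in>E. (\<Sum>T\<in>full_vectors E. (conformal C T * conformal C (flip (\<pi> e) T))\<^sup>2)\<^sup>2)"
    unfolding edge_invariant_def by simp
  also have "\<dots> = edge_invariant E C"
    unfolding edge_invariant_def using sum.permute[OF \<pi>, of "\<lambda>e. (\<Sum>T\<in>full_vectors E. (conformal C T * conformal C (flip e T))\<^sup>2)\<^sup>2"]
    by (simp add: comp_def)
  finally show ?thesis .
qed

text \<open>The condition on \<open>- X\<close> is the condition on another member of
  \<open>C\<close>. In a simple arrangement all four sign patterns around a crossing occur, so a
  full vector with a conforming circuit is a cell, and its conforming circuits are the vertices of
  that cell.\<close>

lemma topes_conformal: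
  assumes "finite C" "\<And>X. X \<in> C \<Longrightarrow> - X \<in> C"
  shows "topes E C = {T \<in> full_vectors E. conformal C T = 0}"
  using assms by (auto simp: topes_def full_vectors_def conformal_def)

lemma act_topes:
  assumes "\<pi> permutes E"
  shows "act R \<pi> T \<in> topes E (act R \<pi> ` C) \<longleftrightarrow> T \<in> topes E C"
proof -
  have "sep (act R \<pi> T) (act R \<pi> X) = {} \<longleftrightarrow> sep T X = {}" for X
    unfolding act_sep[OF assms] using permutes_surj[OF assms]
    by (metis surj_image_vimage_eq image_empty vimage_empty)
  moreover have "- act R \<pi> X = act R \<pi> (- X)" for X by (auto simp: act_apply fun_eq_iff)
  ultimately show ?thesis
    using act_full_vectors[OF assms, of R T] by (auto simp: topes_def full_vectors_def)
qed

lemma complete_cells_class: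
  assumes "D \<in> reorientation_class E C"
  shows "card (complete_cells E D) = card (complete_cells E C)"
proof -
  obtain R \<pi> where \<pi>: "\<pi> permutes E" and D: "D = act R \<pi> ` C"
    using assms unfolding reorientation_class_act by blast
  have "act R \<pi> T \<in> complete_cells E D \<longleftrightarrow> T \<in> complete_cells E C" for T
  proof -
    have "(\<forall>e\<in>E. flip e (act R \<pi> T) \<in> topes E D) \<longleftrightarrow> (\<forall>e\<in>E. flip (\<pi> e) T \<in> topes E C)"
      unfolding D act_flip[OF \<pi>, symmetric] act_topes[OF \<pi>] ..
    also have "\<dots> \<longleftrightarrow> (\<forall>e\<in>E. flip e T \<in> topes E C)"
      using permutes_image[OF \<pi>] by (metis imageE imageI)
    finally show ?thesis
      unfolding complete_cells_def flip_def[symmetric] by (simp add: D act_topes[OF \<pi>])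
  qed
  then have "act R \<pi> ` complete_cells E C = complete_cells E D"
    by (rule act_image_eqI[OF \<pi>])
  from this[symmetric] show ?thesis
    using card_image[OF inj_on_subset[OF act_inj[OF \<pi>]]] by simp
qed

section \<open>Extending a chirotope by one element\<close>

text \<open>The sign of \<open>(a, b, c)\<close> with \<open>a < b < c\<close> is stored at \<open>t ! c ! a ! (b - a - 1)\<close>; elements are counted
  from \<open>0\<close>, so that an extension by one element appends a matrix.\<close>

type_synonym table = "bool list list list"

fun at :: "'a list \<Rightarrow> nat \<Rightarrow> 'a" where
  "at (x # xs) 0 = x"
| "at (x # xs) (Suc n) = at xs n"

text \<open>Lowering both indices together reaches the offset \<open>b - a - 1\<close> by matching
  alone.\<close>

fun at2 :: "'a list list \<Rightarrow> nat \<Rightarrow> nat \<Rightarrow> 'a" where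
  "at2 (r # rs) 0 (Suc b) = at r b"
| "at2 (r # rs) (Suc a) (Suc b) = at2 rs a b"

definition look :: "table \<Rightarrow> nat \<Rightarrow> nat \<Rightarrow> nat \<Rightarrow> bool" where
  "look t a b c = at2 (at t c) a b"

text \<open>Matching on truth values instead of \<open>if\<close> keeps the simplifier from normalizing \<open>t\<close> again.\<close>

fun get_sorted :: "table \<Rightarrow> nat \<Rightarrow> nat \<Rightarrow> nat \<Rightarrow> bool \<Rightarrow> bool \<Rightarrow> bool \<Rightarrow> bool" where
  "get_sorted t a b c True True _ = look t a b c"
| "get_sorted t a b c True False True = (\<not> look t a c b)"
| "get_sorted t a b c True False False = look t c a b"
| "get_sorted t a b c False _ True = (\<not> look t b a c)"
| "get_sorted t a b c False True False = look t b c a"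
| "get_sorted t a b c False False False = (\<not> look t c b a)"

definition get :: "table \<Rightarrow> nat \<Rightarrow> nat \<Rightarrow> nat \<Rightarrow> bool" where
  "get t a b c = get_sorted t a b c (a < b) (b < c) (a < c)"

definition gp_ok :: "bool \<Rightarrow> bool \<Rightarrow> bool \<Rightarrow> bool \<Rightarrow> bool \<Rightarrow> bool \<Rightarrow> bool" where
  "gp_ok bc de bd ce be cd \<longleftrightarrow> (if bc = de then bd = ce \<or> be \<noteq> cd else bd \<noteq> ce \<or> be = cd)"

lemma gp_ok_iff: "gp_ok bc de bd ce be cd \<longleftrightarrow> (bc = de) = (bd = ce) \<or> (bc = de) \<noteq> (be = cd)"
  unfolding gp_ok_def by auto

text \<open>In an extension by \<open>n\<close>, the signs \<open>\<chi>(i, j, n)\<close> for fixed \<open>i\<close> have to satisfy the relations centred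
  at \<open>i\<close>; \<open>pats (tri (\<chi> i) js)\<close> lists the possible sign vectors over \<open>js\<close>.  As \<open>\<chi>(j, i, n) = - \<chi>(i, j, n)\<close>,
  the choice for the first \<open>i\<close> restricts the lists for the others, where the sign with \<open>i\<close> comes first.\<close>

fun ok1 :: "bool \<Rightarrow> bool \<Rightarrow> bool \<Rightarrow> bool list \<Rightarrow> bool list \<Rightarrow> bool list \<Rightarrow> bool" where
  "ok1 v rk wk (kl # ks) (rl # row) (wl # w) =
     (if gp_ok rk wl rl wk v kl then ok1 v rk wk ks row w else False)"
| "ok1 v rk wk _ _ _ = True"

fun ok :: "bool \<Rightarrow> bool list \<Rightarrow> bool list list \<Rightarrow> bool list \<Rightarrow> bool" where
  "ok v (rk # row) (ks # rows) (wk # w) =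
     (if ok1 v rk wk ks row w then ok v row rows w else False)"
| "ok v _ _ _ = True"

text \<open>Signs are added from the back: a triple is tested when its first element is prepended,
  which discards partial solutions early.\<close>

fun pats :: "bool list list \<Rightarrow> bool list list" where
  "pats [] = [[]]"
| "pats (row # rows) =
     concat (map (\<lambda>w. (if ok True row rows w then [True # w] else []) @
                       (if ok False row rows w then [False # w] else [])) (pats rows))"

fun tri :: "(nat \<Rightarrow> nat \<Rightarrow> bool) \<Rightarrow> nat list \<Rightarrow> bool list list" where
  "tri f [] = []"
| "tri f (j # js) = map (f j) js # tri f js"

fun sel :: "bool \<Rightarrow> bool list list \<Rightarrow> bool list list" where
  "sel x [] = []"
| "sel x ((y # w) # ws) = (if x = y then sel x ws else w # sel x ws)"
| "sel x ([] # ws) = sel x ws"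

fun restr :: "bool list \<Rightarrow> bool list list list \<Rightarrow> bool list list list" where
  "restr (x # v) (Q # Qs) = sel x Q # restr v Qs"
| "restr _ _ = []"

lemma length_restr: "length (restr v Qs) \<le> length Qs"
  by (induction v Qs rule: restr.induct) auto

text \<open>Row \<open>i\<close> of a result holds only the signs with \<open>j > i\<close>, because
  \<open>restr\<close> has removed the earlier ones; the rows thus form the new triangular
  matrix.\<close>

function enum_rows :: "bool list list list \<Rightarrow> bool list list list" where
  "enum_rows [] = [[]]"
| "enum_rows (P # Ps) = concat (map (\<lambda>v. map ((#) v) (enum_rows (restr v Ps))) P)"
  by pat_completeness auto
termination
  by (relation "measure length") (auto simp: length_restr le_imp_less_Suc)

text \<open>Reorienting the new element \<open>n\<close> makes \<open>\<chi>(0, 1, n)\<close> positive.\<close>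

fun normalize_first :: "bool list list list \<Rightarrow> bool list list list" where
  "normalize_first [] = []"
| "normalize_first (P # Ps) = map ((#) True) (sel False P) # Ps"

definition line_patterns :: "nat \<Rightarrow> table \<Rightarrow> nat \<Rightarrow> bool list list" where
  "line_patterns n t i = pats (tri (get t i) (filter (\<lambda>j. j \<noteq> i) [0..<n]))"

definition exts :: "nat \<Rightarrow> table \<Rightarrow> bool list list list" where
  "exts n t = enum_rows (normalize_first (map (line_patterns n t) [0..<n]))"

text \<open>A character between \<open>@\<close> and \<open>O\<close> stands for the number given by its four low bits.  Tables are
  strings of such characters.  A certificate consists of the position of the target among the
  representatives (two characters) and a signed permutation, bit \<open>3\<close> being the minus sign.\<close>

definition num3 :: "bool \<Rightarrow> bool \<Rightarrow> bool \<Rightarrow> nat" where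
  "num3 b0 b1 b2 = (if b2 then if b1 then if b0 then 7 else 6 else if b0 then 5 else 4
                    else if b1 then if b0 then 3 else 2 else if b0 then 1 else 0)"

fun dec :: "char \<Rightarrow> nat" where
  "dec (Char b0 b1 b2 b3 b4 b5 b6 b7) = (if b3 then 8 + num3 b0 b1 b2 else num3 b0 b1 b2)"

fun sdec :: "char \<Rightarrow> bool \<times> nat" where
  "sdec (Char b0 b1 b2 b3 b4 b5 b6 b7) = (\<not> b3, num3 b0 b1 b2)"

fun nibbles :: "string \<Rightarrow> bool list" where
  "nibbles [] = []"
| "nibbles (Char b0 b1 b2 b3 b4 b5 b6 b7 # cs) = b3 # b2 # b1 # b0 # nibbles cs"

text \<open>Padding with \<open>False\<close> gives the decoded table the right shape for every
  string, so the shape lemmas ask nothing of the data.\<close>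

fun take_bits :: "nat \<Rightarrow> bool list \<Rightarrow> bool list" where
  "take_bits 0 xs = []"
| "take_bits (Suc n) [] = False # take_bits n []"
| "take_bits (Suc n) (x # xs) = x # take_bits n xs"

fun drop_bits :: "nat \<Rightarrow> bool list \<Rightarrow> bool list" where
  "drop_bits 0 xs = xs"
| "drop_bits (Suc n) [] = []"
| "drop_bits (Suc n) (x # xs) = drop_bits n xs"

fun cut_rows :: "nat \<Rightarrow> bool list \<Rightarrow> bool list list" where
  "cut_rows 0 bs = []"
| "cut_rows (Suc k) bs = take_bits k bs # cut_rows k (drop_bits k bs)"

fun skip_rows :: "nat \<Rightarrow> bool list \<Rightarrow> bool list" where
  "skip_rows 0 bs = bs"
| "skip_rows (Suc k) bs = skip_rows k (drop_bits k bs)"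

fun cut_table :: "nat \<Rightarrow> nat \<Rightarrow> bool list \<Rightarrow> table" where
  "cut_table c 0 bs = []"
| "cut_table c (Suc n) bs = cut_rows c bs # cut_table (Suc c) n (skip_rows c bs)"

text \<open>There are \<open>n choose 3\<close> signs: 56 for \<open>n = 8\<close>, which is exactly
  14 characters. For smaller \<open>n\<close> the last character may carry surplus low bits.\<close>

definition table_of :: "nat \<Rightarrow> string \<Rightarrow> table" where
  "table_of n s = cut_table 0 n (nibbles s)"

section \<open>Checking certificates\<close>

fun chk_row :: "(nat \<Rightarrow> bool) \<Rightarrow> bool \<Rightarrow> (bool \<times> nat) list \<Rightarrow> bool list \<Rightarrow> bool" where
  "chk_row f s ((sb, b) # g) (x # xs) = (f b = ((s = sb) = x) \<and> chk_row f s g xs)"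
| "chk_row f s g [] = True"
| "chk_row f s [] (x # xs) = False"

fun chk_mat :: "(nat \<Rightarrow> nat \<Rightarrow> bool) \<Rightarrow> bool \<Rightarrow> (bool \<times> nat) list \<Rightarrow> bool list list \<Rightarrow> bool" where
  "chk_mat f s ((sa, a) # g) (r # rs) = (chk_row (f a) (s = sa) g r \<and> chk_mat f s g rs)"
| "chk_mat f s g [] = True"
| "chk_mat f s [] (r # rs) = False"

fun chk_tab :: "(nat \<Rightarrow> nat \<Rightarrow> nat \<Rightarrow> bool) \<Rightarrow> (bool \<times> nat) list \<Rightarrow> (bool \<times> nat) list \<Rightarrow> table \<Rightarrow> bool" where
  "chk_tab f g0 ((sc, c) # g) (m # ms) = (chk_mat (f c) sc g0 m \<and> chk_tab f g0 g ms)"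
| "chk_tab f g0 g [] = True"
| "chk_tab f g0 [] (m # ms) = False"

definition chk_perm :: "nat \<Rightarrow> nat list \<Rightarrow> bool" where
  "chk_perm n h \<longleftrightarrow> length h = n \<and> list_all (\<lambda>i. i < n) h \<and> distinct h"

definition chk_cert :: "nat \<Rightarrow> table \<Rightarrow> (bool \<times> nat) list \<Rightarrow> table \<Rightarrow> bool" where
  "chk_cert n t g u \<longleftrightarrow> chk_perm n (map snd g) \<and> chk_tab (get t) g g u"

fun pick :: "'a list \<Rightarrow> nat \<Rightarrow> 'a list" where
  "pick [] n = []"
| "pick (x # xs) 0 = [x]"
| "pick (x # xs) (Suc n) = pick xs n"

fun chk_target :: "nat \<Rightarrow> table \<Rightarrow> (bool \<times> nat) list \<Rightarrow> string list \<Rightarrow> bool" where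
  "chk_target n t g [] = False"
| "chk_target n t g (s # ss) = chk_cert n t g (table_of n s)"

fun chk_leaf :: "nat \<Rightarrow> (nat \<Rightarrow> string list) \<Rightarrow> table \<Rightarrow> string \<Rightarrow> bool" where
  "chk_leaf n reps t (i # j # g) = chk_target n t (map sdec g) (pick (reps (dec i)) (dec j))"
| "chk_leaf n reps t _ = False"

fun chk_leaves :: "nat \<Rightarrow> (nat \<Rightarrow> string list) \<Rightarrow> table \<Rightarrow> bool list list list \<Rightarrow> string list \<Rightarrow> bool" where
  "chk_leaves n reps t (m # ms) (c # cs) =
     (chk_leaf (Suc n) reps (t @ [m]) c \<and> chk_leaves n reps t ms cs)"
| "chk_leaves n reps t [] _ = True"
| "chk_leaves n reps t (m # ms) [] = False"

definition chk_exts :: "nat \<Rightarrow> (nat \<Rightarrow> string list) \<Rightarrow> table \<Rightarrow> string list \<Rightarrow> bool" where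
  "chk_exts n reps t cs = chk_leaves n reps t (exts n t) cs"

text \<open>Only coverage is recorded. That the final tables are chirotopes and pairwise
  inequivalent is read off \<open>rep_table\<close>.\<close>

definition complete_reps :: "nat \<Rightarrow> (nat \<Rightarrow> string list) \<Rightarrow> bool" where
  "complete_reps n reps \<longleftrightarrow> (\<forall>\<chi>. chirotope {..<n} \<chi> \<longrightarrow>
     (\<exists>i. \<exists>s\<in>set (reps i). \<exists>r \<pi>. isomorphism {..<n} \<chi> (get (table_of n s)) r \<pi>))"

section \<open>Soundness of the certificate check\<close>

lemma get_alternating:
  assumes "distinct [a, b, c]"
  shows "get t b c a = get t a b c" "get t b a c = (\<not> get t a b c)"
proof -
  consider "a < b" "b < c" | "a < c" "c < b" | "b < a" "a < c" | "b < c" "c < a" | "c < a" "a < b" | "c < b" "b < a"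
    using assms by (metis distinct_length_2_or_more nat_neq_iff)
  then show "get t b c a = get t a b c" "get t b a c = (\<not> get t a b c)"
    by (cases; simp add: get_def)+
qed

lemma get_lt: "a < b \<Longrightarrow> b < c \<Longrightarrow> get t a b c = look t a b c"
  by (simp add: get_def)

text \<open>Alternating sign maps are determined by increasing triples, and these are the only ones
  that a table stores.\<close>

lemma alternating_eqI:
  fixes F G :: "nat \<Rightarrow> nat \<Rightarrow> nat \<Rightarrow> bool"
  assumes F: "\<And>a b c. a < n \<Longrightarrow> b < n \<Longrightarrow> c < n \<Longrightarrow> distinct [a, b, c] \<Longrightarrow> F b c a = F a b c \<and> F b a c = (\<not> F a b c)"
    and G: "\<And>a b c. a < n \<Longrightarrow> b < n \<Longrightarrow> c < n \<Longrightarrow> distinct [a, b, c] \<Longrightarrow> G b c a = G a b c \<and> G b a c = (\<not> G a b c)"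
    and eq: "\<And>a b c. a < b \<Longrightarrow> b < c \<Longrightarrow> c < n \<Longrightarrow> F a b c = G a b c"
    and abc: "a < n" "b < n" "c < n" "distinct [a, b, c]"
  shows "F a b c = G a b c"
proof -
  have ne: "a \<noteq> b" "a \<noteq> c" "b \<noteq> c" using abc by auto
  have F': "F b c a = F a b c" "F b a c = (\<not> F a b c)" "F c a b = F a b c" "F a c b = (\<not> F a b c)" "F c b a = (\<not> F a b c)"
    using F[of a b c] F[of b c a] F[of c a b] abc ne by auto
  have G': "G b c a = G a b c" "G b a c = (\<not> G a b c)" "G c a b = G a b c" "G a c b = (\<not> G a b c)" "G c b a = (\<not> G a b c)"
    using G[of a b c] G[of b c a] G[of c a b] abc ne by auto
  consider "a < b" "b < c" | "a < c" "c < b" | "b < a" "a < c" | "b < c" "c < a" | "c < a" "a < b" | "c < b" "b < a"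
    using ne by (metis nat_neq_iff)
  then show ?thesis
    by cases (use eq abc F' G' in blast)+
qed

lemma at_nth: "i < length xs \<Longrightarrow> at xs i = xs ! i"
  by (induction xs i rule: at.induct) auto

lemma at2_nth: "a < b \<Longrightarrow> a < length rs \<Longrightarrow> b - Suc a < length (rs ! a) \<Longrightarrow> at2 rs a b = rs ! a ! (b - Suc a)"
  by (induction rs a b rule: at2.induct) (auto simp: at_nth)

lemma length_take_bits [simp]: "length (take_bits k bs) = k"
  by (induction k bs rule: take_bits.induct) auto

lemma length_cut_rows [simp]: "length (cut_rows k bs) = k"
  by (induction k arbitrary: bs) auto

lemma length_cut_rows_nth: "a < k \<Longrightarrow> length (cut_rows k bs ! a) = k - Suc a"
  by (induction k arbitrary: a bs) (auto simp: nth_Cons split: nat.split)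

lemma length_cut_table [simp]: "length (cut_table c n bs) = n"
  by (induction n arbitrary: c bs) auto

lemma cut_table_nth: "i < n \<Longrightarrow> \<exists>bs'. cut_table c n bs ! i = cut_rows (c + i) bs'"
proof (induction n arbitrary: c bs i)
  case (Suc n)
  show ?case
  proof (cases i)
    case (Suc j)
    then show ?thesis using Suc.IH[of j "Suc c" "skip_rows c bs"] Suc.prems by auto
  qed auto
qed simp

lemma table_of_shape:
  "length (table_of n s) = n"
  "c < n \<Longrightarrow> length (table_of n s ! c) = c"
  "a < c \<Longrightarrow> c < n \<Longrightarrow> length (table_of n s ! c ! a) = c - Suc a"
  using cut_table_nth[of c n 0 "nibbles s"] length_cut_rows_nth[of a c]
  by (auto simp: table_of_def)

lemma look_table:
  assumes "a < b" "b < c" "c < length t" "length (t ! c) = c" "length (t ! c ! a) = c - Suc a"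
  shows "look t a b c = t ! c ! a ! (b - Suc a)"
  using assms by (simp add: look_def at_nth at2_nth)

lemma chk_rowD: "chk_row f s g xs \<Longrightarrow> i < length xs \<Longrightarrow> i < length g \<and> f (snd (g ! i)) = ((s = fst (g ! i)) = xs ! i)"
proof (induction f s g xs arbitrary: i rule: chk_row.induct)
  case (1 f s sb b g x xs)
  then show ?case by (cases i) auto
qed auto

lemma chk_matD: "chk_mat f s g rs \<Longrightarrow> a < length rs \<Longrightarrow>
  a < length g \<and> chk_row (f (snd (g ! a))) (s = fst (g ! a)) (drop (Suc a) g) (rs ! a)"
proof (induction f s g rs arbitrary: a rule: chk_mat.induct)
  case (1 f s sa a' g r rs)
  then show ?case by (cases a) auto
qed auto

lemma chk_tabD: "chk_tab f g0 g ms \<Longrightarrow> c < length ms \<Longrightarrow>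
  c < length g \<and> chk_mat (f (snd (g ! c))) (fst (g ! c)) g0 (ms ! c)"
proof (induction f g0 g ms arbitrary: c rule: chk_tab.induct)
  case (1 f g0 sc c' g m ms)
  then show ?case by (cases c) auto
qed auto

lemma chk_perm_permutes:
  assumes "chk_perm n h"
  shows "(\<lambda>i. if i < n then h ! i else i) permutes {..<n}"
proof (rule bij_imp_permutes)
  have h: "length h = n" "distinct h" "\<And>i. i < n \<Longrightarrow> h ! i < n"
    using assms by (auto simp: chk_perm_def list_all_length)
  have inj: "inj_on (\<lambda>i. if i < n then h ! i else i) {..<n}"
    using h(1,2) by (auto simp: inj_on_def nth_eq_iff_index_eq)
  moreover have "(\<lambda>i. if i < n then h ! i else i) ` {..<n} = {..<n}"
    by (rule endo_inj_surj[OF _ _ inj]) (use h(3) in auto)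
  ultimately show "bij_betw (\<lambda>i. if i < n then h ! i else i) {..<n} {..<n}"
    by (simp add: bij_betw_def)
qed auto

lemma chk_cert_isomorphism:
  assumes "chk_cert n t g (table_of n s)"
  shows "\<exists>r \<pi>. isomorphism {..<n} (get t) (get (table_of n s)) r \<pi>"
proof -
  define u where "u = table_of n s"
  define \<pi> where "\<pi> i = (if i < n then map snd g ! i else i)" for i
  define r where "r i = fst (g ! i)" for i
  have perm: "chk_perm n (map snd g)" and tab: "chk_tab (get t) g g u"
    using assms by (auto simp: chk_cert_def u_def)
  have len: "length g = n" using perm by (simp add: chk_perm_def)
  have \<pi>: "\<pi> permutes {..<n}" unfolding \<pi>_def by (rule chk_perm_permutes[OF perm])
  have \<pi>i: "\<pi> a = \<pi> b \<longleftrightarrow> a = b" for a b using inj_eq[OF permutes_inj[OF \<pi>]] by auto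
  have sorted: "get u a b c = (((r a = r b) = r c) = get t (\<pi> a) (\<pi> b) (\<pi> c))" if "a < b" "b < c" "c < n" for a b c
  proof -
    have "chk_mat (get t (\<pi> c)) (r c) g (u ! c)"
      using chk_tabD[OF tab, of c] that len by (auto simp: u_def table_of_shape \<pi>_def r_def)
    then have "chk_row (get t (\<pi> c) (\<pi> a)) (r c = r a) (drop (Suc a) g) (u ! c ! a)"
      using chk_matD[of _ _ _ _ a] that len by (fastforce simp: u_def table_of_shape \<pi>_def r_def)
    then have "get t (\<pi> c) (\<pi> a) (\<pi> b) = (((r c = r a) = r b) = u ! c ! a ! (b - Suc a))"
      using chk_rowD[of _ _ _ _ "b - Suc a"] that len by (fastforce simp: u_def table_of_shape \<pi>_def r_def)
    moreover have "u ! c ! a ! (b - Suc a) = get u a b c"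
      unfolding get_lt[OF that(1,2)] u_def by (rule look_table[symmetric]) (use that in \<open>auto simp: table_of_shape\<close>)
    \<comment> \<open>Tables put the largest index first, so the check reads the rotated triple,
      which has the same sign.\<close>
    moreover have "distinct [\<pi> a, \<pi> b, \<pi> c]" using that by (auto simp: \<pi>i)
    then have "get t (\<pi> c) (\<pi> a) (\<pi> b) = get t (\<pi> a) (\<pi> b) (\<pi> c)"
      using get_alternating(1)[of "\<pi> a" "\<pi> b" "\<pi> c"] get_alternating(1)[of "\<pi> b" "\<pi> c" "\<pi> a"] by auto
    ultimately show ?thesis by argo
  qed
  have "get u a b c = (((r a = r b) = r c) = get t (\<pi> a) (\<pi> b) (\<pi> c))"
    if "a < n" "b < n" "c < n" "distinct [a, b, c]" for a b c
  proof (rule alternating_eqI[of n "get u" "\<lambda>a b c. (((r a = r b) = r c) = get t (\<pi> a) (\<pi> b) (\<pi> c))"])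
    fix a b c assume d: "distinct [a, b, c :: nat]"
    then show "get u b c a = get u a b c \<and> get u b a c = (\<not> get u a b c)"
      using get_alternating by blast
    have "distinct [\<pi> a, \<pi> b, \<pi> c]" using d by (auto simp: \<pi>i)
    note get_alternating[OF this, of t]
    then show "(((r b = r c) = r a) = get t (\<pi> b) (\<pi> c) (\<pi> a)) = (((r a = r b) = r c) = get t (\<pi> a) (\<pi> b) (\<pi> c)) \<and>
      (((r b = r a) = r c) = get t (\<pi> b) (\<pi> a) (\<pi> c)) = (\<not> (((r a = r b) = r c) = get t (\<pi> a) (\<pi> b) (\<pi> c)))"
      by argo
  qed (use that sorted in auto)
  then have "isomorphism {..<n} (get t) (get u) r \<pi>"
    unfolding isomorphism_def using \<pi> by auto
  then show ?thesis unfolding u_def by blast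
qed

lemma set_pick: "set (pick xs n) \<subseteq> set xs"
  by (induction xs n rule: pick.induct) auto

lemma chk_leaf_isomorphism:
  assumes "chk_leaf n reps t c"
  shows "\<exists>i. \<exists>s\<in>set (reps i). \<exists>r \<pi>. isomorphism {..<n} (get t) (get (table_of n s)) r \<pi>"
proof -
  obtain i j g where c: "c = i # j # g" using assms by (cases "(n, reps, t, c)" rule: chk_leaf.cases) auto
  then obtain s ss where s: "pick (reps (dec i)) (dec j) = s # ss" "chk_cert n t (map sdec g) (table_of n s)"
    using assms by (cases "pick (reps (dec i)) (dec j)") auto
  have "s \<in> set (reps (dec i))" using set_pick[of "reps (dec i)" "dec j"] s(1) by auto
  then show ?thesis using chk_cert_isomorphism[OF s(2)] by blast
qed

lemma chk_leavesD: "chk_leaves n reps t ms cs \<Longrightarrow> m \<in> set ms \<Longrightarrow> \<exists>c. chk_leaf (Suc n) reps (t @ [m]) c"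
  by (induction n reps t ms cs rule: chk_leaves.induct) auto

section \<open>Completeness of the enumeration of extensions\<close>

lemma ok1_map:
  assumes "\<And>l. l \<in> set ls \<Longrightarrow> gp_ok (f j k) (u l) (f j l) (u k) (u j) (f k l)"
  shows "ok1 (u j) (f j k) (u k) (map (f k) ls) (map (f j) ls) (map u ls)"
  using assms by (induction ls) auto

lemma ok_map:
  assumes "distinct (j # ks)"
    "\<And>k l. k \<in> set ks \<Longrightarrow> l \<in> set ks \<Longrightarrow> k \<noteq> l \<Longrightarrow> gp_ok (f j k) (u l) (f j l) (u k) (u j) (f k l)"
  shows "ok (u j) (map (f j) ks) (tri f ks) (map u ks)"
  using assms
proof (induction ks)
  case (Cons k ks)
  have "ok1 (u j) (f j k) (u k) (map (f k) ks) (map (f j) ks) (map u ks)"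
    by (rule ok1_map) (use Cons.prems in auto)
  moreover have "ok (u j) (map (f j) ks) (tri f ks) (map u ks)"
    by (rule Cons.IH) (use Cons.prems in auto)
  ultimately show ?case by simp
qed simp

lemma pats_tri:
  assumes "distinct js"
    "\<And>j k l. j \<in> set js \<Longrightarrow> k \<in> set js \<Longrightarrow> l \<in> set js \<Longrightarrow> distinct [j, k, l] \<Longrightarrow>
      gp_ok (f j k) (u l) (f j l) (u k) (u j) (f k l)"
  shows "map u js \<in> set (pats (tri f js))"
  using assms
proof (induction js)
  case (Cons j js)
  have "map u js \<in> set (pats (tri f js))"
    by (rule Cons.IH) (use Cons.prems in auto)
  moreover have "ok (u j) (map (f j) js) (tri f js) (map u js)"
    by (rule ok_map) (use Cons.prems in auto)
  ultimately show ?case by (cases "u j") force+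
qed simp

lemma set_sel: "(\<not> x) # w \<in> set Q \<Longrightarrow> w \<in> set (sel x Q)"
  by (induction x Q rule: sel.induct) auto

lemma restr_map: "restr (map g js) (map F js) = map (\<lambda>j. sel (g j) (F j)) js"
  by (induction js) auto

lemma enum_rows_Cons:
  "v \<in> set P \<Longrightarrow> m \<in> set (enum_rows (restr v Ps)) \<Longrightarrow> v # m \<in> set (enum_rows (P # Ps))"
  by (auto intro!: bexI[of _ v])

text \<open>The lists \<open>F i\<close> run over the undecided columns from \<open>k\<close> on.
  Fixing row \<open>k\<close> removes column \<open>k\<close> from the others, and the entry removed
  from row \<open>i\<close> is the negation of \<open>u k i\<close>, as \<open>sel\<close>
  demands.\<close>

lemma enum_rows_complete:
  assumes "\<And>i j. i < n \<Longrightarrow> j < n \<Longrightarrow> i \<noteq> j \<Longrightarrow> u j i = (\<not> u i j)"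
    and "k \<le> n" "\<And>i. k \<le> i \<Longrightarrow> i < n \<Longrightarrow> map (u i) (filter (\<lambda>j. j \<noteq> i) [k..<n]) \<in> set (F i)"
  shows "map (\<lambda>i. map (u i) [Suc i..<n]) [k..<n] \<in> set (enum_rows (map F [k..<n]))"
  using assms(2,3)
proof (induction "n - k" arbitrary: k F)
  case (Suc d)
  then have k: "k < n" and upt: "[k..<n] = k # [Suc k..<n]" by (auto simp: upt_conv_Cons)
  have "filter (\<lambda>j. j \<noteq> k) [k..<n] = [Suc k..<n]" unfolding upt by (auto simp: filter_id_conv)
  then have "map (u k) [Suc k..<n] \<in> set (F k)" using Suc.prems(2)[of k] k by simp
  moreover have "map (\<lambda>i. map (u i) [Suc i..<n]) [Suc k..<n] \<in>
      set (enum_rows (map (\<lambda>j. sel (u k j) (F j)) [Suc k..<n]))"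
  proof (rule Suc.hyps(1))
    fix i assume i: "Suc k \<le> i" "i < n"
    have "map (u i) (filter (\<lambda>j. j \<noteq> i) [k..<n]) = u i k # map (u i) (filter (\<lambda>j. j \<noteq> i) [Suc k..<n])"
      unfolding upt using i by simp
    moreover have "u i k = (\<not> u k i)" using assms(1)[of k i] i by simp
    ultimately show "map (u i) (filter (\<lambda>j. j \<noteq> i) [Suc k..<n]) \<in> set (sel (u k i) (F i))"
      using Suc.prems(2)[of i] i by (intro set_sel) auto
  qed (use Suc k in auto)
  then have "map (\<lambda>i. map (u i) [Suc i..<n]) [Suc k..<n] \<in>
      set (enum_rows (restr (map (u k) [Suc k..<n]) (map F [Suc k..<n])))"
    by (simp only: restr_map)
  ultimately show ?case unfolding upt list.map by (intro enum_rows_Cons)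
qed simp

text \<open>The relations used are those centred at old elements, so \<open>exts\<close> contains
  all normalised extensions. Any further matrix in it would merely have to be certified as
  well.\<close>

lemma exts_complete:
  assumes \<chi>: "chirotope {..<Suc n} \<chi>" and "n \<ge> 2" and "\<chi> 0 1 n"
    and t: "\<And>a b c. a < n \<Longrightarrow> b < n \<Longrightarrow> c < n \<Longrightarrow> distinct [a, b, c] \<Longrightarrow> get t a b c = \<chi> a b c"
  shows "map (\<lambda>i. map (\<lambda>j. \<chi> i j n) [Suc i..<n]) [0..<n] \<in> set (exts n t)"
proof -
  define F where "F i = (if i = 0 then map ((#) True) (sel False (line_patterns n t 0)) else line_patterns n t i)" for i
  have line: "map (\<lambda>j. \<chi> i j n) (filter (\<lambda>j. j \<noteq> i) [0..<n]) \<in> set (line_patterns n t i)" if i: "i < n" for i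
    unfolding line_patterns_def
  proof (rule pats_tri)
    fix j k l assume jkl: "j \<in> set (filter (\<lambda>j. j \<noteq> i) [0..<n])" "k \<in> set (filter (\<lambda>j. j \<noteq> i) [0..<n])"
      "l \<in> set (filter (\<lambda>j. j \<noteq> i) [0..<n])" "distinct [j, k, l]"
    then have d: "distinct [i, j, k, l, n]" "j < n" "k < n" "l < n" using i by auto
    then have "get t i j k = \<chi> i j k" "get t i j l = \<chi> i j l" "get t i k l = \<chi> i k l"
      using t i by simp_all
    moreover have "(\<chi> i j k = \<chi> i l n) = (\<chi> i j l = \<chi> i k n) \<or> (\<chi> i j k = \<chi> i l n) \<noteq> (\<chi> i j n = \<chi> i k l)"
      by (rule chirotope_gp[OF \<chi>]) (use d i in auto)
    ultimately show "gp_ok (get t i j k) (\<chi> i l n) (get t i j l) (\<chi> i k n) (\<chi> i j n) (get t i k l)"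
      unfolding gp_ok_iff by simp
  qed simp
  have upt: "[0..<n] = 0 # [1..<n]" using assms(2) by (simp add: upt_conv_Cons)
  have F0: "map (\<lambda>j. \<chi> 0 j n) (filter (\<lambda>j. j \<noteq> 0) [0..<n]) \<in> set (F 0)"
  proof -
    have "filter (\<lambda>j. j \<noteq> 0) [0..<n] = [1..<n]" unfolding upt by (auto simp: filter_id_conv)
    moreover have "[1..<n] = 1 # [2..<n]" using assms(2) by (simp add: upt_conv_Cons numeral_2_eq_2)
    ultimately have eq: "map (\<lambda>j. \<chi> 0 j n) (filter (\<lambda>j. j \<noteq> 0) [0..<n]) = True # map (\<lambda>j. \<chi> 0 j n) [2..<n]"
      using assms(3) by simp
    have "0 < n" using assms(2) by simp
    from line[OF this] have "map (\<lambda>j. \<chi> 0 j n) [2..<n] \<in> set (sel False (line_patterns n t 0))"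
      unfolding eq by (intro set_sel) simp
    then show ?thesis unfolding eq F_def by simp
  qed
  have "normalize_first (map (line_patterns n t) [0..<n]) = map F [0..<n]"
    unfolding upt by (simp add: F_def)
  moreover have "map (\<lambda>i. map (\<lambda>j. \<chi> i j n) [Suc i..<n]) [0..<n] \<in> set (enum_rows (map F [0..<n]))"
  proof (rule enum_rows_complete)
    show "\<chi> j i n = (\<not> \<chi> i j n)" if "i < n" "j < n" "i \<noteq> j" for i j
      using chirotope_cyc(2)[OF \<chi>, of i j n] that by auto
    show "map (\<lambda>j. \<chi> i j n) (filter (\<lambda>j. j \<noteq> i) [0..<n]) \<in> set (F i)" if "i < n" for i
      using F0 line[OF that] by (cases "i = 0") (auto simp: F_def)
  qed simp
  ultimately show ?thesis unfolding exts_def by simp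
qed

lemma chirotope_subset:
  assumes \<chi>: "chirotope E \<chi>" and sub: "F \<subseteq> E"
  shows "chirotope F \<chi>"
  unfolding chirotope_def
proof (intro conjI ballI impI)
  fix a b c assume "a \<in> F" "b \<in> F" "c \<in> F" "distinct [a, b, c]"
  then show "\<chi> b c a = \<chi> a b c" "\<chi> b a c = (\<not> \<chi> a b c)"
    using chirotope_cyc(1,2)[OF \<chi>, of a b c] sub by auto
next
  fix a b c d e assume "a \<in> F" "b \<in> F" "c \<in> F" "d \<in> F" "e \<in> F" "distinct [a, b, c, d, e]"
  then show "(\<chi> a b c = \<chi> a d e) = (\<chi> a b d = \<chi> a c e) \<or> (\<chi> a b c = \<chi> a d e) \<noteq> (\<chi> a b e = \<chi> a c d)"
    using sub by (intro chirotope_gp[OF \<chi>]) auto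
qed

text \<open>The isomorphism for the restriction is extended by fixing \<open>n\<close>, whose sign
  remains free and serves to normalise. The relabelled map then extends the table \<open>t\<close>,
  so its new matrix has a certificate, and the two isomorphisms compose.\<close>

lemma complete_reps_Suc:
  assumes "complete_reps n reps" and n: "n \<ge> 2"
    and chk: "\<And>i s. s \<in> set (reps i) \<Longrightarrow> \<exists>cs. chk_exts n reps' (table_of n s) cs"
  shows "complete_reps (Suc n) reps'"
  unfolding complete_reps_def
proof (intro allI impI)
  fix \<chi> :: "nat \<Rightarrow> nat \<Rightarrow> nat \<Rightarrow> bool" assume \<chi>: "chirotope {..<Suc n} \<chi>"
  then have "chirotope {..<n} \<chi>" by (rule chirotope_subset) auto
  then obtain i s r \<pi> where s: "s \<in> set (reps i)" and iso: "isomorphism {..<n} \<chi> (get (table_of n s)) r \<pi>"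
    using assms(1) unfolding complete_reps_def by blast
  define t where "t = table_of n s"
  have \<pi>: "\<pi> permutes {..<n}" using isomorphismD(1)[OF iso] .
  have \<pi>n: "\<pi> n = n" using permutes_not_in[OF \<pi>] by simp
  have \<pi>S: "\<pi> permutes {..<Suc n}" by (rule permutes_subset[OF \<pi>]) auto
  \<comment> \<open>This \<open>v\<close> solves
    \<open>((r 0 = r 1) = v) = \<chi> (\<pi> 0) (\<pi> 1) n\<close>, the condition that the new sign
    at \<open>(0, 1, n)\<close> be positive.\<close>
  define v where "v \<longleftrightarrow> (r 0 = r 1) = \<chi> (\<pi> 0) (\<pi> 1) n"
  define r' where "r' = r(n := v)"
  define \<psi> where "\<psi> a b c \<longleftrightarrow> ((r' a = r' b) = r' c) = \<chi> (\<pi> a) (\<pi> b) (\<pi> c)" for a b c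
  have iso': "isomorphism {..<Suc n} \<chi> \<psi> r' \<pi>"
    unfolding isomorphism_def \<psi>_def using \<pi>S by simp
  have \<psi>: "chirotope {..<Suc n} \<psi>" by (rule isomorphism_chirotope[OF iso' \<chi>])
  have t: "get t a b c = \<psi> a b c" if "a < n" "b < n" "c < n" "distinct [a, b, c]" for a b c
    using isomorphismD(2)[OF iso, of a b c] that unfolding t_def \<psi>_def r'_def by auto
  have "\<psi> 0 1 n" unfolding \<psi>_def r'_def v_def \<pi>n using n by auto
  define m where "m = map (\<lambda>i. map (\<lambda>j. \<psi> i j n) [Suc i..<n]) [0..<n]"
  have m: "m \<in> set (exts n t)" unfolding m_def by (rule exts_complete[OF \<psi> n \<open>\<psi> 0 1 n\<close> t])
  obtain cs where "chk_leaves n reps' t (exts n t) cs"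
    using chk[OF s] unfolding chk_exts_def t_def by blast
  then obtain c where "chk_leaf (Suc n) reps' (t @ [m]) c" using chk_leavesD[OF _ m] by blast
  then obtain i' s' r'' \<pi>' where s': "s' \<in> set (reps' i')"
    and iso2: "isomorphism {..<Suc n} (get (t @ [m])) (get (table_of (Suc n) s')) r'' \<pi>'"
    using chk_leaf_isomorphism by blast
  have len: "length t = n" by (simp add: t_def table_of_shape)
  have "\<psi> a b c = get (t @ [m]) a b c" if "a < Suc n" "b < Suc n" "c < Suc n" "distinct [a, b, c]" for a b c
  proof (rule alternating_eqI[OF _ _ _ that, of \<psi> "get (t @ [m])"])
    fix a b c assume abc: "a < Suc n" "b < Suc n" "c < Suc n" "distinct [a, b, c]"
    show "\<psi> b c a = \<psi> a b c \<and> \<psi> b a c = (\<not> \<psi> a b c)"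
      using chirotope_cyc(1,2)[OF \<psi>, of a b c] abc by auto
    show "get (t @ [m]) b c a = get (t @ [m]) a b c \<and> get (t @ [m]) b a c = (\<not> get (t @ [m]) a b c)"
      using get_alternating[OF abc(4)] by blast
  next
    fix a b c assume abc: "a < b" "b < c" "c < Suc n"
    show "\<psi> a b c = get (t @ [m]) a b c"
    proof (cases "c < n")
      case True
      then have "look (t @ [m]) a b c = look t a b c"
        unfolding look_def using len by (simp add: at_nth nth_append)
      then show ?thesis using t[of a b c] abc True by (simp add: get_lt)
    next
      case False
      then have c: "c = n" using abc by simp
      have "look (t @ [m]) a b n = (t @ [m]) ! n ! a ! (b - Suc a)"
        by (rule look_table) (use abc c len in \<open>auto simp: m_def nth_append\<close>)
      also have "\<dots> = \<psi> a b n" using abc c len by (simp add: m_def nth_append)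
      finally show ?thesis using abc c by (simp add: get_lt)
    qed
  qed
  then have "isomorphism {..<Suc n} \<psi> (get (table_of (Suc n) s')) r'' \<pi>'"
    using iso2 permutes_in_image[OF isomorphismD(1)[OF iso2]] inj_eq[OF permutes_inj[OF isomorphismD(1)[OF iso2]]]
    unfolding isomorphism_def by simp
  from isomorphism_trans[OF iso' this] s'
  show "\<exists>i. \<exists>s\<in>set (reps' i). \<exists>r \<pi>. isomorphism {..<Suc n} \<chi> (get (table_of (Suc n) s)) r \<pi>"
    by blast
qed

text \<open>Two elements carry no triple, so any table represents any sign map.\<close>

lemma complete_reps_2:
  assumes "s \<in> set (reps i)"
  shows "complete_reps 2 reps"
  unfolding complete_reps_def
proof (intro allI impI)
  fix \<chi> :: "nat \<Rightarrow> nat \<Rightarrow> nat \<Rightarrow> bool"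
  have "isomorphism {..<2} \<chi> (get (table_of 2 s)) (\<lambda>_. True) id"
    unfolding isomorphism_def by (auto simp: permutes_id less_2_cases_iff)
  then show "\<exists>i. \<exists>s\<in>set (reps i). \<exists>r \<pi>. isomorphism {..<2} \<chi> (get (table_of 2 s)) r \<pi>"
    using assms by blast
qed

section \<open>Counting conformal circuits\<close>

definition quintuples :: "nat \<Rightarrow> (nat \<times> nat \<times> nat \<times> nat \<times> nat) list" where
  "quintuples n = [(a, b, c, d, e). a \<leftarrow> [0..<n], b \<leftarrow> [Suc a..<n], c \<leftarrow> [Suc b..<n], d \<leftarrow> [Suc c..<n], e \<leftarrow> [Suc d..<n]]"

definition gp5_ok :: "bool \<Rightarrow> bool \<Rightarrow> bool \<Rightarrow> bool \<Rightarrow> bool \<Rightarrow> bool \<Rightarrow> bool \<Rightarrow> bool \<Rightarrow> bool \<Rightarrow> bool \<Rightarrow> bool" where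
  "gp5_ok abc abd abe acd ace ade bcd bce bde cde \<longleftrightarrow>
     gp_ok abc ade abd ace abe acd \<and> gp_ok abc bde abd bce abe bcd \<and> gp_ok abc cde acd bce ace bcd \<and>
     gp_ok abd cde acd bde ade bcd \<and> gp_ok abe cde ace bde ade bce"

fun chk_gp5 :: "table \<Rightarrow> nat \<times> nat \<times> nat \<times> nat \<times> nat \<Rightarrow> bool" where
  "chk_gp5 t (a, b, c, d, e) =
     gp5_ok (look t a b c) (look t a b d) (look t a b e) (look t a c d) (look t a c e) (look t a d e)
       (look t b c d) (look t b c e) (look t b d e) (look t c d e)"

definition chk_gp :: "nat \<Rightarrow> table \<Rightarrow> bool" where
  "chk_gp n t = list_all (chk_gp5 t) (quintuples n)"

text \<open>Adjacent transpositions sort any four arguments, so a property that they preserve need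
  only be tested in increasing order.\<close>

lemma sorted4_symmetric:
  fixes P :: "nat \<Rightarrow> nat \<Rightarrow> nat \<Rightarrow> nat \<Rightarrow> bool"
  assumes sorted: "\<And>b c d e. b \<in> A \<Longrightarrow> c \<in> A \<Longrightarrow> d \<in> A \<Longrightarrow> e \<in> A \<Longrightarrow> b < c \<Longrightarrow> c < d \<Longrightarrow> d < e \<Longrightarrow> P b c d e"
    and swap: "\<And>b c d e. b \<in> A \<Longrightarrow> c \<in> A \<Longrightarrow> d \<in> A \<Longrightarrow> e \<in> A \<Longrightarrow> distinct [b, c, d, e] \<Longrightarrow> P b c d e \<Longrightarrow>
      P c b d e \<and> P b d c e \<and> P b c e d"
    and A: "b \<in> A" "c \<in> A" "d \<in> A" "e \<in> A" and dist: "distinct [b, c, d, e]"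
  shows "P b c d e"
proof -
  have three: "P b c d e" if A: "b \<in> A" "c \<in> A" "d \<in> A" "e \<in> A" and "b < c" "c < d" and e: "e \<notin> {b, c, d}" for b c d e
  proof -
    consider "d < e" | "c < e" "e < d" | "b < e" "e < c" | "e < b"
      using e by (metis insertCI nat_neq_iff)
    then show ?thesis
    proof cases
      case 1 then show ?thesis using sorted that by blast
    next
      case 2
      then have "P b c e d" using sorted that by blast
      then show ?thesis using swap[of b c e d] 2 that by auto
    next
      case 3
      then have "P b e c d" using sorted that by blast
      then have "P b c e d" using swap[of b e c d] 3 that by auto
      then show ?thesis using swap[of b c e d] 3 that by auto
    next
      case 4
      then have "P e b c d" using sorted that by blast
      then have "P b e c d" using swap[of e b c d] 4 that by auto
      then have "P b c e d" using swap[of b e c d] 4 that by auto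
      then show ?thesis using swap[of b c e d] 4 that by auto
    qed
  qed
  have two: "P b c d e" if A: "b \<in> A" "c \<in> A" "d \<in> A" "e \<in> A" and "b < c" and bcde: "distinct [b, c, d, e]" for b c d e
  proof -
    consider "c < d" | "b < d" "d < c" | "d < b"
      using bcde by (metis distinct_length_2_or_more nat_neq_iff)
    then show ?thesis
    proof cases
      case 1 then show ?thesis using three[of b c d e] that by auto
    next
      case 2
      then have "P b d c e" using three[of b d c e] that by auto
      then show ?thesis using swap[of b d c e] 2 that by auto
    next
      case 3
      then have "P d b c e" using three[of d b c e] that by auto
      then have "P b d c e" using swap[of d b c e] 3 that by auto
      then show ?thesis using swap[of b d c e] 3 that by auto
    qed
  qed
  show ?thesis
  proof (cases "b < c")
    case True then show ?thesis using two A dist by blast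
  next
    case False
    then have "P c b d e" using two[of c b d e] A dist by auto
    then show ?thesis using swap[of c b d e] A dist by auto
  qed
qed

lemma gp_ok_not:
  "gp_ok (\<not> bc) de (\<not> bd) ce (\<not> be) cd \<longleftrightarrow> gp_ok bc de bd ce be cd"
  "gp_ok bc de (\<not> bd) (\<not> ce) (\<not> be) (\<not> cd) \<longleftrightarrow> gp_ok bc de bd ce be cd"
  "gp_ok bc (\<not> de) bd (\<not> ce) (\<not> be) cd \<longleftrightarrow> gp_ok bc de bd ce be cd"
  unfolding gp_ok_iff by blast+

lemma chk_gp_chirotope:
  assumes "chk_gp n t"
  shows "chirotope {..<n} (get t)"
  unfolding chirotope_def
proof (intro conjI ballI impI)
  fix a b c :: nat assume "distinct [a, b, c]"
  then show "get t b c a = get t a b c" "get t b a c = (\<not> get t a b c)" using get_alternating by blast+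
next
  fix a b c d e assume in_n: "a \<in> {..<n}" "b \<in> {..<n}" "c \<in> {..<n}" "d \<in> {..<n}" "e \<in> {..<n}"
    and dist: "distinct [a, b, c, d, e]"
  define P where "P b c d e \<longleftrightarrow> gp_ok (get t a b c) (get t a d e) (get t a b d) (get t a c e) (get t a b e) (get t a c d)"
    for b c d e
  have sw: "get t a y x = (\<not> get t a x y)" if "distinct [a, x, y]" for x y
  proof -
    have d: "distinct [x, y, a]" "distinct [y, x, a]" "distinct [x, a, y]" using that by auto
    show ?thesis
      using get_alternating(1)[OF that, of t] get_alternating(2)[OF d(1), of t]
        get_alternating(1)[OF d(2), of t] get_alternating(1)[OF d(3), of t] by blast
  qed
  have "P b c d e"
  proof (rule sorted4_symmetric[of "{..<n} - {a}"])
    fix b c d e assume *: "b \<in> {..<n} - {a}" "c \<in> {..<n} - {a}" "d \<in> {..<n} - {a}" "e \<in> {..<n} - {a}" "b < c" "c < d" "d < e"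
    have chk: "gp5_ok (look t v w x) (look t v w y) (look t v w z) (look t v x y) (look t v x z) (look t v y z)
       (look t w x y) (look t w x z) (look t w y z) (look t x y z)"
      if "v < w" "w < x" "x < y" "y < z" "z < n" for v w x y z
    proof -
      have "(v, w, x, y, z) \<in> set (quintuples n)" 
        by (simp add: quintuples_def, rule bexI[of _ v], rule bexI[of _ w], rule bexI[of _ x], rule bexI[of _ y])
          (use that in auto)
      then have "chk_gp5 t (v, w, x, y, z)" using assms unfolding chk_gp_def list_all_iff by blast
      then show ?thesis by simp
    qed
    \<comment> \<open>The centre \<open>a\<close> takes one of five positions among the increasing
      \<open>b\<close>, \<open>c\<close>, \<open>d\<close>, \<open>e\<close>; moving it to the front
      negates signs in one of the patterns of \<open>gp_ok_not\<close>, or none.\<close>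
    consider "a < b" | "b < a" "a < c" | "c < a" "a < d" | "d < a" "a < e" | "e < a"
      using * by (metis DiffE insertCI nat_neq_iff)
    then show "P b c d e"
    proof cases
      case 1 then show ?thesis unfolding P_def using chk[of a b c d e] * by (simp add: get_def gp5_ok_def)
    next
      case 2 then show ?thesis unfolding P_def using chk[of b a c d e] * by (simp add: get_def gp5_ok_def gp_ok_not)
    next
      case 3 then show ?thesis unfolding P_def using chk[of b c a d e] * by (simp add: get_def gp5_ok_def gp_ok_not)
    next
      case 4 then show ?thesis unfolding P_def using chk[of b c d a e] * by (simp add: get_def gp5_ok_def gp_ok_not)
    next
      case 5 then show ?thesis unfolding P_def using chk[of b c d e a] * in_n(1) by (simp add: get_def gp5_ok_def gp_ok_not)
    qed
  next
    fix b c d e assume *: "b \<in> {..<n} - {a}" "c \<in> {..<n} - {a}" "d \<in> {..<n} - {a}" "e \<in> {..<n} - {a}"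
      "distinct [b, c, d, e]" "P b c d e"
    then have d: "distinct [a, b, c]" "distinct [a, c, d]" "distinct [a, d, e]" by auto
    show "P c b d e \<and> P b d c e \<and> P b c e d"
      using *(6) sw[OF d(1)] sw[OF d(2)] sw[OF d(3)] unfolding P_def gp_ok_iff by argo
  qed (use in_n dist in auto)
  then show "(get t a b c = get t a d e) = (get t a b d = get t a c e) \<or> (get t a b c = get t a d e) \<noteq> (get t a b e = get t a c d)"
    unfolding P_def gp_ok_iff .
qed

text \<open>A trie over the sign vectors counts how many circuits conform to each: \<open>L k\<close> stands for \<open>k + 1\<close>
  and \<open>Z\<close> for an empty subtree.\<close>

datatype trie = Z | L nat | N trie trie

text \<open>A zero of a circuit conforms to both signs, so \<open>None\<close> inserts into both
  subtrees; a circuit with two zeros reaches four leaves.\<close>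

fun ins :: "bool option list \<Rightarrow> trie \<Rightarrow> trie" where
  "ins [] (L k) = L (Suc k)"
| "ins [] t = L 0"
| "ins (None # p) (N l r) = N (ins p l) (ins p r)"
| "ins (None # p) t = N (ins p Z) (ins p Z)"
| "ins (Some True # p) (N l r) = N (ins p l) r"
| "ins (Some True # p) t = N (ins p Z) Z"
| "ins (Some False # p) (N l r) = N l (ins p r)"
| "ins (Some False # p) t = N Z (ins p Z)"

fun entry :: "(nat \<Rightarrow> bool) \<Rightarrow> nat \<Rightarrow> bool \<Rightarrow> bool option" where
  "entry f c True = None"
| "entry f c False = Some (f c)"

definition entry_at :: "(nat \<Rightarrow> bool) \<Rightarrow> nat \<Rightarrow> nat \<Rightarrow> nat \<Rightarrow> bool option" where
  "entry_at f a b c = entry f c (c = a \<or> c = b)"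

fun pattern :: "nat \<Rightarrow> table \<Rightarrow> nat \<times> nat \<Rightarrow> bool option list" where
  "pattern n t (a, b) = map (entry_at (get t a b) a b) [0..<n]"

definition pairs :: "nat \<Rightarrow> (nat \<times> nat) list" where
  "pairs n = filter (\<lambda>(a, b). a \<noteq> b) (List.product [0..<n] [0..<n])"

text \<open>The two orders of a pair give a circuit and its opposite, so the ordered pairs insert
  every circuit exactly once.\<close>

definition conf_trie :: "nat \<Rightarrow> table \<Rightarrow> trie" where
  "conf_trie n t = fold ins (map (pattern n t) (pairs n)) Z"

fun dot :: "trie \<Rightarrow> trie \<Rightarrow> int" where
  "dot (N a b) (N c d) = dot a c + dot b d"
| "dot (L j) (L k) = (int (Suc j) * int (Suc k))\<^sup>2"
| "dot _ _ = 0"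

fun edge_sum :: "nat \<Rightarrow> trie \<Rightarrow> int" where
  "edge_sum 0 (N l r) = dot l r"
| "edge_sum (Suc e) (N l r) = edge_sum e l + edge_sum e r"
| "edge_sum e _ = 0"

definition trie_invariant :: "nat \<Rightarrow> trie \<Rightarrow> int" where
  "trie_invariant n t = sum_list (map (\<lambda>e. (edge_sum e t)\<^sup>2) [0..<n])"

text \<open>A union of supports: only whether a value is zero will be read from the result, so
  either of two leaves may stay.\<close>

fun join :: "trie \<Rightarrow> trie \<Rightarrow> trie" where
  "join Z t = t"
| "join t Z = t"
| "join (N a b) (N c d) = N (join a c) (join b d)"
| "join t u = t"

fun lft :: "trie \<Rightarrow> trie" where "lft (N l r) = l" | "lft _ = Z"
fun rgt :: "trie \<Rightarrow> trie" where "rgt (N l r) = r" | "rgt _ = Z"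

text \<open>\<open>free n t s\<close> counts the positions outside \<open>t\<close> and its flips and outside \<open>s\<close>, which collects the flips
  in the directions already descended.\<close>

fun free :: "nat \<Rightarrow> trie \<Rightarrow> trie \<Rightarrow> int" where
  "free 0 t s = (if t = Z \<and> s = Z then 1 else 0)"
| "free (Suc n) t s = free n (lft t) (join (lft s) (rgt t)) + free n (rgt t) (join (rgt s) (lft t))"

fun val :: "trie \<Rightarrow> bool list \<Rightarrow> nat" where
  "val (L k) [] = Suc k"
| "val (N l r) (b # bs) = val (if b then l else r) bs"
| "val _ _ = 0"

fun depth :: "nat \<Rightarrow> trie \<Rightarrow> bool" where
  "depth n Z = True"
| "depth 0 (L k) = True"
| "depth (Suc n) (N l r) = (depth n l \<and> depth n r)"
| "depth _ _ = False"

fun matches :: "bool option list \<Rightarrow> bool list \<Rightarrow> bool" where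
  "matches [] [] = True"
| "matches (p # ps) (b # bs) = ((p = None \<or> p = Some b) \<and> matches ps bs)"
| "matches _ _ = False"

section \<open>Correctness of the functions on tries\<close>

lemma val_Z [simp]: "val Z bs = 0"
  by (cases bs) auto

lemma depth_0: "depth 0 t \<Longrightarrow> t = Z \<or> (\<exists>k. t = L k)"
  by (cases t) auto

lemma depth_Suc: "depth (Suc n) t \<Longrightarrow> t = Z \<or> (\<exists>l r. t = N l r \<and> depth n l \<and> depth n r)"
  by (cases t) auto

lemma depth_ins: "depth (length p) t \<Longrightarrow> depth (length p) (ins p t)"
  by (induction p t rule: ins.induct) auto

lemma val_ins: "depth (length p) t \<Longrightarrow> length bs = length p \<Longrightarrow> val (ins p t) bs = val t bs + of_bool (matches p bs)"
proof (induction p t arbitrary: bs rule: ins.induct)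
qed (auto simp: length_Suc_conv)

lemma val_fold_ins:
  assumes "depth n t" "length bs = n" "\<And>p. p \<in> set ps \<Longrightarrow> length p = n"
  shows "depth n (fold ins ps t) \<and> val (fold ins ps t) bs = val t bs + length (filter (\<lambda>p. matches p bs) ps)"
  using assms(1,3)
proof (induction ps arbitrary: t)
  case (Cons p ps)
  have p: "length p = n" using Cons.prems by simp
  have "depth n (ins p t)" "val (ins p t) bs = val t bs + of_bool (matches p bs)"
    using depth_ins[of p t] val_ins[of p t bs] Cons.prems(1) assms(2) p by simp_all
  then show ?case using Cons.IH[of "ins p t"] Cons.prems(2) by auto
qed simp

lemma matches_map_upt:
  "matches (map f [0..<length bs]) bs \<longleftrightarrow> (\<forall>c<length bs. f c = None \<or> f c = Some (bs ! c))"
proof -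
  have "matches (map f [k..<k + length bs]) bs \<longleftrightarrow> (\<forall>c<length bs. f (k + c) = None \<or> f (k + c) = Some (bs ! c))" for k
  proof (induction bs arbitrary: k)
    case (Cons b bs)
    have "matches (map f [k..<k + length (b # bs)]) (b # bs) \<longleftrightarrow>
        (f k = None \<or> f k = Some b) \<and> matches (map f [Suc k..<Suc k + length bs]) bs"
    proof -
      have "[k..<k + length (b # bs)] = k # [Suc k..<Suc k + length bs]"
        by (simp add: upt_conv_Cons del: upt_Suc)
      then show ?thesis by (simp only: list.map matches.simps)
    qed
    then show ?case unfolding Cons.IH by (auto simp: All_less_Suc2)
  qed simp
  from this[of 0] show ?thesis by simp
qed

lemma sum_length_Suc:
  "(\<Sum>bs | length bs = Suc n. f bs) = (\<Sum>bs | length bs = n. f (True # bs)) + (\<Sum>bs | length bs = n. f (False # bs :: bool list))"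
proof -
  have eq: "{bs :: bool list. length bs = Suc n} = (#) True ` {bs. length bs = n} \<union> (#) False ` {bs. length bs = n}"
    by (auto simp: length_Suc_conv image_iff)
  have fin: "finite {bs :: bool list. length bs = n}"
    using finite_lists_length_eq[of "UNIV :: bool set" n] by simp
  show ?thesis
    unfolding eq by (subst sum.union_disjoint) (auto simp: fin sum.reindex)
qed

lemma dot_sum:
  assumes "depth n l" "depth n r"
  shows "(\<Sum>bs | length bs = n. (int (val l bs) * int (val r bs))\<^sup>2) = dot l r"
  using assms
proof (induction n arbitrary: l r)
  case 0
  then show ?case using depth_0[of l] depth_0[of r] by auto
next
  case (Suc n)
  then show ?case
    using depth_Suc[of n l] depth_Suc[of n r] Suc.IH by (auto simp: sum_length_Suc)
qed

text \<open>The sum visits a vector and its flip in direction \<open>e\<close> separately, whereas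
  \<open>edge_sum\<close> pairs the two subtrees below depth \<open>e\<close> only once; hence the
  factor 2.\<close>

lemma edge_sum_sum:
  assumes "depth n t" "e < n"
  shows "(\<Sum>bs | length bs = n. (int (val t bs) * int (val t (bs[e := \<not> bs ! e])))\<^sup>2) = 2 * edge_sum e t"
  using assms
proof (induction e arbitrary: n t)
  case 0
  then obtain m where n: "n = Suc m" by (cases n) auto
  have "t = Z \<or> (\<exists>l r. t = N l r \<and> depth m l \<and> depth m r)" using depth_Suc[of m t] 0 n by simp
  then show ?case
  proof (elim disjE exE conjE)
    fix l r assume t: "t = N l r" "depth m l" "depth m r"
    have "(\<Sum>bs | length bs = m. (int (val r bs) * int (val l bs))\<^sup>2) = dot l r"
      using dot_sum[OF t(2,3)] by (simp add: mult.commute)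
    then show ?thesis using dot_sum[OF t(2,3)] by (simp add: n t sum_length_Suc)
  qed auto
next
  case (Suc e)
  then obtain m where n: "n = Suc m" by (cases n) auto
  have "t = Z \<or> (\<exists>l r. t = N l r \<and> depth m l \<and> depth m r)" using depth_Suc[of m t] Suc.prems n by simp
  then show ?case
  proof (elim disjE exE conjE)
    fix l r assume t: "t = N l r" "depth m l" "depth m r"
    then show ?thesis using Suc.IH[of m l] Suc.IH[of m r] Suc.prems by (simp add: n sum_length_Suc)
  qed auto
qed

lemma depth_join: "depth n t \<Longrightarrow> depth n s \<Longrightarrow> depth n (join t s)"
proof (induction n arbitrary: t s)
  case 0
  then show ?case using depth_0[of t] depth_0[of s] by auto
next
  case (Suc n)
  show ?case using depth_Suc[OF Suc.prems(1)] depth_Suc[OF Suc.prems(2)] Suc.IH by auto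
qed

lemma val_join_eq_0: "depth n t \<Longrightarrow> depth n s \<Longrightarrow> length bs = n \<Longrightarrow> val (join t s) bs = 0 \<longleftrightarrow> val t bs = 0 \<and> val s bs = 0"
proof (induction n arbitrary: t s bs)
  case 0
  then show ?case using depth_0[of t] depth_0[of s] by auto
next
  case (Suc n)
  then obtain b cs where bs: "bs = b # cs" "length cs = n" by (auto simp: length_Suc_conv)
  show ?case using depth_Suc[OF Suc.prems(1)] depth_Suc[OF Suc.prems(2)] Suc.IH bs by auto
qed

lemma depth_children: "depth (Suc n) t \<Longrightarrow> depth n (lft t) \<and> depth n (rgt t)"
  by (cases t) auto

lemma val_Cons: "depth (Suc n) t \<Longrightarrow> val t (b # bs) = val (if b then lft t else rgt t) bs"
  by (cases t) auto

lemma free_card: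
  assumes "depth n t" "depth n s"
  shows "free n t s = int (card {bs. length bs = n \<and> val t bs = 0 \<and> val s bs = 0 \<and> (\<forall>e<n. val t (bs[e := \<not> bs ! e]) = 0)})"
  using assms
proof (induction n arbitrary: t s)
  case 0
  have "{bs :: bool list. length bs = 0 \<and> val t bs = 0 \<and> val s bs = 0 \<and> (\<forall>e<0. val t (bs[e := \<not> bs ! e]) = 0)} =
      (if t = Z \<and> s = Z then {[]} else {})"
    using depth_0[OF 0(1)] depth_0[OF 0(2)] by auto
  then show ?case by simp
next
  case (Suc n)
  define A where "A t s = {bs. length bs = n \<and> val t bs = 0 \<and> val s bs = 0 \<and> (\<forall>e<n. val t (bs[e := \<not> bs ! e]) = 0)}" for t s
  note d = depth_children[OF Suc.prems(1)] depth_children[OF Suc.prems(2)]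
  have fin: "finite (A t s)" for t s
    using finite_lists_length_eq[of "UNIV :: bool set" n] by (auto simp: A_def intro: finite_subset)
  have join: "val (join (lft s) (rgt t)) bs = 0 \<longleftrightarrow> val (lft s) bs = 0 \<and> val (rgt t) bs = 0"
    "val (join (rgt s) (lft t)) bs = 0 \<longleftrightarrow> val (rgt s) bs = 0 \<and> val (lft t) bs = 0" if "length bs = n" for bs
    using val_join_eq_0 d that by blast+
  \<comment> \<open>The first flip of \<open>True # cs\<close> is \<open>False # cs\<close>, so the
    right subtree joins the forbidden positions on the way to the left, and vice versa.\<close>
  have "{bs. length bs = Suc n \<and> val t bs = 0 \<and> val s bs = 0 \<and> (\<forall>e<Suc n. val t (bs[e := \<not> bs ! e]) = 0)} =
      (#) True ` A (lft t) (join (lft s) (rgt t)) \<union> (#) False ` A (rgt t) (join (rgt s) (lft t))" (is "?L = ?R")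
  proof (intro subset_antisym subsetI)
    fix bs assume bs: "bs \<in> ?L"
    then obtain b cs where "bs = b # cs" "length cs = n" by (auto simp: length_Suc_conv)
    then show "bs \<in> ?R"
      using bs join[of cs] by (cases b) (auto simp: A_def All_less_Suc2 val_Cons[OF Suc.prems(1)] val_Cons[OF Suc.prems(2)])
  next
    fix bs assume "bs \<in> ?R"
    then show "bs \<in> ?L"
      by (auto simp: A_def All_less_Suc2 val_Cons[OF Suc.prems(1)] val_Cons[OF Suc.prems(2)] join)
  qed
  moreover have "card ?R = card (A (lft t) (join (lft s) (rgt t))) + card (A (rgt t) (join (rgt s) (lft t)))"
    by (subst card_Un_disjoint) (auto simp: fin card_image)
  ultimately show ?case
    using Suc.IH[of "lft t" "join (lft s) (rgt t)"] Suc.IH[of "rgt t" "join (rgt s) (lft t)"] d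
    by (simp add: depth_join A_def)
qed

section \<open>From tables to circuits on \<open>{1..n}\<close>\<close>

definition shifted :: "table \<Rightarrow> nat \<Rightarrow> nat \<Rightarrow> nat \<Rightarrow> bool" where
  "shifted t a b c = get t (a - 1) (b - 1) (c - 1)"

definition vec :: "nat \<Rightarrow> bool list \<Rightarrow> nat sign_vector" where
  "vec n bs e = (if e \<in> {1..n} then if bs ! (e - 1) then 1 else - 1 else 0)"

lemma ball_Suc_iff: "(\<forall>e\<in>{1..n}. P e) \<longleftrightarrow> (\<forall>e<n. P (Suc e))"
proof (intro iffI ballI)
  fix e assume "\<forall>e<n. P (Suc e)" "e \<in> {1..n}"
  moreover from this obtain d where "e = Suc d" by (cases e) auto
  ultimately show "P e" by auto
qed auto

lemma isomorphism_shift: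
  assumes "isomorphism {..<n} (\<lambda>a b c. \<chi> (Suc a) (Suc b) (Suc c)) (get t) r \<pi>"
  shows "isomorphism {1..n} \<chi> (shifted t) (\<lambda>a. r (a - 1)) (\<lambda>a. if a \<in> {1..n} then Suc (\<pi> (a - 1)) else a)"
  unfolding isomorphism_def
proof (intro conjI ballI impI)
  have \<pi>: "\<pi> permutes {..<n}" using isomorphismD(1)[OF assms] .
  let ?\<rho> = "\<lambda>a. if a \<in> {1..n} then Suc (\<pi> (a - 1)) else a"
  have \<pi>n: "\<pi> a < n \<longleftrightarrow> a < n" for a using permutes_in_image[OF \<pi>] by simp
  show "?\<rho> permutes {1..n}"
  proof (rule bij_imp_permutes)
    have inj: "inj_on ?\<rho> {1..n}"
    proof (rule inj_onI)
      fix a b assume "a \<in> {1..n}" "b \<in> {1..n}" "?\<rho> a = ?\<rho> b"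
      then have "a - 1 = b - 1" using inj_eq[OF permutes_inj[OF \<pi>]] by auto
      then show "a = b" using \<open>a \<in> {1..n}\<close> \<open>b \<in> {1..n}\<close> by auto
    qed
    moreover have "?\<rho> ` {1..n} = {1..n}"
    proof (rule endo_inj_surj[OF _ _ inj])
      show "?\<rho> ` {1..n} \<subseteq> {1..n}"
      proof (intro image_subsetI)
        fix a assume "a \<in> {1..n}"
        then show "?\<rho> a \<in> {1..n}" using \<pi>n[of "a - 1"] by auto
      qed
    qed simp
    ultimately show "bij_betw ?\<rho> {1..n} {1..n}" by (simp add: bij_betw_def)
  qed auto
  fix a b c assume abc: "a \<in> {1..n}" "b \<in> {1..n}" "c \<in> {1..n}" "distinct [a, b, c]"
  then have "distinct [a - 1, b - 1, c - 1]" "a - 1 \<in> {..<n}" "b - 1 \<in> {..<n}" "c - 1 \<in> {..<n}" by auto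
  note iso = isomorphismD(2)[OF assms this(2-4,1)]
  have "?\<rho> a = Suc (\<pi> (a - 1))" "?\<rho> b = Suc (\<pi> (b - 1))" "?\<rho> c = Suc (\<pi> (c - 1))"
    using abc by auto
  then show "shifted t a b c = (((r (a - 1) = r (b - 1)) = r (c - 1)) = \<chi> (?\<rho> a) (?\<rho> b) (?\<rho> c))"
    unfolding shifted_def iso by (simp only:)
qed

lemma chirotope_reindex:
  assumes "chirotope E \<chi>" "f ` F \<subseteq> E" "inj_on f F"
  shows "chirotope F (\<lambda>a b c. \<chi> (f a) (f b) (f c))"
  unfolding chirotope_def
proof (intro conjI ballI impI)
  have d: "distinct (map f xs) = distinct xs" if "set xs \<subseteq> F" for xs
    using assms(3) that by (simp add: distinct_map inj_on_subset)
  fix a b c assume abc: "a \<in> F" "b \<in> F" "c \<in> F" "distinct [a, b, c]"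
  then have fd: "f a \<noteq> f b" "f a \<noteq> f c" "f b \<noteq> f c" "f a \<in> E" "f b \<in> E" "f c \<in> E"
    using d[of "[a, b, c]"] assms(2) by auto
  show "\<chi> (f b) (f c) (f a) = \<chi> (f a) (f b) (f c)" "\<chi> (f b) (f a) (f c) = (\<not> \<chi> (f a) (f b) (f c))"
    using chirotope_cyc(1,2)[OF assms(1) fd(4-6,1-3)] by blast+
next
  have d: "distinct (map f xs) = distinct xs" if "set xs \<subseteq> F" for xs
    using assms(3) that by (simp add: distinct_map inj_on_subset)
  fix a b c d e assume abc: "a \<in> F" "b \<in> F" "c \<in> F" "d \<in> F" "e \<in> F" "distinct [a, b, c, d, e]"
  show "(\<chi> (f a) (f b) (f c) = \<chi> (f a) (f d) (f e)) = (\<chi> (f a) (f b) (f d) = \<chi> (f a) (f c) (f e)) \<or>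
    (\<chi> (f a) (f b) (f c) = \<chi> (f a) (f d) (f e)) \<noteq> (\<chi> (f a) (f b) (f e) = \<chi> (f a) (f c) (f d))"
    by (rule chirotope_gp[OF assms(1)]) (use abc assms(2) d[of "[a, b, c, d, e]"] in auto)
qed

lemma chirotope_shifted:
  assumes "chirotope {..<n} (get t)"
  shows "chirotope {1..n} (shifted t)"
  unfolding shifted_def by (rule chirotope_reindex[OF assms]) (auto simp: inj_on_def)

lemma complete_reps_circuits:
  assumes "complete_reps n reps" and \<chi>: "chirotope {1..n} \<chi>"
  shows "\<exists>i. \<exists>s\<in>set (reps i). circuits {1..n} (shifted (table_of n s)) \<in> reorientation_class {1..n} (circuits {1..n} \<chi>)"
proof -
  have "chirotope {..<n} (\<lambda>a b c. \<chi> (Suc a) (Suc b) (Suc c))"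
    by (rule chirotope_reindex[OF \<chi>]) (auto simp: inj_on_def)
  then obtain i s r \<pi> where "s \<in> set (reps i)"
    "isomorphism {..<n} (\<lambda>a b c. \<chi> (Suc a) (Suc b) (Suc c)) (get (table_of n s)) r \<pi>"
    using assms(1) unfolding complete_reps_def by blast
  then show ?thesis
    using isomorphism_circuits[OF isomorphism_shift \<chi>] by blast
qed

text \<open>A third element tells a vector from its opposite, so ordered pairs correspond
  bijectively to circuits. This turns the pairs counted by the trie into circuits.\<close>

lemma signed_inj:
  assumes \<chi>: "chirotope E \<chi>" and "finite E" "card E \<ge> 3"
    and ab: "a \<in> E" "b \<in> E" "a \<noteq> b" and cd: "c \<in> E" "d \<in> E" "c \<noteq> d"
    and eq: "signed E \<chi> True a b = signed E \<chi> True c d"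
  shows "a = c \<and> b = d"
proof -
  have "E - {a, b} = E - {c, d}" using supp_signed eq by metis
  then have "a = c \<and> b = d \<or> a = d \<and> b = c" using ab cd by blast
  moreover have "\<not> (a = d \<and> b = c)"
  proof
    assume "a = d \<and> b = c"
    then have "signed E \<chi> True a b = signed E \<chi> False a b"
      using eq signed_swap[OF \<chi> ab, of True] by simp
    moreover have "E - {a, b} \<noteq> {}"
      using assms(3) ab card_mono[of "{a, b}" E] by auto
    then obtain e where "e \<in> E" "e \<noteq> a" "e \<noteq> b" by blast
    ultimately show False by (auto simp: signed_def fun_eq_iff split: if_splits)
  qed
  ultimately show ?thesis by blast
qed

lemma set_pairs: "set (pairs n) = {(a, b). a < n \<and> b < n \<and> a \<noteq> b}"
  by (auto simp: pairs_def)

lemma distinct_pairs: "distinct (pairs n)"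
  unfolding pairs_def by (intro distinct_filter distinct_product) auto

lemma entry_at_eq: "entry_at f a b c = (if c = a \<or> c = b then None else Some (f c))"
  unfolding entry_at_def by (cases "c = a \<or> c = b") auto

lemma matches_pattern:
  assumes "a < n" "b < n" "length bs = n"
  shows "matches (pattern n t (a, b)) bs \<longleftrightarrow> sep (vec n bs) (signed {1..n} (shifted t) True (Suc a) (Suc b)) = {}"
proof -
  have "matches (pattern n t (a, b)) bs \<longleftrightarrow> (\<forall>c<n. c = a \<or> c = b \<or> get t a b c = bs ! c)"
    using matches_map_upt[of "entry_at (get t a b) a b" bs] assms by (auto simp: entry_at_eq)
  also have "\<dots> \<longleftrightarrow> (\<forall>e\<in>{1..n}. e = Suc a \<or> e = Suc b \<or> get t a b (e - 1) = bs ! (e - 1))"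
    unfolding ball_Suc_iff by simp
  also have "\<dots> \<longleftrightarrow> (\<forall>e. vec n bs e * signed {1..n} (shifted t) True (Suc a) (Suc b) e \<noteq> - 1)"
    unfolding vec_def signed_def shifted_def by auto
  finally show ?thesis unfolding sep_def by auto
qed

lemma depth_conf_trie: "depth n (conf_trie n t)"
  and val_conf_trie: "length bs = n \<Longrightarrow> val (conf_trie n t) bs = length (filter (\<lambda>p. matches p bs) (map (pattern n t) (pairs n)))"
proof -
  have len: "length p = n" if "p \<in> set (map (pattern n t) (pairs n))" for p using that by auto
  show "depth n (conf_trie n t)"
    unfolding conf_trie_def using val_fold_ins[of n Z "replicate n True" "map (pattern n t) (pairs n)", OF _ _ len] by simp
  show "val (conf_trie n t) bs = length (filter (\<lambda>p. matches p bs) (map (pattern n t) (pairs n)))" if "length bs = n"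
    unfolding conf_trie_def using val_fold_ins[of n Z bs "map (pattern n t) (pairs n)", OF _ that len] by simp
qed

lemma conformal_vec:
  assumes \<chi>: "chirotope {1..n} (shifted t)" and "n \<ge> 3" and len: "length bs = n"
  shows "conformal (circuits {1..n} (shifted t)) (vec n bs) = val (conf_trie n t) bs"
proof -
  let ?f = "\<lambda>(a, b). signed {1..n} (shifted t) True (Suc a) (Suc b)"
  let ?A = "{p \<in> set (pairs n). matches (pattern n t p) bs}"
  have "val (conf_trie n t) bs = length (filter (\<lambda>p. matches (pattern n t p) bs) (pairs n))"
    unfolding val_conf_trie[OF len] filter_map by (simp add: comp_def)
  also have "\<dots> = card ?A"
    using distinct_card[OF distinct_filter[OF distinct_pairs]] by (metis set_filter)
  also have "\<dots> = card (?f ` ?A)"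
  proof (rule card_image[symmetric], rule inj_onI)
    fix p q assume "p \<in> ?A" "q \<in> ?A" and eq: "?f p = ?f q"
    then obtain a b c d where "p = (a, b)" "q = (c, d)" "a < n" "b < n" "a \<noteq> b" "c < n" "d < n" "c \<noteq> d"
      by (auto simp: set_pairs)
    then show "p = q" using signed_inj[OF \<chi>, of "Suc a" "Suc b" "Suc c" "Suc d"] eq assms(2) by auto
  qed
  also have "?f ` ?A = {X \<in> circuits {1..n} (shifted t). sep (vec n bs) X = {}}"
  proof (intro subset_antisym subsetI)
    fix X assume "X \<in> ?f ` ?A"
    then obtain a b where ab: "a < n" "b < n" "a \<noteq> b" "matches (pattern n t (a, b)) bs"
      and X: "X = signed {1..n} (shifted t) True (Suc a) (Suc b)"
      by (auto simp: set_pairs simp del: pattern.simps)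
    have "sep (vec n bs) X = {}" unfolding X using matches_pattern[OF ab(1,2) len] ab(4) by blast
    moreover have "X \<in> circuits {1..n} (shifted t)" unfolding X by (rule signed_in_circuits[OF \<chi>]) (use ab in auto)
    ultimately show "X \<in> {X \<in> circuits {1..n} (shifted t). sep (vec n bs) X = {}}" by simp
  next
    fix X assume "X \<in> {X \<in> circuits {1..n} (shifted t). sep (vec n bs) X = {}}"
    then obtain a' b' where ab: "a' \<in> {1..n}" "b' \<in> {1..n}" "a' \<noteq> b'" "X = signed {1..n} (shifted t) True a' b'"
      and sep: "sep (vec n bs) X = {}"
      unfolding circuits_def by blast
    define a b where "a = a' - 1" and "b = b' - 1"
    have ab': "a < n" "b < n" "a \<noteq> b" "a' = Suc a" "b' = Suc b" using ab by (auto simp: a_def b_def)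
    then have "(a, b) \<in> ?A" using sep matches_pattern[OF ab'(1,2) len] ab(4) by (simp add: set_pairs del: pattern.simps)
    then show "X \<in> ?f ` ?A" by (rule rev_image_eqI) (use ab ab' in simp)
  qed
  finally show ?thesis unfolding conformal_def ..
qed

lemma full_vectors_vec: "full_vectors {1..n} = vec n ` {bs. length bs = n}"
proof (intro subset_antisym subsetI)
  fix T assume T: "T \<in> full_vectors {1..n}"
  have v: "T e = - 1 \<or> T e = 0 \<or> T e = 1" "T e \<noteq> 0 \<longleftrightarrow> e \<in> {1..n}" for e
    using T by (auto simp: full_vectors_def sign_vectors_def supp_def)
  define bs where "bs = map (\<lambda>i. T (Suc i) = 1) [0..<n]"
  have "T = vec n bs"
  proof
    fix e show "T e = vec n bs e" using v[of e] by (auto simp: vec_def bs_def)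
  qed
  then show "T \<in> vec n ` {bs. length bs = n}" by (auto simp: bs_def)
qed (auto simp: vec_def full_vectors_def sign_vectors_def supp_def split: if_splits)

lemma inj_on_vec: "inj_on (vec n) {bs. length bs = n}"
proof (rule inj_onI)
  fix bs cs assume len: "bs \<in> {bs. length bs = n}" "cs \<in> {bs. length bs = n}" and eq: "vec n bs = vec n cs"
  show "bs = cs"
  proof (rule nth_equalityI)
    fix i assume "i < length bs"
    then show "bs ! i = cs ! i"
      using fun_cong[OF eq, of "Suc i"] len by (auto simp: vec_def split: if_splits)
  qed (use len in simp)
qed

lemma flip_vec:
  assumes "e < n" "length bs = n"
  shows "flip (Suc e) (vec n bs) = vec n (bs[e := \<not> bs ! e])"
proof
  fix i
  show "flip (Suc e) (vec n bs) i = vec n (bs[e := \<not> bs ! e]) i"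
    using assms by (cases "i = Suc e") (auto simp: flip_def vec_def nth_list_update split: if_splits)
qed

text \<open>The factor 4 is the square of the factor 2 with which the inner sum counts every
  edge.\<close>

lemma edge_invariant_trie:
  assumes \<chi>: "chirotope {1..n} (shifted t)" and n: "n \<ge> 3"
  shows "int (edge_invariant {1..n} (circuits {1..n} (shifted t))) = 4 * trie_invariant n (conf_trie n t)"
proof -
  let ?C = "circuits {1..n} (shifted t)" and ?t = "conf_trie n t"
  have inner: "int (\<Sum>T\<in>full_vectors {1..n}. (conformal ?C T * conformal ?C (flip (Suc e) T))\<^sup>2) = 2 * edge_sum e ?t"
    if e: "e < n" for e
  proof -
    have "int (\<Sum>T\<in>full_vectors {1..n}. (conformal ?C T * conformal ?C (flip (Suc e) T))\<^sup>2) =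
        (\<Sum>bs | length bs = n. (int (val ?t bs) * int (val ?t (bs[e := \<not> bs ! e])))\<^sup>2)"
      unfolding full_vectors_vec by (subst sum.reindex[OF inj_on_vec]) (simp add: conformal_vec[OF \<chi> n] flip_vec[OF e] del: One_nat_def)
    then show ?thesis using edge_sum_sum[OF depth_conf_trie e] by simp
  qed
  have "int (edge_invariant {1..n} ?C) =
      (\<Sum>e\<in>{1..n}. (int (\<Sum>T\<in>full_vectors {1..n}. (conformal ?C T * conformal ?C (flip e T))\<^sup>2))\<^sup>2)"
    unfolding edge_invariant_def by (simp add: power_mult_distrib)
  also have "\<dots> = (\<Sum>e<n. (int (\<Sum>T\<in>full_vectors {1..n}. (conformal ?C T * conformal ?C (flip (Suc e) T))\<^sup>2))\<^sup>2)"
    by (rule sum.reindex_bij_witness[of _ Suc "\<lambda>e. e - 1"]) auto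
  also have "\<dots> = (\<Sum>e<n. (2 * edge_sum e ?t)\<^sup>2)"
    by (intro sum.cong refl arg_cong[where f = "\<lambda>x. x\<^sup>2"] inner) simp
  also have "\<dots> = 4 * trie_invariant n ?t"
    unfolding trie_invariant_def by (simp add: power_mult_distrib sum_distrib_left sum_list_distinct_conv_sum_set atLeast0LessThan)
  finally show ?thesis .
qed

lemma circuits_finite: "finite E \<Longrightarrow> finite (circuits E \<chi>)"
proof -
  assume "finite E"
  have "circuits E \<chi> \<subseteq> (\<lambda>(a, b). signed E \<chi> True a b) ` (E \<times> E)" unfolding circuits_def by auto
  then show ?thesis using \<open>finite E\<close> by (meson finite_SigmaI finite_imageI finite_subset)
qed

lemma circuits_uminus:
  assumes "chirotope E \<chi>" "X \<in> circuits E \<chi>"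
  shows "- X \<in> circuits E \<chi>"
proof -
  obtain a b where "a \<in> E" "b \<in> E" "a \<noteq> b" "X = signed E \<chi> True a b"
    using assms(2) unfolding circuits_def by blast
  then show ?thesis using signed_in_circuits[OF assms(1)] by (simp add: signed_uminus)
qed

text \<open>That a vector and all its neighbours are topes means that the trie vanishes at all of
  them. The search starts at \<open>Z\<close> because no flip has been collected yet.\<close>

lemma complete_cells_trie:
  assumes \<chi>: "chirotope {1..n} (shifted t)" and n: "n \<ge> 3"
  shows "int (card (complete_cells {1..n} (circuits {1..n} (shifted t)))) = free n (conf_trie n t) Z"
proof -
  let ?C = "circuits {1..n} (shifted t)" and ?t = "conf_trie n t"
  let ?A = "{bs. length bs = n \<and> val ?t bs = 0 \<and> val Z bs = 0 \<and> (\<forall>e<n. val ?t (bs[e := \<not> bs ! e]) = 0)}"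
  have tope: "vec n bs \<in> topes {1..n} ?C \<longleftrightarrow> val ?t bs = 0" if "length bs = n" for bs
    using topes_conformal[OF circuits_finite circuits_uminus[OF \<chi>], of "{1..n}"] that
    by (auto simp: full_vectors_vec conformal_vec[OF \<chi> n] simp del: One_nat_def)
  have "vec n bs \<in> complete_cells {1..n} ?C \<longleftrightarrow> bs \<in> ?A" if len: "length bs = n" for bs
    unfolding complete_cells_def flip_def[symmetric] ball_Suc_iff using tope len by (simp add: flip_vec)
  moreover have "complete_cells {1..n} ?C \<subseteq> vec n ` {bs. length bs = n}"
    unfolding full_vectors_vec[symmetric] by (auto simp: complete_cells_def topes_def full_vectors_def)
  ultimately have "complete_cells {1..n} ?C = vec n ` ?A" by auto
  moreover have "card (vec n ` ?A) = card ?A"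
    by (intro card_image inj_on_subset[OF inj_on_vec]) auto
  ultimately show ?thesis using free_card[OF depth_conf_trie, of n Z t] by simp
qed

section \<open>The alternating oriented matroid\<close>

definition ord_sign :: "nat \<Rightarrow> nat \<Rightarrow> int" where
  "ord_sign a b = sgn (int b - int a)"

lemma ord_sign_swap: "ord_sign b a = - ord_sign a b"
  by (simp add: ord_sign_def sgn_minus[symmetric] del: sgn_minus)

lemma ord_sign_values: "a \<noteq> b \<Longrightarrow> ord_sign a b = 1 \<or> ord_sign a b = - 1"
  by (auto simp: ord_sign_def sgn_if)

lemma ord_sign_eq_0: "ord_sign a b = 0 \<longleftrightarrow> a = b"
  by (auto simp: ord_sign_def sgn_if)

lemma ord_sign_less: "a < b \<Longrightarrow> ord_sign a b = 1"
  by (simp add: ord_sign_def)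

text \<open>Dualising an alternating chirotope gives the sign \<open>(- 1) ^ (a + b + c)\<close> on
  increasing triples, up to a global sign; the factors \<open>ord_sign\<close> extend it to all
  orders.\<close>

definition alt_sign :: "nat \<Rightarrow> nat \<Rightarrow> nat \<Rightarrow> int" where
  "alt_sign a b c = (- 1) ^ (a + b + c) * ord_sign a b * ord_sign a c * ord_sign b c"

lemma alt_sign_values: "distinct [a, b, c] \<Longrightarrow> alt_sign a b c = 1 \<or> alt_sign a b c = - 1"
  using ord_sign_values[of a b] ord_sign_values[of a c] ord_sign_values[of b c]
  by (cases "even (a + b + c)") (auto simp: alt_sign_def)

lemma alt_sign_alternating: "alt_sign b c a = alt_sign a b c" "alt_sign b a c = - alt_sign a b c"
  by (simp_all add: alt_sign_def ord_sign_swap[of b a] ord_sign_swap[of c a] add_ac mult_ac)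

text \<open>The ground set starts at 1 and the table at 0, which shifts the sum by 3: the positive
  entries are those with odd \<open>a + b + c\<close>.\<close>

definition alt_table :: table where
  "alt_table = map (\<lambda>c. map (\<lambda>a. map (\<lambda>b. odd (a + b + c)) [Suc a..<c]) [0..<c]) [0..<8]"

lemma get_alt_table:
  assumes "a < 8" "b < 8" "c < 8" "distinct [a, b, c]"
  shows "get alt_table a b c \<longleftrightarrow> alt_sign (Suc a) (Suc b) (Suc c) = 1"
proof (rule alternating_eqI[OF _ _ _ assms])
  fix a b c :: nat assume d: "distinct [a, b, c]"
  then show "get alt_table b c a = get alt_table a b c \<and> get alt_table b a c = (\<not> get alt_table a b c)"
    using get_alternating by blast
  show "(alt_sign (Suc b) (Suc c) (Suc a) = 1) = (alt_sign (Suc a) (Suc b) (Suc c) = 1) \<and>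
      (alt_sign (Suc b) (Suc a) (Suc c) = 1) = (\<not> alt_sign (Suc a) (Suc b) (Suc c) = 1)"
    using alt_sign_values[of "Suc a" "Suc b" "Suc c"] d
    by (auto simp: alt_sign_alternating(1)[of "Suc b" "Suc c" "Suc a"] alt_sign_alternating(2)[of "Suc b" "Suc a" "Suc c"])
next
  fix a b c :: nat assume lt: "a < b" "b < c" "c < 8"
  have "look alt_table a b c = alt_table ! c ! a ! (b - Suc a)"
    by (rule look_table) (use lt in \<open>auto simp: alt_table_def\<close>)
  also have "\<dots> = odd (a + b + c)"
    using lt nth_upt[of "Suc a" "b - Suc a" c] by (simp add: alt_table_def)
  finally show "get alt_table a b c = (alt_sign (Suc a) (Suc b) (Suc c) = 1)"
    using lt by (simp add: get_lt alt_sign_def ord_sign_less minus_one_power_iff)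
qed

abbreviation (input) "E8 \<equiv> {1..8 :: nat}"

definition alt_circuits :: "nat sign_vector set" where
  "alt_circuits = circuits E8 (shifted alt_table)"

lemma signed_alt:
  assumes "a \<in> E8" "b \<in> E8" "a \<noteq> b"
  shows "signed E8 (shifted alt_table) True a b c = (if c \<in> E8 then alt_sign a b c else 0)"
proof (cases "c \<in> E8 \<and> c \<noteq> a \<and> c \<noteq> b")
  case True
  then have "distinct [a - 1, b - 1, c - 1]" "a - 1 < 8" "b - 1 < 8" "c - 1 < 8" using assms by auto
  from get_alt_table[OF this(2-4,1)] have "shifted alt_table a b c \<longleftrightarrow> alt_sign a b c = 1"
    unfolding shifted_def using assms True by simp
  then show ?thesis
    using alt_sign_values[of a b c] True assms(3) by (auto simp: signed_def)
qed (auto simp: signed_def alt_sign_def ord_sign_eq_0)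

lemma alt_chirotope: "chirotope E8 (shifted alt_table)"
proof (rule chirotope_shifted[OF chk_gp_chirotope])
  show "chk_gp 8 alt_table" by code_simp
qed

lemma alt_circuitsE:
  assumes "X \<in> alt_circuits"
  obtains a b where "a \<in> E8" "b \<in> E8" "a \<noteq> b" "supp X = E8 - {a, b}"
    "\<And>c. c \<in> E8 \<Longrightarrow> X c = alt_sign a b c"
  using assms signed_alt supp_signed[of E8 "shifted alt_table" True]
  unfolding alt_circuits_def circuits_def by (smt (verit, ccfv_threshold) mem_Collect_eq)

lemma alt_uniform: "uniform_oriented_matroid E8 5 alt_circuits"
  unfolding alt_circuits_def by (rule circuits_uniform_oriented_matroid[OF alt_chirotope]) auto

section \<open>Uniqueness of the alternating oriented matroid of rank 5 on 8 elements\<close>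

lemma consecutive_constant:
  fixes A :: "nat set" and h :: "nat \<Rightarrow> 'b"
  assumes "\<And>x y. x \<in> A \<Longrightarrow> y \<in> A \<Longrightarrow> x < y \<Longrightarrow> (\<And>z. z \<in> A \<Longrightarrow> \<not> (x < z \<and> z < y)) \<Longrightarrow> h x = h y"
    and "x \<in> A" "y \<in> A"
  shows "h x = h y"
proof -
  have lt: "h x = h y" if "x \<in> A" "y \<in> A" "x < y" for x y
    using that
  proof (induction "y - x" arbitrary: x y rule: less_induct)
    case less
    show ?case
    proof (cases "\<exists>z\<in>A. x < z \<and> z < y")
      case True
      then obtain z where z: "z \<in> A" "x < z" "z < y" by blast
      have "h x = h z" by (rule less.hyps) (use z less.prems in auto)
      moreover have "h z = h y" by (rule less.hyps) (use z less.prems in auto)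
      ultimately show ?thesis by simp
    qed (use assms(1) less.prems in blast)
  qed
  show ?thesis
    by (cases x y rule: linorder_cases) (use lt assms(2,3) in \<open>blast intro: sym\<close>)+
qed

lemma alt_sign_mult:
  assumes "a \<noteq> b"
  shows "alt_sign a b x * alt_sign a b y =
    (- 1) ^ (x + y) * (ord_sign a x * ord_sign b x) * (ord_sign a y * ord_sign b y)"
proof -
  have "(- 1 :: int) ^ (a + b + x) * (- 1) ^ (a + b + y) = (- 1) ^ (x + y)"
    by (simp add: minus_one_power_iff)
  moreover have "ord_sign a b * ord_sign a b = 1" using ord_sign_values[OF assms] by auto
  moreover have "alt_sign a b x * alt_sign a b y =
      ((- 1) ^ (a + b + x) * (- 1) ^ (a + b + y)) * (ord_sign a b * ord_sign a b) *
      (ord_sign a x * ord_sign b x) * (ord_sign a y * ord_sign b y)"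
    by (simp add: alt_sign_def mult_ac)
  ultimately show ?thesis by simp
qed

text \<open>If \<open>k\<close> of the zeros \<open>a\<close>, \<open>b\<close> lie between
  \<open>x\<close> and \<open>y\<close>, then \<open>y - x = k + 1\<close>, while exactly
  \<open>k\<close> order signs change from \<open>x\<close> to \<open>y\<close>. The two powers of
  \<open>- 1\<close> therefore always multiply to \<open>- 1\<close>.\<close>

lemma alt_sign_consecutive:
  assumes "a \<noteq> b" "x < y" "x \<notin> {a, b}" "y \<notin> {a, b}" and between: "\<And>z. x < z \<Longrightarrow> z < y \<Longrightarrow> z \<in> {a, b}"
  shows "alt_sign a b x * alt_sign a b y = - 1"
proof -
  have b: "Suc x < y \<Longrightarrow> Suc x \<in> {a, b}" "Suc (Suc x) < y \<Longrightarrow> Suc (Suc x) \<in> {a, b}"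
    "Suc (Suc (Suc x)) < y \<Longrightarrow> Suc (Suc (Suc x)) \<in> {a, b}"
    using between by auto
  have "\<not> Suc (Suc (Suc x)) < y" using b assms(1) by auto
  then consider "y = Suc x" | "y = Suc (Suc x)" | "y = Suc (Suc (Suc x))" using assms(2) by linarith
  then show ?thesis
  proof cases
    case 1
    then have "ord_sign a x = ord_sign a y" "ord_sign b x = ord_sign b y"
      using assms by (auto simp: ord_sign_def sgn_if)
    then show ?thesis
      using 1 ord_sign_values[of a y] ord_sign_values[of b y] assms
      by (auto simp: alt_sign_mult[OF assms(1)])
  next
    case 2
    then consider "a = Suc x" | "b = Suc x" using b by auto
    then have "ord_sign a x * ord_sign b x = - (ord_sign a y * ord_sign b y)"
      by cases (use 2 assms in \<open>auto simp: ord_sign_def sgn_if\<close>)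
    then show ?thesis
      using 2 ord_sign_values[of a y] ord_sign_values[of b y] assms
      by (auto simp: alt_sign_mult[OF assms(1)])
  next
    case 3
    then have "Suc x \<in> {a, b}" "Suc (Suc x) \<in> {a, b}" using b by auto
    then have "ord_sign a x = - 1" "ord_sign b x = - 1" "ord_sign a y = 1" "ord_sign b y = 1"
      using 3 by (auto simp: ord_sign_def sgn_if)
    then show ?thesis using 3 by (simp add: alt_sign_mult[OF assms(1)])
  qed
qed

lemma chirotope_move:
  assumes \<chi>: "is_chirotope E r C \<chi>" and "set (ps @ y # us @ vs) \<subseteq> E" "length (ps @ y # us @ vs) = r"
  shows "\<chi> (ps @ y # us @ vs) = (- 1) ^ length us * \<chi> (ps @ us @ y # vs)"
  using assms(2,3)
proof (induction us arbitrary: ps)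
  case (Cons u us)
  have swap: "\<chi> (xs[i := xs ! j, j := xs ! i]) = - \<chi> xs"
    if "set xs \<subseteq> E" "length xs = r" "i < j" "j < r" for xs i j
    using \<chi> that unfolding is_chirotope_def by blast
  let ?xs = "ps @ y # u # us @ vs"
  have "?xs[length ps := ?xs ! Suc (length ps), Suc (length ps) := ?xs ! length ps] = ps @ u # y # us @ vs"
    by (simp add: list_update_append nth_append)
  then have "\<chi> (ps @ u # y # us @ vs) = - \<chi> ?xs"
    using swap[of ?xs "length ps" "Suc (length ps)"] Cons.prems by auto
  moreover have "\<chi> ((ps @ [u]) @ y # us @ vs) = (- 1) ^ length us * \<chi> ((ps @ [u]) @ us @ y # vs)"
    by (rule Cons.IH) (use Cons.prems in auto)
  ultimately show ?case by simp
qed simp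

text \<open>Both \<open>x # us @ vs\<close> and \<open>y # us @ vs\<close> become increasing when
  the head moves behind \<open>us\<close>, because nothing in the support lies between
  \<open>x\<close> and \<open>y\<close>. So their chirotope values agree, and the pivoting rule
  leaves \<open>- X x * X y = 1\<close>.\<close>

lemma alternating_consecutive:
  assumes A: "is_alternating n r C" and X: "X \<in> C"
    and xy: "x \<in> supp X" "y \<in> supp X" "x < y" "\<And>z. z \<in> supp X \<Longrightarrow> \<not> (x < z \<and> z < y)"
  shows "X x * X y = - 1"
proof -
  obtain \<chi> where \<chi>: "is_chirotope {1..n} r C \<chi>"
    and pos: "\<And>bs. set bs \<subseteq> {1..n} \<Longrightarrow> length bs = r \<Longrightarrow> sorted_wrt (<) bs \<Longrightarrow> \<chi> bs = 1"
    and U: "uniform_oriented_matroid {1..n} r C"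
    using A unfolding is_alternating_def by blast
  then interpret oriented_matroid "{1..n}" C by (simp add: uniform_oriented_matroid_def)
  have supp: "supp X \<subseteq> {1..n}" "card (supp X) = r + 1"
    using U X unfolding uniform_oriented_matroid_def by blast+
  then have fin: "finite (supp X)" by (auto intro: finite_subset)
  define us where "us = sorted_list_of_set {z \<in> supp X. z < x}"
  define vs where "vs = sorted_list_of_set {z \<in> supp X. y < z}"
  have set_us: "set us = {z \<in> supp X. z < x}" and set_vs: "set vs = {z \<in> supp X. y < z}"
    using fin by (auto simp: us_def vs_def)
  have srt: "sorted_wrt (<) us" "sorted_wrt (<) vs" by (auto simp: us_def vs_def)
  have split: "supp X = {z \<in> supp X. z < x} \<union> {z \<in> supp X. y < z} \<union> {x, y}"
    using xy by (auto dest: xy(4))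
  have "card (supp X) = length us + length vs + 2"
  proof -
    have "card (supp X) = card ({z \<in> supp X. z < x} \<union> {z \<in> supp X. y < z} \<union> {x, y})" using split by simp
    also have "\<dots> = card ({z \<in> supp X. z < x} \<union> {z \<in> supp X. y < z}) + card {x, y}"
      by (rule card_Un_disjoint) (use fin xy in auto)
    also have "card ({z \<in> supp X. z < x} \<union> {z \<in> supp X. y < z}) = card {z \<in> supp X. z < x} + card {z \<in> supp X. y < z}"
      by (rule card_Un_disjoint) (use fin xy in auto)
    finally show ?thesis using xy by (simp add: us_def vs_def fin)
  qed
  then have len: "length (us @ vs) + 1 = r" using supp by simp
  have val: "\<chi> (w # us @ vs) = (- 1) ^ length us"
    if w: "w = x \<or> w = y" for w
  proof -
    have "\<chi> ([] @ w # us @ vs) = (- 1) ^ length us * \<chi> ([] @ us @ w # vs)"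
      by (rule chirotope_move[OF \<chi>]) (use w xy supp len set_us set_vs in auto)
    moreover have "\<chi> (us @ w # vs) = 1"
      by (rule pos) (use w xy supp len set_us set_vs srt in \<open>auto simp: sorted_wrt_append\<close>)
    ultimately show ?thesis by simp
  qed
  have "\<chi> (y # us @ vs) = - X x * X y * \<chi> (x # us @ vs)"
  proof -
    have "supp X \<subseteq> {x, y} \<union> set (us @ vs)" using split set_us set_vs by auto
    moreover have "set (us @ vs) \<subseteq> {1..n}" using set_us set_vs supp by auto
    ultimately show ?thesis
      using \<chi> X xy(1,2,3) len unfolding is_chirotope_def by (metis nat_neq_iff)
  qed
  then show ?thesis using val[of x] val[of y] by (cases "even (length us)") auto
qed

text \<open>Along the support, consecutive signs are opposite both for \<open>X\<close> and for
  \<open>alt_sign a b\<close>. Their product is therefore constant, and \<open>X\<close> is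
  determined up to sign by its zeros.\<close>

lemma alternating_eq_alt_circuits:
  assumes A: "is_alternating 8 5 C"
  shows "C = alt_circuits"
proof -
  have U: "uniform_oriented_matroid E8 5 C" using A unfolding is_alternating_def by simp
  then interpret oriented_matroid E8 C by (simp add: uniform_oriented_matroid_def)
  have supps: "supp ` C = {E8 - {a, b} | a b. a \<in> E8 \<and> b \<in> E8 \<and> a \<noteq> b}"
    using U pair_complements[of E8 5] unfolding uniform_oriented_matroid_def by simp
  have key: "X = signed E8 (shifted alt_table) True a b \<or> X = - signed E8 (shifted alt_table) True a b"
    if X: "X \<in> C" and ab: "a \<in> E8" "b \<in> E8" "a \<noteq> b" "supp X = E8 - {a, b}" for X a b
  proof -
    have Xv: "X c = 1 \<or> X c = - 1" if "c \<in> supp X" for c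
      using X circuits_sign_vectors that by (auto simp: sign_vectors_def supp_def)
    have Av: "alt_sign a b c = 1 \<or> alt_sign a b c = - 1" if "c \<in> supp X" for c
      using alt_sign_values[of a b c] that ab by auto
    have const: "X x * alt_sign a b x = X y * alt_sign a b y" if "x \<in> supp X" "y \<in> supp X" for x y
    proof (rule consecutive_constant[of "supp X" "\<lambda>c. X c * alt_sign a b c", OF _ that])
      fix x y assume xy: "x \<in> supp X" "y \<in> supp X" "x < y" "\<And>z. z \<in> supp X \<Longrightarrow> \<not> (x < z \<and> z < y)"
      have "X x * X y = - 1" by (rule alternating_consecutive[OF A X xy])
      moreover have "alt_sign a b x * alt_sign a b y = - 1"
      proof (rule alt_sign_consecutive[OF ab(3) xy(3)])
        show "x \<notin> {a, b}" "y \<notin> {a, b}" using xy ab by auto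
        show "z \<in> {a, b}" if "x < z" "z < y" for z
        proof -
          have "z \<in> E8" using that xy ab(4) by auto
          then show ?thesis using xy(4)[of z] that ab(4) by auto
        qed
      qed
      ultimately show "X x * alt_sign a b x = X y * alt_sign a b y"
        using Xv[OF xy(1)] Xv[OF xy(2)] Av[OF xy(1)] Av[OF xy(2)] by auto
    qed
    obtain c where c: "c \<in> supp X" using circuit_nonempty[OF X] by blast
    define v where "v = X c * alt_sign a b c"
    have v: "v = 1 \<or> v = - 1" using Xv[OF c] Av[OF c] by (auto simp: v_def)
    have "X e = v * signed E8 (shifted alt_table) True a b e" for e
    proof (cases "e \<in> supp X")
      case True
      then have "X e * alt_sign a b e = v" using const[OF True c] by (simp add: v_def)
      moreover have "e \<in> E8" using True ab by auto
      ultimately show ?thesis unfolding signed_alt[OF ab(1-3)] using Av[OF True] v by auto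
    next
      case False
      then have "X e = 0" by (simp add: supp_def)
      moreover have "e \<notin> E8 - {a, b}" using False ab(4) by simp
      ultimately show ?thesis by (auto simp: signed_def)
    qed
    then show ?thesis using v by (auto simp: fun_eq_iff)
  qed
  show ?thesis
  proof (intro subset_antisym subsetI)
    fix X assume X: "X \<in> C"
    then obtain a b where ab: "a \<in> E8" "b \<in> E8" "a \<noteq> b" "supp X = E8 - {a, b}"
      using imageI[OF X, of supp] unfolding supps by blast
    show "X \<in> alt_circuits"
      using key[OF X ab] signed_in_circuits[OF alt_chirotope ab(1-3)] unfolding alt_circuits_def
      by (auto simp: signed_uminus)
  next
    fix X assume "X \<in> alt_circuits"
    then obtain a b where ab: "a \<in> E8" "b \<in> E8" "a \<noteq> b" "X = signed E8 (shifted alt_table) True a b"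
      unfolding alt_circuits_def circuits_def by blast
    have "E8 - {a, b} \<in> supp ` C" unfolding supps using ab(1-3) by blast
    then obtain Y where Y: "Y \<in> C" "supp Y = E8 - {a, b}" by (metis imageE)
    from key[OF Y(1) ab(1-3) Y(2)] show "X \<in> C"
    proof
      assume "Y = - signed E8 (shifted alt_table) True a b"
      then have "X = - Y" unfolding ab(4) by (simp add: fun_eq_iff)
      then show ?thesis using circuit_symmetric[OF Y(1)] by simp
    qed (use Y ab(4) in simp)
  qed
qed

section \<open>An alternating chirotope of rank 5 on 8 elements\<close>

fun list_sign :: "nat list \<Rightarrow> int" where
  "list_sign [] = 1"
| "list_sign (x # xs) = prod_list (map (ord_sign x) xs) * list_sign xs"

text \<open>The product of the order signs of all pairs is the sign of a Vandermonde determinant,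
  which vanishes exactly when two entries coincide.\<close>

lemma list_sign_eq_0: "list_sign xs = 0 \<longleftrightarrow> \<not> distinct xs"
  by (induction xs) (auto simp: prod_list_zero_iff ord_sign_eq_0)

lemma list_sign_values: "list_sign xs \<in> {- 1, 0, 1}"
proof (induction xs)
  case (Cons x xs)
  have "prod_list (map (ord_sign x) xs) \<in> {- 1, 0, 1}"
    by (induction xs) (auto simp: ord_sign_def sgn_if)
  then show ?case using Cons by auto
qed simp

lemma list_sign_sorted: "sorted_wrt (<) xs \<Longrightarrow> list_sign xs = 1"
proof (induction xs)
  case (Cons x xs)
  have "prod_list (map (ord_sign x) xs) = 1"
    using Cons.prems by (induction xs) (auto simp: ord_sign_less)
  then show ?case using Cons by simp
qed simp

lemma list_sign_swap:
  assumes "length xs = 5" "i < j" "j < 5"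
  shows "list_sign (xs[i := xs ! j, j := xs ! i]) = - list_sign xs"
proof -
  obtain a b c d e where xs: "xs = [a, b, c, d, e]"
    using assms(1) by (auto simp: length_Suc_conv numeral_eq_Suc)
  note sw = ord_sign_swap[of b a] ord_sign_swap[of c a] ord_sign_swap[of d a] ord_sign_swap[of e a]
    ord_sign_swap[of c b] ord_sign_swap[of d b] ord_sign_swap[of e b] ord_sign_swap[of d c]
    ord_sign_swap[of e c] ord_sign_swap[of e d]
  have "i = 0 \<or> i = 1 \<or> i = 2 \<or> i = 3" "j = 1 \<or> j = 2 \<or> j = 3 \<or> j = 4" using assms(2,3) by arith+
  then show ?thesis
    using assms(2) by (elim disjE) (simp_all add: xs sw mult_ac numeral_eq_Suc)
qed

text \<open>Exactly \<open>x - 1\<close> elements are smaller than \<open>x\<close>, and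
  \<open>x + 1\<close> has the same parity.\<close>

lemma prod_ord_sign_E8:
  assumes "x \<in> E8"
  shows "(\<Prod>z\<in>E8 - {x}. ord_sign x z) = (- 1) ^ (x + 1)"
proof -
  have "E8 = {1, 2, 3, 4, 5, 6, 7, 8}" by auto
  moreover from this assms have "x = 1 \<or> x = 2 \<or> x = 3 \<or> x = 4 \<or> x = 5 \<or> x = 6 \<or> x = 7 \<or> x = 8" by auto
  ultimately show ?thesis
    by (elim disjE) (simp_all add: ord_sign_def sgn_if insert_Diff_if)
qed

lemma alt_bases:
  assumes "distinct xs" "set xs \<subseteq> E8" "length xs = 5"
  shows "set xs \<in> bases E8 alt_circuits"
proof -
  have supps: "supp ` alt_circuits = {A. A \<subseteq> E8 \<and> card A = 5 + 1}"
    using alt_uniform unfolding uniform_oriented_matroid_def by blast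
  have card: "card (set xs) = 5" using assms distinct_card by metis
  have "\<not> supp X \<subseteq> set xs" if "X \<in> alt_circuits" for X
  proof
    assume "supp X \<subseteq> set xs"
    then have "card (supp X) \<le> card (set xs)" by (simp add: card_mono)
    moreover have "card (supp X) = 6" using imageI[OF that, of supp] unfolding supps by simp
    ultimately show False using card by simp
  qed
  moreover have "\<exists>X\<in>alt_circuits. supp X \<subseteq> insert e (set xs)" if "e \<in> E8 - set xs" for e
  proof -
    have "insert e (set xs) \<in> supp ` alt_circuits"
      unfolding supps using that assms card by auto
    then show ?thesis by (metis imageE order_refl)
  qed
  ultimately show ?thesis unfolding bases_def using assms by blast
qed

text \<open>The four entries of \<open>xs\<close> are the elements outside
  \<open>{a, b, x, y}\<close>. The order signs of \<open>x\<close> against all other elements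
  multiply to a power of \<open>- 1\<close>, and likewise for \<open>y\<close>; dividing out the
  elements missing from \<open>xs\<close> expresses both list signs by the factors of
  \<open>alt_sign\<close>.\<close>

lemma alt_pivot:
  assumes X: "X \<in> alt_circuits" and xs: "set xs \<subseteq> E8" "length xs = 4"
    and xy: "x \<noteq> y" "x \<in> supp X" "y \<in> supp X" and sub: "supp X \<subseteq> {x, y} \<union> set xs"
  shows "list_sign (y # xs) = - X x * X y * list_sign (x # xs)"
proof -
  obtain a b where ab: "a \<in> E8" "b \<in> E8" "a \<noteq> b" "supp X = E8 - {a, b}" "\<And>c. c \<in> E8 \<Longrightarrow> X c = alt_sign a b c"
    using alt_circuitsE[OF X] by metis
  have E: "x \<in> E8" "y \<in> E8" "x \<noteq> a" "x \<noteq> b" "y \<noteq> a" "y \<noteq> b" using xy ab(4) by auto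
  have "card (supp X - {x, y}) = 4"
  proof -
    have "supp X - {x, y} = E8 - {a, b, x, y}" using ab(4) by auto
    moreover have "card (E8 - {a, b, x, y}) = card E8 - card {a, b, x, y}"
      by (rule card_Diff_subset) (use E ab in auto)
    moreover have "card {a, b, x, y} = 4" using E ab xy by auto
    ultimately show ?thesis by simp
  qed
  moreover have sub': "supp X - {x, y} \<subseteq> set xs" using sub by auto
  moreover have "card (set xs) \<le> 4" using card_length[of xs] xs by simp
  ultimately have set_xs: "set xs = E8 - {a, b, x, y}" and "card (set xs) = length xs"
    using card_seteq[OF _ sub'] xs card_mono[OF _ sub'] ab(4) by auto
  then have dist: "distinct xs" by (simp add: card_distinct)
  have prod: "prod_list (map (ord_sign u) xs) * ord_sign u v * ord_sign u a * ord_sign u b = (- 1) ^ (u + 1)"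
    if uv: "u = x \<and> v = y \<or> u = y \<and> v = x" for u v
  proof -
    have u: "u \<in> E8" "v \<in> E8" "u \<noteq> v" "u \<noteq> a" "u \<noteq> b" "v \<noteq> a" "v \<noteq> b"
      using uv E xy(1) by blast+
    have xs': "set xs = E8 - {a, b, u, v}" using set_xs uv by blast
    have "E8 - {u} = insert v (insert a (insert b (set xs)))"
      unfolding xs' using u ab(1,2) by blast
    moreover have "v \<notin> insert a (insert b (set xs))" "a \<notin> insert b (set xs)" "b \<notin> set xs"
      unfolding xs' using u ab(3) by blast+
    ultimately have "(\<Prod>z\<in>E8 - {u}. ord_sign u z) = ord_sign u v * (ord_sign u a * (ord_sign u b * prod (ord_sign u) (set xs)))"
      by simp
    then show ?thesis
      using prod_ord_sign_E8[OF u(1)] prod.distinct_set_conv_list[OF dist, of "ord_sign u"] by (simp add: mult_ac)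
  qed
  have s: "ord_sign y x = - ord_sign x y" "ord_sign a x = - ord_sign x a" "ord_sign b x = - ord_sign x b"
    "ord_sign a y = - ord_sign y a" "ord_sign b y = - ord_sign y b" by (rule ord_sign_swap)+
  have v: "ord_sign x y = 1 \<or> ord_sign x y = - 1" "ord_sign x a = 1 \<or> ord_sign x a = - 1" "ord_sign x b = 1 \<or> ord_sign x b = - 1"
    "ord_sign y a = 1 \<or> ord_sign y a = - 1" "ord_sign y b = 1 \<or> ord_sign y b = - 1" "ord_sign a b = 1 \<or> ord_sign a b = - 1"
    using ord_sign_values E xy ab by metis+
  define P where "P u = prod_list (map (ord_sign u) xs)" for u
  have Px: "P x = (- 1) ^ (x + 1) * ord_sign x y * ord_sign x a * ord_sign x b"
    using prod[of x y] v unfolding P_def by (elim disjE) simp_all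
  have Py: "P y = - ((- 1) ^ (y + 1) * ord_sign x y * ord_sign y a * ord_sign y b)"
    using prod[of y x] v s(1) unfolding P_def by (elim disjE) simp_all
  have alt: "alt_sign a b x * alt_sign a b y = (- 1) ^ (x + y) * (ord_sign x a * ord_sign x b) * (ord_sign y a * ord_sign y b)"
    unfolding alt_sign_mult[OF ab(3)] s by simp
  have sq: "ord_sign x a * ord_sign x a = 1" "ord_sign x b * ord_sign x b = 1" using v(2,3) by auto
  have pow: "(- 1 :: int) ^ (x + y) * (- 1) ^ (x + 1) = (- 1) ^ (y + 1)" by (simp add: minus_one_power_iff)
  have "(alt_sign a b x * alt_sign a b y) * P x =
      ((- 1) ^ (x + y) * (- 1) ^ (x + 1)) * (ord_sign x a * ord_sign x a) * (ord_sign x b * ord_sign x b) *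
      (ord_sign x y * ord_sign y a * ord_sign y b)"
    unfolding alt Px by (simp only: mult_ac)
  then have "P y = - (alt_sign a b x * alt_sign a b y) * P x"
    unfolding Py sq pow by simp
  then show ?thesis using ab(5)[OF E(1)] ab(5)[OF E(2)] by (simp add: P_def mult_ac)
qed

text \<open>This is the existence half; without it the claims about all alternating \<open>A\<close>
  could be vacuous.\<close>

lemma alt_is_alternating: "is_alternating 8 5 alt_circuits"
  unfolding is_alternating_def
proof (intro conjI exI[of _ list_sign] allI impI)
  show "uniform_oriented_matroid E8 5 alt_circuits" by (rule alt_uniform)
  show "is_chirotope E8 5 alt_circuits list_sign"
    unfolding is_chirotope_def
  proof (intro conjI allI impI ballI)
    fix xs :: "nat list" assume xs: "set xs \<subseteq> E8 \<and> length xs = 5"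
    show "list_sign xs \<in> {- 1, 0, 1}" by (rule list_sign_values)
    show "(list_sign xs \<noteq> 0) = (distinct xs \<and> set xs \<in> bases E8 alt_circuits)"
      using list_sign_eq_0 alt_bases xs by blast
  next
    fix xs :: "nat list" and i j :: nat assume "set xs \<subseteq> E8 \<and> length xs = 5 \<and> i < j \<and> j < 5"
    then show "list_sign (xs[i := xs ! j, j := xs ! i]) = - list_sign xs" using list_sign_swap by blast
  next
    fix X xs x y assume "X \<in> alt_circuits" "set xs \<subseteq> E8 \<and> length xs + 1 = 5 \<and> x \<noteq> y \<and>
        x \<in> supp X \<and> y \<in> supp X \<and> supp X \<subseteq> {x, y} \<union> set xs"
    then show "list_sign (y # xs) = - X x * X y * list_sign (x # xs)" using alt_pivot by auto
  qed
  fix bs :: "nat list" assume "set bs \<subseteq> E8 \<and> length bs = 5 \<and> sorted_wrt (<) bs"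
  then show "list_sign bs = 1" using list_sign_sorted by blast
qed

section \<open>Enumeration\<close>

definition reps2 :: "nat \<Rightarrow> string list" where
  "reps2 i = [
    '''']"

definition reps3 :: "nat \<Rightarrow> string list" where
  "reps3 i = [
    ''H'']"

definition reps4 :: "nat \<Rightarrow> string list" where
  "reps4 i = [
    ''O'']"

definition reps5 :: "nat \<Rightarrow> string list" where
  "reps5 i = [
    ''OOL'']"

definition reps6 :: "nat \<Rightarrow> string list" where
  "reps6 i = [
    ''OOCOK'', ''OOOOL'', ''OOOON'', ''OOOOO'']"

definition reps7 :: "nat \<Rightarrow> string list" where
  "reps7 i = [
    ''OOOOLOOMF'', ''OOOOLOOOF'', ''OOOONOO@@'', ''OOOONOOD@'', ''OOOONOOF@'', ''OOOOOOOL@'',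
    ''OOOOOOON@'', ''OOOOOOOO@'', ''OOOOOOOOH'', ''OOOOOOOOL'', ''OOOOOOOON'']"

text \<open>Groups of at most twelve keep both parts of a target's position within one character
  each. The order is that of the invariant, increasing across the groups.\<close>

fun reps8 :: "nat \<Rightarrow> string list" where
  "reps8 0 = [
    ''OOOONOOOCOOC@@'', ''OOOOOOOLAOOL@C'', ''OOOOOOOOMOON@@'', ''OOOOOOOOIOOOLA'',
    ''OOOOOOOOMOOOL@'', ''OOOONOO@AOOGDK'', ''OOOOOOONAOOC@@'', ''OOOOOOOOAOOC@@'',
    ''OOOOOOOFAOON@A'', ''OOOOOOONAOOL@A'', ''OOOOOOOOAONB@@'', ''OOOOOOONIOOODA'']"
| "reps8 (Suc 0) = [
    ''OOOOOOOOAOO@@@'', ''OOOOOOOOMOOKH@'', ''OOOOOOOOMOOOH@'', ''OOOOOOONIOOOLA'',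
    ''OOOOOOOOIOOKH@'', ''OOOOOOOOMOOOK@'', ''OOOOOOOOIONB@@'', ''OOOOOOOFIOON@A'',
    ''OOOOOOOLAOOH@@'', ''OOOOOOONIOON@A'', ''OOOOOOOOMOOCB@'', ''OOOOOOOOMOOKK@'']"
| "reps8 (Suc (Suc 0)) = [
    ''OOOOOOOOAOOH@@'', ''OOOOOOOOMOL@@@'', ''OOOOOOOOMOOL@@'', ''OOOONOODAOOGDC'',
    ''OOOONOOOCOOK@@'', ''OOOOOOOOMOOOOH'', ''OOOOOOOOAOOB@@'', ''OOOOOOONIOOJ@@'',
    ''OOOOOOONAOON@A'', ''OOOOOOONIOOK@@'', ''OOOOOOOOMOOO@@'', ''OOOOOOOOMOOOB@'']"
| "reps8 (Suc (Suc (Suc 0))) = [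
    ''OOOOOOOLAOOOFK'', ''OOOOOOONAOOODC'', ''OOOOOOOLAOOL@A'', ''OOOOOOOOMOOOJ@'',
    ''OOOOOOOLAOON@A'', ''OOOOOOOOOOOOOH'', ''OOOOOOOOIOOOH@'', ''OOOOOOONIOOH@@'',
    ''OOOONOOFAOOGDK'', ''OOOOOOOOIOOONI'', ''OOOOOOOOIOOOJ@'', ''OOOOOOONIOOC@@'']"
| "reps8 (Suc (Suc (Suc (Suc 0)))) = [
    ''OOOOOOOOIOOKJ@'', ''OOOOOOOFIOOODA'', ''OOOOOOOOIOOH@@'', ''OOOOOOONAOOH@@'',
    ''OOOOOOOOION@@@'', ''OOOOOOOOMOOON@'', ''OOOOOOOOIOOCB@'', ''OOOOOOOOMOOH@@'',
    ''OOOOOOOOMOO@@@'', ''OOOOOOOOMOOOO@'', ''OOOOOOOOIOOONA'', ''OOOOOOOOMON@@@'']"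
| "reps8 (Suc (Suc (Suc (Suc (Suc 0))))) = [
    ''OOOOOOOOOOOON@'', ''OOOOOOOOIOOOL@'', ''OOOONOO@AOOFDK'', ''OOOOOOOOIOOJ@@'',
    ''OOOOOOONAOOB@@'', ''OOOOOOOOMOOK@@'', ''OOOOOOO@AOOOLK'', ''OOOOOOOOOOON@@'',
    ''OOOOOOONAOOO@A'', ''OOOOOOOOIOOB@@'', ''OOOOOOONAOOJ@@'', ''OOOOOOOOAOOJ@@'']"
| "reps8 (Suc (Suc (Suc (Suc (Suc (Suc 0)))))) = [
    ''OOOOOOOOAOOK@@'', ''OOOOOOONIOOB@@'', ''OOOOOOONAOOOFK'', ''OOOOOOOOIOOC@@'',
    ''OOOOOOOLAOONDK'', ''OOOOOOONIOOO@A'', ''OOOOOOOOMOOKJ@'', ''OOOOOOOOIOOOB@'',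
    ''OOOOOOOFIOOO@A'', ''OOOOOOOOIOO@@@'', ''OOOOLOOOOOOOKD'', ''OOOOOOOOOOOOJ@'']"
| "reps8 (Suc (Suc (Suc (Suc (Suc (Suc (Suc 0))))))) = [
    ''OOOOOOOOIOOON@'', ''OOOOOOOOOOOOK@'', ''OOOOOOOOOOOOO@'', ''OOOOOOOLAOOONK'',
    ''OOOOOONDAOOONK'', ''OOOONOODAOOFDC'', ''OOOOOOOOOOOOOL'', ''OOOOOOOOIOOK@@'',
    ''OOOONOODAOOGDK'', ''OOOOOON@AOOONK'', ''OOOOOOOOMOOKB@'', ''OOOOOOOLAOOODK'']"
| "reps8 (Suc (Suc (Suc (Suc (Suc (Suc (Suc (Suc 0)))))))) = [
    ''OOOOOOOOIOOKB@'', ''OOOOOOONAOOODK'', ''OOOONOOFAOOODC'', ''OOOOOOOOIOOO@@'',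
    ''OOOONOOFAOOODK'', ''OOOOOOODAOOOFK'', ''OOOOOOO@AOOONK'', ''OOOOOOOOOOOOON'',
    ''OOOOOOOFAOOOFK'', ''OOOOOOOOIOOONK'', ''OOOOOOONIOO@@@'', ''OOOOOOOOIOOOOK'']"
| "reps8 (Suc (Suc (Suc (Suc (Suc (Suc (Suc (Suc (Suc 0))))))))) = [
    ''OOOOOOO@AOOOFK'', ''OOOOOOOOOOOOOD'', ''OOOOOONDAOOOLK'', ''OOOOOOODAOOOLK'',
    ''OOOONOODAOOODC'', ''OOOOOOOLAOOOLK'', ''OOOOOOODAOOONK'', ''OOOONOODAOOFDK'',
    ''OOOONOO@AOONDK'', ''OOOOOOODAOOODK'', ''OOOONOODAOOOLC'', ''OOOONOOFAOOOLC'']"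
| "reps8 (Suc (Suc (Suc (Suc (Suc (Suc (Suc (Suc (Suc (Suc 0)))))))))) = [
    ''OOOONOODAOONDC'', ''OOOOOOONAOOOLK'', ''OOOOOOONAOOONK'', ''OOOONOODAOONDK'',
    ''OOOONONDAOONDK'', ''OOOONOODAOOODK'', ''OOOONON@AOONDK'', ''OOOOOOOFAOOONK'',
    ''OOOONOOFAOOOLK'', ''OOOOLOOOGOOOID'', ''OOOOOOONIOOOOK'', ''OOOOOOOOOOOOOO'']"
| "reps8 (Suc (Suc (Suc (Suc (Suc (Suc (Suc (Suc (Suc (Suc (Suc 0))))))))))) = [
    ''OOOONOODAOOOLK'', ''OOOOOOONIOOONK'', ''OOOODOOMGOOOMO'']"
| "reps8 _ = []"

text \<open>There is one certificate per matrix of \<open>exts\<close>, in the order of enumeration.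
  After the two address characters, letter \<open>i\<close> gives the signed element of the
  extension that stands at position \<open>i\<close> of the target.\<close>

lemma chk_exts_2_0: "chk_exts 2 reps3 (table_of 2 '''') [
    ''@@@AB'']"
  by code_simp

lemma chk_exts_3_0: "chk_exts 3 reps4 (table_of 3 ''H'') [
    ''@@@ABC'', ''@@@IJK'', ''@@@IKJ'', ''@@@ACB'']"
  by code_simp

lemma chk_exts_4_0: "chk_exts 4 reps5 (table_of 4 ''O'') [
    ''@@@ABCD'', ''@@HIDCB'', ''@@HBALK'', ''@@HKJID'', ''@@HBAKL'', ''@@HICDB'', ''@@@ABDC'',
    ''@@@CIJL'', ''@@@JKAD'', ''@@HBDAK'', ''@@@ADBC'', ''@@HICBD'']"
  by code_simp

lemma chk_exts_5_0: "chk_exts 5 reps6 (table_of 5 ''OOL'') [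
    ''@C@ABCDE'', ''@B@ABCDE'', ''@A@ABCDE'', ''@BHIEDCB'', ''@B@DEIJK'', ''@A@DEIJK'',
    ''@BHLKJIE'', ''@CHLKJIE'', ''@B@EDIJK'', ''@A@ABCED'', ''@B@ABCED'', ''@C@ABCED'',
    ''@BIHLMKJ'', ''@ABAMKLH'', ''@BABCD@M'', ''@AABCDE@'', ''@@@ABECD'', ''@ABAKMLH'',
    ''@AA@JMKL'', ''@BIHLKMJ'', ''@C@ABECD'', ''@B@ABECD'', ''@BHLKMJI'', ''@A@MKLAB'',
    ''@BHMIDCB'', ''@A@DIMJK'', ''@BHLKJMI'', ''@C@AEBCD'', ''@BIHLKJM'', ''@AA@MJKL'',
    ''@BA@MJKL'']"
  by code_simp

lemma chk_exts_6_0: "chk_exts 6 reps7 (table_of 6 ''OOCOK'') [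
    ''@AHNMLKJI'', ''@CF@ABCED'', ''@AEF@ACBD'', ''@AMNBCA@L'', ''@AEFJL@AC'', ''@AMNA@LJK'',
    ''@CNA@JLMK'', ''@AIFECDBH'', ''@AEFIKJL@'', ''@AANMHBDC'', ''@CNACE@LJ'', ''@AIFDBHMK'',
    ''@AANLKMHB'', ''@CFHMLKIJ'', ''@AIFHMKLJ'', ''@A@NABCDE'', ''@A@FEIJKL'', ''@AMNHDBCA'',
    ''@CNHDCBMA'', ''@AEFCBDHI'', ''@AMNKIHDB'', ''@AEFDHIKJ'', ''@AMNLJKIH'', ''@CFIKLJE@'',
    ''@CFCAMBDH'', ''@ALNMBAC@'', ''@ADFE@CAB'', ''@ALNAC@EJ'', ''@ADFIJE@C'', ''@ALN@EJIK'',
    ''@CN@EIJLK'', ''@AHFDCBAM'', ''@AHNKJIED'', ''@CF@LMACB'', ''@ACF@LAMB'', ''@AKNMAL@J'',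
    ''@ACFEJ@LA'', ''@CNKIDHMB'', ''@AKNL@JEI'', ''@ACFDIEJ@'', ''@ADFCABMH'', ''@ALNKHMBA'',
    ''@CNJEDIKH'', ''@ADFBMHKI'', ''@ALNJIKHM'', ''@ADFHKIJE'', ''@CFHKJIDE'', ''@A@NLMABC'',
    ''@A@FCDEIJ'', ''@CNHBAMKL'', ''@AKNHBMAL'', ''@ACFAMBHD'', ''@AKNIDHBM'', ''@ACFBHDIE'',
    ''@AKNJEIDH'', ''@CFBMKHDI'', ''@CFALKMBH'', ''@AJNKMLA@'', ''@ABFC@ALM'', ''@AJNLA@CE'',
    ''@ABFDEC@A'', ''@CN@CDEJI'', ''@AJN@CEDI'', ''@AHFBAMLK'', ''@AHNIEDCB'', ''@AAF@JLKM'',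
    ''@CF@JKLAM'', ''@AINKLJ@E'', ''@AAFCE@JL'', ''@CNIDBHKM'', ''@AINJ@ECD'', ''@ABFALMKH'',
    ''@AAFBDCE@'', ''@AJNIHKML'', ''@CNIHMKJL'', ''@ABFMKHID'', ''@AJNEDIHK'', ''@CFHIEDBC'',
    ''@ABFHIDEC'', ''@A@NJKLMA'']"
  by code_simp

lemma chk_exts_6_1: "chk_exts 6 reps7 (table_of 6 ''OOOOL'') [
    ''@HF@ABCDE'', ''@A@ABCDEF'', ''@BFECHIJL'', ''@@@ABCDEF'', ''@BK@DEFJI'', ''@HDEFJK@A'',
    ''@HLMNA@KJ'', ''@DNA@JKML'', ''@HHIFEDCB'', ''@B@KLMNAB'', ''@BDCHIFEJ'', ''@BNMHCBAD'',
    ''@@IFCBHML'', ''@BCD@NABM'', ''@H@NABCDE'', ''@FHNLKJIE'', ''@C@ABCDFE'', ''@B@KLNMAB'',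
    ''@E@ABCDFE'', ''@FHIEFDCB'', ''@HLNMA@KJ'', ''@HDFEJK@A'', ''@BK@DFEJI'', ''@@@ABCDFE'',
    ''@BFILKJE@'', ''@FCBMNLHI'', ''@CK@DFEJI'', ''@ABCFED@A'', ''@AJKNA@DE'', ''@CCBMLHFI'',
    ''@FKJIFHLM'', ''@ECBMLNHI'', ''@FCBMLNHI'', ''@HFDEJK@A'', ''@HNLMA@KJ'', ''@FHIEDFCB'',
    ''@E@ABCFDE'', ''@EHIEDFCB'', ''@F@ABCFDE'', ''@HNKJIHLM'', ''@HFCBMLHI'', ''@FKN@DEJI'',
    ''@ECBMLHFI'', ''@FLMAF@KJ'', ''@CDCHNIEJ'', ''@ADEJK@AF'', ''@ALMA@KJN'', ''@CLHCFBMA'',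
    ''@FDEJNK@A'', ''@BFAKLMBH'', ''@@HIEDCFB'', ''@BLHCFBMA'', ''@HCFBMLHI'', ''@HKNJIHLM'',
    ''@F@ABFCDE'', ''@EHIEDCFB'', ''@BHLKNJIE'', ''@CHIEDCFB'', ''@F@NKLMAB'', ''@HHNIEDCB'',
    ''@BDCHNIEJ'', ''@@AFDE@JK'', ''@BNJ@DEIC'', ''@BCD@AFBM'', ''@BHLKJNIE'', ''@H@AFBCDE'',
    ''@HKJNIHLM'', ''@DNIHMLJK'', ''@HCBFMLHI'', ''@BLHCBFMA'', ''@BFBD@AMK'', ''@@HIEDCBF'',
    ''@AHIEDCBF'', ''@HFHIEDCB'']"
  by code_simp

lemma chk_exts_6_2: "chk_exts 6 reps7 (table_of 6 ''OOOON'') [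
    ''@IJIHNMLK'', ''@HJIHNMLK'', ''@GJIHNMLK'', ''@IKLMNBA@'', ''@EHIFEDCB'', ''@FHIFEDCB'',
    ''@GHIFEDCB'', ''@D@ABCDEF'', ''@C@ABCDEF'', ''@B@ABCDEF'', ''@B@EFIJKL'', ''@BJIHMLKN'',
    ''@GBANKLMH'', ''@I@NABCDE'', ''@EHNLKJIE'', ''@D@ABCDFE'', ''@F@ABCDFE'', ''@EHIEFDCB'',
    ''@G@ABCDFE'', ''@IKLNMBA@'', ''@GJIHMNLK'', ''@HJIHMNLK'', ''@BEFCHIJL'', ''@A@ABCDFE'',
    ''@BJKNA@ED'', ''@BKNMBA@D'', ''@AABCFDE@'', ''@CJIHMLKN'', ''@FBANKLMH'', ''@ECD@NABM'',
    ''@DK@FDEJI'', ''@CK@FDEJI'', ''@BKLMBA@F'', ''@BK@FDEJI'', ''@BEDCHIJN'', ''@GJIHMLNK'',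
    ''@IKNLMBA@'', ''@G@ABCFDE'', ''@H@ABCFDE'', ''@DJIHMLKN'', ''@EBANKLMH'', ''@DKJIFHLM'',
    ''@HEDCHNIJ'', ''@AKLMBAF@'', ''@BEJNLK@A'', ''@ALMBFA@K'', ''@CE@ABFDC'', ''@FJIHMLNK'',
    ''@EBAKNLMH'', ''@HKLMBFA@'', ''@DE@ABFDC'', ''@EBFDE@AK'', ''@DJIHMLNK'', ''@I@ABFCDE'',
    ''@H@ABFCDE'', ''@G@ABFCDE'', ''@IEDCFHIJ'', ''@GKLMFBA@'', ''@BCD@ABFM'', ''@BHIEDCFB'',
    ''@HEDCFHIJ'', ''@GHNIEDCB'', ''@B@FBCDEI'', ''@BJNHMLKA'', ''@GBFAKLMH'', ''@I@AFBCDE'',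
    ''@EMLJNIHC'', ''@DE@AFBDC'', ''@HKLMFBA@'', ''@BBAKLMFH'', ''@BMLJIHFC'', ''@GEDCFHIJ'']"
  by code_simp

lemma chk_exts_6_3: "chk_exts 6 reps7 (table_of 6 ''OOOOO'') [
    ''@J@ABCDEF'', ''@I@ABCDEF'', ''@H@ABCDEF'', ''@G@ABCDEF'', ''@HLKJIHMN'', ''@F@ABCDEF'',
    ''@E@ABCDEF'', ''@IBCDE@AN'', ''@IABCDFE@'', ''@EHMLKJIF'', ''@FHMLKJIF'', ''@HBCDE@AN'',
    ''@GHMLKJIF'', ''@HHMLKJIF'', ''@IHMLKJIF'', ''@JHMLKJIF'', ''@IABCDEF@'', ''@HLKJIHNM'',
    ''@H@ABCDFE'', ''@I@ABCDFE'', ''@J@ABCDFE'', ''@IJIHMNLK'', ''@HE@ABCDF'', ''@GBCDE@AN'',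
    ''@HKJIHMLN'', ''@FBCDE@AN'', ''@EJIHMLKN'', ''@IABCDE@N'', ''@HABCDEF@'', ''@ABCDEF@A'',
    ''@AABCDFE@'', ''@HKJIHMNL'', ''@@@ABCFDE'', ''@A@ABCFDE'', ''@HE@ABCFD'', ''@HJIHMLNK'',
    ''@IJIHMLNK'', ''@J@ABCFDE'', ''@I@ABCFDE'', ''@IIHMLNKJ'', ''@EBCDE@AN'', ''@HDE@ABCF'',
    ''@FJIHMLKN'', ''@GABCDE@N'', ''@HABCDE@N'', ''@HMLKJINH'', ''@ACDE@FAB'', ''@@HMLKNJI'',
    ''@ADE@AFBC'', ''@AHMLKNJI'', ''@HDE@ABFC'', ''@HCDE@AFB'', ''@HIHMLKNJ'', ''@IIHMLKNJ'',
    ''@J@ABFCDE'', ''@IJIHMLKN'', ''@HJIHMLKN'', ''@GJIHMLKN'', ''@IHMLKNJI'', ''@EABCDE@N'',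
    ''@FABCDE@N'', ''@HMLKJIHF'', ''@IBCDE@FA'', ''@HBCDE@FA'', ''@HHMLKJNI'', ''@IHMLKJNI'',
    ''@J@AFBCDE'', ''@IIHMLKJN'', ''@HIHMLKJN'', ''@GIHMLKJN'', ''@HCDE@ABF'', ''@FIHMLKJN'',
    ''@EIHMLKJN'', ''@IBCDEN@A'']"
  by code_simp

lemma chk_exts_7_0: "chk_exts 7 reps8 (table_of 7 ''OOOOLOOMF'') [
    ''HIIHONMLKJ'', ''D@G@ABCDFE'', ''KAIHONMLKJ'', ''JHGFEHIJLK'', ''GEFDBOCEHI'', ''CANMKGJLIH'',
    ''HIEFG@ADBC'', ''HJDAMNOBCH'', ''FALJGFEIHC'', ''CKLJGFEIHC'', ''FCDFGJK@AM'', ''HABCEGFD@A'',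
    ''EIDFGJK@AM'', ''IGJLNOMKA@'', ''FIDFGJK@AM'', ''JIHIGFEDCB'', ''FILMOA@KJF'', ''D@OBCEFDA@'',
    ''JHOA@JKMLN'', ''HJDCHIGEFJ'', ''FBBCEGFD@A'', ''EBADEGF@JK'', ''IGADEGF@JK'', ''EILMOA@KJF'',
    ''GEADEGF@JK'', ''FALMOA@KJF'', ''CKDAOMNBCH'', ''FCDAOMNBCH'', ''CAEF@OADBC'', ''HAEF@OADBC'',
    ''FBEF@OADBC'', ''HI@OABCDEF'', ''FBKJIHOLNM'', ''IJ@GFIJKLM'', ''FBBCEFGD@A'', ''C@KJIHOLNM'',
    ''IGNMKJLOIH'', ''HABCEFGD@A'', ''FCDGFJK@AM'', ''FALJFGEIHC'', ''HJDAMONBCH'', ''HIEGF@ADBC'',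
    ''FBIHNOMLKJ'', ''HAIHNOMLKJ'', ''FCLMOA@KJF'', ''CAIHNOMLKJ'', ''CKLMOA@KJF'', ''FADAOMNBCH'',
    ''EIDAOMNBCH'', ''GEMLIGHNCB'', ''IGMLIGHNCB'', ''EBCD@OABMN'', ''FBKJIGHLNM'', ''HAHOLKJIFE'',
    ''IG@ABCDGEF'', ''C@BCEFGD@A'', ''GKKJIHOLNM'', ''JC@ABCDGEF'', ''GKBCEFGD@A'', ''GGDGFJK@AM'',
    ''EDDAMONBCH'', ''FADAMONBCH'', ''FD@ABCDGEF'', ''HCGDCHIEFJ'', ''FDBCEFGD@A'', ''HCDGFJK@AM'',
    ''FDIHNMOLKJ'', ''GGLOMA@KJF'', ''GKIHNMOLKJ'', ''FCLOMA@KJF'', ''HAIHNMOLKJ'', ''C@IHNMOLKJ'',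
    ''FBIHNMOLKJ'', ''HINMOKJLIH'', ''HJDAOMNBCH'', ''D@GEF@ADCB'', ''FIDAOMNBCH'', ''HCGDAMNBCH'',
    ''JCKJIHLONM'', ''IGEF@ADGBC'', ''IGKJIHLONM'', ''IJKOMBA@DF'', ''KABCGEFD@A'', ''JHOMNCBAD@'',
    ''JHGCBMNHLI'', ''JIJKOA@DFE'', ''GECD@OABMN'', ''IGCD@OABMN'', ''CAKJIGHLNM'', ''HAKJIGHLNM'',
    ''FCLOHCBNMA'', ''GGLOHCBNMA'', ''HCDGAMNBCH'', ''FDIHNMLOKJ'', ''HCGDFJK@AM'', ''FDBCEFDG@A'',
    ''HCDGCHIEFJ'', ''FD@ABCGDEF'', ''GGDGCHIEFJ'', ''GK@ABCGDEF'', ''C@@ABCGDEF'', ''FCDGCHIEFJ'',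
    ''HA@ABCGDEF'', ''FB@ABCGDEF'', ''HIBCGEFD@A'', ''D@OKJIHLMN'', ''HJLHGCBNMA'', ''FILHGCBNMA'',
    ''FALHGCBNMA'', ''EILHGCBNMA'', ''CKLHGCBNMA'', ''FCLHGCBNMA'', ''FADCHOIEFJ'', ''EDDCHOIEFJ'',
    ''GGDGAMNBCH'', ''GKEF@AGDBC'', ''JCIHNMLOKJ'', ''GKNMKJOLIH'', ''GGLOJFEIHC'', ''EDLHCGBNMA'',
    ''FALHCGBNMA'', ''C@EF@AGDBC'', ''IGBCEFDG@A'', ''HAJOLNMKA@'', ''FCLOJFEIHC'', ''FADFJOK@AM'',
    ''HJLHCGBNMA'', ''HIBGCEFD@A'', ''FB@ABGCDEF'', ''HA@ABGCDEF'', ''CA@ABGCDEF'', ''FCDCGHIEFJ'',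
    ''CKDCGHIEFJ'', ''FBNMKOJLIH'', ''EBHLKOJIFE'', ''IGHLKOJIFE'', ''GEHLKOJIFE'', ''EIDCGHIEFJ'',
    ''FADCGHIEFJ'', ''HJDCHOIEFJ'', ''FALMAG@KJF'', ''FCDGAMNBCH'', ''HAAGDEF@JK'', ''IGIHNMLOKJ'',
    ''C@NMKJOLIH'', ''FBEF@AGDBC'', ''IJIOJ@FEDC'', ''FBNMKJOLIH'', ''HI@AGBCDEF'', ''KA@AGBCDEF'',
    ''HIKJOIHLNM'', ''D@OIHNMLJK'', ''JHOJKA@FDE'', ''HJLHCBGNMA'', ''GEJLNGMKA@'', ''FADFOJK@AM'',
    ''CABCEOFD@A'', ''CKDFOJK@AM'', ''FCLJOFEIHC'', ''EILJOFEIHC'', ''FILJOFEIHC'', ''D@GNMKJLHI'',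
    ''HANMKOJLIH'', ''IGFDBGCEHI'', ''JIA@OJKLMN'', ''JHGHIFECDB'', ''FIDCGHIEFJ'', ''HJDCGHIEFJ'']"
  by code_simp

lemma chk_exts_7_1: "chk_exts 7 reps8 (table_of 7 ''OOOOLOOOF'') [
    ''HKIHONMLKJ'', ''FFG@ABCDFE'', ''JJIHONMLKJ'', ''JGJIHONLMK'', ''IEONLJIHEC'', ''JHJIHONLMK'',
    ''EKONLJIHCE'', ''IKJIHONLMK'', ''JI@ABCDEFG'', ''JFKMOBA@DF'', ''IGOMKJLNIH'', ''JDKMOBA@DF'',
    ''JFNLJGIHEC'', ''HFLMOA@KFJ'', ''IKOA@JKMLN'', ''I@DCHIGEJF'', ''IK@FGIJKLM'', ''HB@FGIJKLM'',
    ''IJ@FGIJKLM'', ''ID@FGIJKLM'', ''J@@FGIJKLM'', ''IFLMOA@KFJ'', ''GHOBCEDAF@'', ''HELMOA@KFJ'',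
    ''HBEF@OADBC'', ''HDEF@OADBC'', ''EJOADEF@KJ'', ''GKOADEF@JK'', ''HHEF@OADBC'', ''HK@OABCDEF'',
    ''HHKJIHOLNM'', ''IK@GFIJKLM'', ''HEKJIHOLNM'', ''JI@ABCDEGF'', ''EFCDG@ABMN'', ''JHJIHNOLMK'',
    ''IENOLJIHEC'', ''JGJIHNOLMK'', ''JJIHNOMLKJ'', ''GJGF@ABDEC'', ''GEGDBNCEHI'', ''JHFGEHIJLK'',
    ''KAIHNOMLKJ'', ''JBIHNOMLKJ'', ''JAIHNOMLKJ'', ''JGLMOA@KFJ'', ''F@OMLIHNBC'', ''HHLMOA@KFJ'',
    ''JFDCHIGEJF'', ''IHJKOA@FDE'', ''J@MLIGHNCB'', ''JCJKOA@FDE'', ''IHCD@OABMN'', ''HHKJIGHLNM'',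
    ''GKHOLKJIFE'', ''GH@ABCDGEF'', ''II@ABCDGEF'', ''JE@ABCDGEF'', ''IC@ABCDGEF'', ''K@@ABCDGEF'',
    ''ICJIHNOLMK'', ''IFJIHNOLMK'', ''IDGEILJFK@'', ''JFDCHIEGJF'', ''GK@ABCDGEF'', ''GGGDCHIEFJ'',
    ''IE@ABCDGEF'', ''JBGDCHIEJF'', ''IBJIHNOLMK'', ''GDJIHNOLMK'', ''JBLOMA@KFJ'', ''IEIHNMOLKJ'',
    ''JGLOMA@KFJ'', ''JAIHNMOLKJ'', ''GCIHNMOLKJ'', ''JBIHNMOLKJ'', ''KAIHNMOLKJ'', ''JHFEGHIJLK'',
    ''H@GEF@ADCB'', ''HDFEGHIJLK'', ''JDKJIHLONM'', ''J@GDAMBCNH'', ''J@OLHCNMBA'', ''K@KOMBA@DF'',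
    ''KB@ABCDGEF'', ''K@FEGHIJLK'', ''K@JKOA@FDE'', ''JEJKOA@FDE'', ''J@CD@OABMN'', ''JCCD@OABMN'',
    ''EJGHLKJIEF'', ''GKGHLKJIFE'', ''HDKJIHOLNM'', ''JEKJIHOLNM'', ''IDLMAG@KFJ'', ''JCKJIHOLNM'',
    ''JDKJIHOLNM'', ''GKIHNMLOKJ'', ''GGOLMA@KJF'', ''IEIHNMLOKJ'', ''JBOLMA@KFJ'', ''IBJIHNLOMK'',
    ''JBDGCHIEJF'', ''IE@ABCGDEF'', ''GC@ABCGDEF'', ''GDF@ABGDCE'', ''JGDGCHIEJF'', ''JA@ABCGDEF'',
    ''JB@ABCGDEF'', ''KA@ABCGDEF'', ''H@OKJIHLMN'', ''JHJKOA@FDE'', ''HDJKOA@FDE'', ''JFLMA@OKFJ'',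
    ''IHLMA@OKFJ'', ''HBKJIGHLNM'', ''HDKJIGHLNM'', ''HEDCHOIEJF'', ''IIDCHOIEJF'', ''EDG@KLMABN'',
    ''JEDCHOIEJF'', ''IDDCHOIEJF'', ''IIIHNMLOKJ'', ''JEIHNMLOKJ'', ''ICIHNMLOKJ'', ''K@IHNMLOKJ'',
    ''ICBGDF@AKM'', ''IDOK@DFJEI'', ''IFF@ABGDCE'', ''JFLMA@KOFJ'', ''HEEF@AGDBC'', ''JIIHNMLKOJ'',
    ''EFMLOIHNCB'', ''JHF@ABGDCE'', ''IEBGDF@AKM'', ''GEOLNBMKA@'', ''JGF@ABGDCE'', ''JHJOKA@FDE'',
    ''JJ@ABGCDEF'', ''KA@ABGCDEF'', ''GJOJIHNLKM'', ''JB@ABGCDEF'', ''JA@ABGCDEF'', ''F@GCD@ABNM'',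
    ''JGDCGHIEJF'', ''HHDCGHIEJF'', ''IKIJO@FEDC'', ''IJIJO@FEDC'', ''HBIJO@FEDC'', ''IDIJO@FEDC'',
    ''J@IJO@FEDC'', ''GHGNMKLHJI'', ''IFDCGHIEJF'', ''HEDCGHIEJF'', ''I@DCHOIEJF'', ''HELMAG@KFJ'',
    ''HDEF@AGDBC'', ''GKAGDEF@JK'', ''GHIHNMLOKJ'', ''HHEF@AGDBC'', ''IKIOJ@FEDC'', ''HK@AGBCDEF'',
    ''JJ@AGBCDEF'', ''FFOIHNMLJK'', ''JGF@AGBDCE'', ''IEGBDF@AKM'', ''EKGBDF@AMK'', ''JHF@AGBDCE'',
    ''IKF@AGBDCE'', ''JIIHNMLKJO'', ''IGGCEFDB@A'', ''JFECGNHILJ'', ''JDBDFO@AKM'', ''JFBDFO@AKM'',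
    ''IKGHIFECDB'', ''HFDCGHIEJF'', ''I@DCGHIEJF'']"
  by code_simp

lemma chk_exts_7_2: "chk_exts 7 reps8 (table_of 7 ''OOOONOO@@'') [
    ''ABG@ABCDEF'', ''EIJIHOMLKN'', ''BFJIHOMLKN'', ''H@JGEDCFIH'', ''HDEGJLK@NA'', ''IH@ABCDEFG'',
    ''HHNOBCDAE@'', ''F@BONKLMHI'', ''EJJKNOA@ED'', ''DCJKNOA@ED'', ''@E@ABCDEFG'', ''EB@ABCDEFG'',
    ''FBNOBCDAE@'', ''@GBONKLMHI'', ''BGJKNOA@ED'', ''CGJKNOA@ED'', ''CIAONMHBCD'', ''@J@KLMNOAB'',
    ''BI@EFGIJKL'', ''BFHGFEDCBA'', ''CAGIJ@EFDC'', ''EKHGFEDCBA'', ''AA@OABCDEF'', ''AB@OABCDEF'',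
    ''DHJIHOMLKN'', ''FIJIHOMLKN'', ''A@JIHOMLKN'', ''DF@KLMONAB'', ''FC@KLMONAB'', ''EI@KLMONAB'',
    ''AF@KLMONAB'', ''@G@KLMONAB'', ''D@@EGFIJKL'', ''BF@KLMONAB'', ''H@@EGFIJKL'', ''@J@KLMONAB'',
    ''CIANOMHBCD'', ''@@@KLMONAB'', ''EFDCHIFGJE'', ''BCNBCGDAE@'', ''CGJKONA@ED'', ''BGJKONA@ED'',
    ''@GBNOKLMHI'', ''FBONBCDAE@'', ''@FOKJFILMH'', ''BIJKONA@ED'', ''BFBNOKLMHI'', ''IJKLMBNOA@'',
    ''A@BNOKLMHI'', ''IKEDCHGFIJ'', ''DHJIGHMLKN'', ''CJ@GEFIJKL'', ''BGHOLKJIFE'', ''D@@GEFIJKL'',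
    ''@G@KLOMNAB'', ''FAHOLKJIFE'', ''FC@KLOMNAB'', ''A@@ABCDGEF'', ''DF@KLOMNAB'', ''A@JIHMOLKN'',
    ''FIJIHMOLKN'', ''@EDCHIFGJE'', ''HDGE@NADBC'', ''ADGFILKJE@'', ''DC@ABCDGEF'', ''AAGDCHIFEJ'',
    ''B@@ABCDGEF'', ''AJ@KLOMNAB'', ''AFBDGE@ANK'', ''DDJIHMOLKN'', ''C@LONA@KEJ'', ''@ENBCGDAE@'',
    ''HELONA@KEJ'', ''GHNBCGDAE@'', ''DBJKONA@ED'', ''ECJKONA@ED'', ''@FBNOKLMHI'', ''BIONBCDA@E'',
    ''C@FILOKJ@E'', ''GKFILOKJ@E'', ''GGJKONA@ED'', ''EDJEDCGFIH'', ''IDKLMBNOA@'', ''FAJEDCGFIH'',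
    ''JFJIHMLKNO'', ''CJO@EFIJKL'', ''@KANMOHBCD'', ''BCK@GDEJFI'', ''GEK@GDEJFI'', ''@EOMBANL@K'',
    ''GCFIOLKJ@E'', ''C@FIOLKJ@E'', ''BCAGDFE@JK'', ''BGOLNA@KJE'', ''@ENBCDGAE@'', ''C@OLNA@KEJ'',
    ''AFBGDE@ANK'', ''AJ@KOLMNAB'', ''B@@ABCGDEF'', ''DB@ABCGDEF'', ''ADJKONA@ED'', ''@FJEDCGFIH'',
    ''BCKLMBNOA@'', ''CKJEDCGFIH'', ''HBKO@DEJFI'', ''@KANMHGBCD'', ''BKG@KLMNAB'', ''GCDCHOIFJE'',
    ''IEDCHOIFJE'', ''@GOIFDCHMB'', ''JBFIOLKJ@E'', ''FBFIOLKJ@E'', ''IDAGDFE@JK'', ''JD@KLMNABG'',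
    ''EBEJOLK@NA'', ''IGEJOLK@NA'', ''EIBGDE@ANK'', ''CKJEDGCFIH'', ''GEANMHBGCD'', ''J@ANMHBGCD'',
    ''FGOJEDCFIH'', ''@EEJOLK@NA'', ''GHEJOLK@NA'', ''CHEJOLK@NA'', ''ECBGDE@ANK'', ''@FJEDGCFIH'',
    ''CFJOKNA@ED'', ''ADJOKNA@ED'', ''DG@ABGCDEF'', ''DB@ABGCDEF'', ''B@@ABGCDEF'', ''AJ@OKLMNAB'',
    ''BJOJIHMLKN'', ''EC@ABGCDEF'', ''EK@ABGCDEF'', ''GJ@OKLMNAB'', ''ACKLMGBNA@'', ''@FHGBANMLK'',
    ''CAANMHGBCD'', ''BK@OKLMNAB'', ''AHJKNAG@ED'', ''DCJKNAG@ED'', ''CGJKNAG@ED'', ''CIGANMHBCD'',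
    ''BI@EFIOJKL'', ''BG@EFIOJKL'', ''CAIOJ@EFDC'', ''EJ@EFIOJKL'', ''ACKLMBGNA@'', ''AA@AGBCDEF'',
    ''EE@AGBCDEF'', ''BJJOIHMLKN'', ''DG@AGBCDEF'', ''CFOJKNA@ED'', ''CHEOJLK@NA'', ''FGJOEDCFIH'',
    ''BIBGHIFCDE'', ''CKBGHIFCDE'', ''AHJKNA@OED'']"
  by code_simp

lemma chk_exts_7_3: "chk_exts 7 reps8 (table_of 7 ''OOOONOOD@'') [
    ''CCG@ABCDEF'', ''IFJIHOMLNK'', ''ICJIHOMLNK'', ''K@@ABCDEFG'', ''BFOMLJIHCF'', ''IJ@ABCDEFG'',
    ''JE@ABCDEFG'', ''ID@ABCDEFG'', ''JC@ABCDEFG'', ''J@@ABCDEFG'', ''IFFGJK@EAD'', ''GIDCHIGFJE'',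
    ''HBOA@JKNLM'', ''HFDCHIGFJE'', ''GH@ABCDEFG'', ''BC@ABCDEFG'', ''IG@ABCDEFG'', ''GE@ABCDEFG'',
    ''GCFGJK@EAD'', ''GDLNOA@KEJ'', ''BCOBCFDAE@'', ''EFDCHIGFJE'', ''GJ@EFGIJKL'', ''EK@KLMNOAB'',
    ''H@@EFGIJKL'', ''BF@KLMNOAB'', ''EE@EFGIJKL'', ''EJ@KLMNOAB'', ''GG@EFGIJKL'', ''ED@KLMNOAB'',
    ''F@@EFGIJKL'', ''EJHGFEDCBA'', ''FF@OABCDEF'', ''CC@OABCDEF'', ''DAKJIHOLMN'', ''HFJIHOMLNK'',
    ''EFJIHOMLNK'', ''H@@KLMONAB'', ''GG@KLMONAB'', ''EC@KLMONAB'', ''F@@KLMONAB'', ''FF@EGFIJKL'',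
    ''EK@KLMONAB'', ''GJ@EGFIJKL'', ''BD@KLMONAB'', ''GDLONA@KEJ'', ''GCGFJK@EAD'', ''GE@ABCDEGF'',
    ''IG@ABCDEGF'', ''EB@ABCDEGF'', ''ECGFJK@EDA'', ''GHKONBA@DE'', ''J@EDCHGFIJ'', ''IDEDCHGFIJ'',
    ''HBEDCHGFIJ'', ''DAKJIGHLMN'', ''CC@GEFIJKL'', ''EJHOLKJIFE'', ''FF@GEFIJKL'', ''F@@KLOMNAB'',
    ''ED@ABCDGEF'', ''GG@KLOMNAB'', ''BF@ABCDGEF'', ''H@@KLOMNAB'', ''EFJIHMOLNK'', ''HFJIHMOLNK'',
    ''BCGFILJEK@'', ''HBGE@NADBC'', ''EJ@ABCDGEF'', ''EE@KLOMNAB'', ''EK@ABCDGEF'', ''GJ@KLOMNAB'',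
    ''GDBDGE@AKN'', ''GIJIHMOLNK'', ''GCLONA@KEJ'', ''GE@EFIJKLO'', ''IFLONA@KEJ'', ''J@@EFIJKLO'',
    ''BC@EFIJKLO'', ''ID@EFIJKLO'', ''IJ@EFIJKLO'', ''BFGCBNMHIL'', ''IG@EFIJKLO'', ''JC@EFIJKLO'',
    ''GH@EFIJKLO'', ''JE@EFIJKLO'', ''K@@EFIJKLO'', ''ICNMHGCBDA'', ''IFNMHGCBDA'', ''CCO@EFIJKL'',
    ''DAANMOHBCD'', ''HBKJIHOLMN'', ''IDKJIHOLMN'', ''EB@EFIJKOL'', ''J@KJIHOLMN'', ''IG@EFIJKOL'',
    ''GHAGDFE@JK'', ''ECOLNA@KJE'', ''GE@EFIJKOL'', ''GCOLNA@KEJ'', ''GDBGDE@AKN'', ''GJ@KOLMNAB'',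
    ''EK@ABCGDEF'', ''EC@ABCGDEF'', ''BD@ABCGDEF'', ''FF@KOLMNAB'', ''F@@ABCGDEF'', ''GG@ABCGDEF'',
    ''H@@ABCGDEF'', ''EFNMHGCBDA'', ''HFNMHGCBDA'', ''DAANMHGBCD'', ''CCG@KLMNAB'', ''IFDCHOIFJE'',
    ''ICDCHOIFJE'', ''BFOIFDCHMB'', ''K@@KLMNABG'', ''IJ@KLMNABG'', ''JE@KLMNABG'', ''JC@KLMNABG'',
    ''ID@KLMNABG'', ''J@@KLMNABG'', ''IFBGDE@AKN'', ''HBOK@DEJFI'', ''GIFJOK@EAD'', ''HFNMHCGBDA'',
    ''GH@KLMNABG'', ''IG@KLMNABG'', ''BC@KLMNABG'', ''GE@KLMNABG'', ''GCBGDE@AKN'', ''BCOLMBNKA@'',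
    ''GDFJOK@EAD'', ''EFNMHCGBDA'', ''GJ@ABGCDEF'', ''H@@ABGCDEF'', ''EE@ABGCDEF'', ''GG@ABGCDEF'',
    ''F@@ABGCDEF'', ''FF@OKLMNAB'', ''EK@EFIJOKL'', ''BF@EFIJOKL'', ''EJ@EFIJOKL'', ''ED@EFIJOKL'',
    ''EJHGBANMLK'', ''CC@OKLMNAB'', ''DAEDCHOFIJ'', ''HFDCHOIFJE'', ''EFDCHOIFJE'', ''H@@EFIOJKL'',
    ''GG@EFIOJKL'', ''EC@EFIOJKL'', ''F@@EFIOJKL'', ''EK@EFIOJKL'', ''FF@AGBCDEF'', ''GJ@AGBCDEF'',
    ''BD@EFIOJKL'', ''GDFOJK@EAD'', ''GCGBDE@AKN'', ''ECGBDE@ANK'', ''GE@KLMNAGB'', ''GHEOJLK@NA'',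
    ''IG@KLMNAGB'', ''EB@KLMNAGB'', ''J@ANMHGBCD'', ''IDANMHGBCD'', ''HBANMHGBCD'', ''DAEDCGHFIJ'']"
  by code_simp

lemma chk_exts_7_4: "chk_exts 7 reps8 (table_of 7 ''OOOONOOF@'') [
    ''AEG@ABCDEF'', ''FELKGEFJIH'', ''EFOMLJIHFC'', ''JH@ABCDEFG'', ''A@OMLJIHCF'', ''IK@ABCDEFG'',
    ''DHGFDCHIJM'', ''HD@ABCDEFG'', ''HB@ABCDEFG'', ''DAJGFDCIHM'', ''CBLKEFGJIH'', ''BHFEAOBDCH'',
    ''AIFEAOBDCH'', ''CH@ABCDEFG'', ''@KONLJIMHC'', ''@ABAKLNOMH'', ''@ILKEFGJIH'', ''BD@KLMNOAB'',
    ''@@@KLMNOAB'', ''AK@EFGIJKL'', ''@CGFEABDCH'', ''FF@EFGIJKL'', ''F@@KLMNOAB'', ''D@@EFGIJKL'',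
    ''@G@KLMNOAB'', ''AA@EFGIJKL'', ''CAMNO@KLJI'', ''AD@EFGIJKL'', ''@F@KLMNOAB'', ''@CBAOKLNMH'',
    ''ACBAOKLNMH'', ''AK@OABCDEF'', ''AE@OABCDEF'', ''@ACDG@ABNM'', ''AILKGEFJIH'', ''@@@ABCDEGF'',
    ''D@@KLMONAB'', ''AD@KLMONAB'', ''@CFGEABDCH'', ''AK@EGFIJKL'', ''@ILKEGFJIH'', ''@ABAKLONMH'',
    ''@KNOLJIMHC'', ''CH@ABCDEGF'', ''BC@ABCDEGF'', ''GH@ABCDEGF'', ''@E@ABCDEGF'', ''@EKONBA@DE'',
    ''GEEDCHGFIJ'', ''BCEDCHGFIJ'', ''@KBAOKLNMH'', ''@ACD@OABNM'', ''AE@GEFIJKL'', ''ACFEGABDCH'',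
    ''AK@GEFIJKL'', ''@CFEGABDCH'', ''@F@ABCDGEF'', ''AD@KLOMNAB'', ''@G@ABCDGEF'', ''D@@KLOMNAB'',
    ''@@@ABCDGEF'', ''AILKEGFJIH'', ''CACDG@ABNM'', ''AA@KLOMNAB'', ''F@@ABCDGEF'', ''FF@KLOMNAB'',
    ''BD@ABCDGEF'', ''BHLKEGFJIH'', ''@COLKEFJIH'', ''AK@KLOMNAB'', ''@IBAKLONMH'', ''@AFEABDGCH'',
    ''CBBAKLONMH'', ''DANOLJIMHC'', ''DHOLJIHMNC'', ''@KGDBNMCHI'', ''HB@EFIJKLO'', ''IK@EFIJKLO'',
    ''A@GCBNMHIL'', ''CH@EFIJKLO'', ''HD@EFIJKLO'', ''JH@EFIJKLO'', ''EFGCBNMHLI'', ''FEBAOKLNMH'',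
    ''AEO@EFIJKL'', ''@AIJ@GEFDC'', ''@KFEGABDCH'', ''BCKJIHOLMN'', ''@E@EFIJKOL'', ''GEKJIHOLMN'',
    ''GH@EFIJKOL'', ''CH@EFIJKOL'', ''@EAGDFE@JK'', ''BC@EFIJKOL'', ''@KDGBNMCHI'', ''@AFEABGDCH'',
    ''@IBAKOLNMH'', ''AK@KOLMNAB'', ''@CLOKEFJIH'', ''AD@ABCGDEF'', ''D@@ABCGDEF'', ''@@@EFIJKOL'',
    ''AIBAOKLNMH'', ''@AIJO@EFDC'', ''AEG@KLMNAB'', ''FEFEGABDCH'', ''EFOIFDCHBM'', ''A@OIFDCHMB'',
    ''JH@KLMNABG'', ''IK@KLMNABG'', ''DHGBNMHCDI'', ''HD@KLMNABG'', ''HB@KLMNABG'', ''DADGBNMCHI'',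
    ''CBFEABGDCH'', ''BHBAKOLNMH'', ''AIBAKOLNMH'', ''CH@KLMNABG'', ''@KOJFDCIHM'', ''@ALKEFJOIH'',
    ''@IFEABGDCH'', ''BD@EFIJOKL'', ''@@@EFIJOKL'', ''AK@ABGCDEF'', ''FF@ABGCDEF'', ''D@@ABGCDEF'',
    ''AA@ABGCDEF'', ''AD@ABGCDEF'', ''@CLKOEFJIH'', ''AK@OKLMNAB'', ''@CGBAKLNMH'', ''F@@EFIJOKL'',
    ''@G@EFIJOKL'', ''CAIJO@EFDC'', ''@F@EFIJOKL'', ''ACLKOEFJIH'', ''AE@OKLMNAB'', ''@AMNG@KLJI'',
    ''AIFEGABDCH'', ''@@@KLMNAGB'', ''D@@EFIOJKL'', ''AD@EFIOJKL'', ''@CBGAKLNMH'', ''AK@AGBCDEF'',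
    ''@IFEAGBDCH'', ''@ALKEFOJIH'', ''@KJOFDCIHM'', ''BC@KLMNAGB'', ''@EEOJLK@NA'', ''CH@KLMNAGB'',
    ''GH@KLMNAGB'', ''@E@KLMNAGB'', ''GEANMHGBCD'', ''BCANMHGBCD'', ''@KLKOEFJIH'', ''@AMN@OKLJI'']"
  by code_simp

lemma chk_exts_7_5: "chk_exts 7 reps8 (table_of 7 ''OOOOOOOL@'') [
    ''E@G@ABCDEF'', ''BKKJIHOMLN'', ''GC@ABCDEFG'', ''IE@ABCDEFG'', ''@GCDE@ABON'', ''C@@ABCDEFG'',
    ''GK@ABCDEFG'', ''@FCDE@ABON'', ''FD@ABCDEFG'', ''ACNOBDEA@K'', ''AECBONLMHI'', ''CD@ABCDEFG'',
    ''AEHIGFEDCB'', ''@A@ABCDEFG'', ''CB@ABCDEFG'', ''DIHIGFEDCB'', ''ACFGIMLJK@'', ''AH@ABCDEFG'',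
    ''@FHMLKJIGF'', ''CKHMLKJIGF'', ''@GHMLKJIGF'', ''FCHMLKJIGF'', ''AACDE@OABN'', ''E@@OABCDEF'',
    ''GAHOMLKJIF'', ''BJKJIHOMLN'', ''EC@ABCDEGF'', ''EK@ABCDEGF'', ''BG@ABCDEGF'', ''EJ@ABCDEGF'',
    ''ACGFIMLJK@'', ''EG@ABCDEGF'', ''@B@ABCDEGF'', ''CFHIFGEDCB'', ''ABHIFGEDCB'', ''CJHIFGEDCB'',
    ''AI@ABCDEGF'', ''CCHIFGEDCB'', ''BH@ABCDEGF'', ''AEHIFGEDCB'', ''CD@ABCDEGF'', ''AECBNOLMHI'',
    ''ACONBDEA@K'', ''FD@ABCDEGF'', ''DGGIMLKJF@'', ''AG@ABCDEGF'', ''@H@ABCDEGF'', ''BHKJIHMLON'',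
    ''CCCBNOLMHI'', ''EJKJIHMLON'', ''GKKJIHMLNO'', ''HHHMLKJIFG'', ''ABCBNOLMHI'', ''EKKJIHMLON'',
    ''IEKJIHMLNO'', ''JGHMLKJIFG'', ''FFCDE@OABN'', ''GAGHMLKJIF'', ''@IHOLKJIFE'', ''AG@ABCDGEF'',
    ''AI@ABCDGEF'', ''CJHIFEGDCB'', ''CFHIFEGDCB'', ''@B@ABCDGEF'', ''EG@ABCDGEF'', ''AGKJIHMLON'',
    ''AIKJIHMLON'', ''CJCBNOLMHI'', ''BGKJIHMLON'', ''C@KJIHMLNO'', ''AFGCBNMHIL'', ''CFCBNOLMHI'',
    ''ECKJIHMLON'', ''GCKJIHMLNO'', ''GDGCBNMHLI'', ''BDCBNLMHGI'', ''@IGHLKJIFE'', ''CDEDHOIFJK'',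
    ''FHFIOMLJK@'', ''HFGEFJK@LA'', ''JFDGANBCMH'', ''IHDGANBCMH'', ''CFCBNLOMHI'', ''FIGEFJK@AL'',
    ''JIHIFEDGCB'', ''FIOLNA@KJE'', ''JFMOJFIHDC'', ''HFOLNA@KEJ'', ''CJCBNLOMHI'', ''AIKJIHMOLN'',
    ''FHNBGDEA@K'', ''AGKJIHMOLN'', ''EG@ABCGDEF'', ''@B@ABCGDEF'', ''CDLMCGBNA@'', ''@ICGE@ABNL'',
    ''GACGDE@ABN'', ''BJ@ABCGDEF'', ''E@OKJIHMLN'', ''BK@ABCGDEF'', ''DIGCBNLMHI'', ''EHHIFEDGCB'',
    ''CBLMGCBNA@'', ''BHEDGHIFJK'', ''@ILMGCBNA@'', ''CD@OLMNABC'', ''CBEDHOIFJK'', ''DAFIOMLJK@'',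
    ''HBCBNLMHOI'', ''IDCBNLMHOI'', ''EBDGANBCMH'', ''HDCBNLMHOI'', ''JEHIFEDCGB'', ''HDHIFEDCGB'',
    ''IDHIFEDCGB'', ''HBHIFEDCGB'', ''DANBGDEA@K'', ''CBLMCGBNA@'', ''ADCDE@AGBN'', ''GGCDE@AGBN'',
    ''FCCDE@AGBN'', ''BICDE@AGBN'', ''CKCDE@AGBN'', ''AHKOIHMLNB'', ''DICGBNLMHI'', ''E@KOJIHMLN'',
    ''GAGCDE@ABN'', ''@IGCE@ABNL'', ''CDKOEDFJIH'', ''@IEDGHIFJK'', ''AAHMLKOJIF'', ''FFHMLKOJIF'',
    ''BDHIFEDCGB'', ''BHLMGCBNA@'', ''CBEDGHIFJK'', ''DIHOIFEDCB'', ''AH@GBCDEFI'', ''CKHMLKJOIF'',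
    ''BIHMLKJOIF'', ''FCHMLKJOIF'', ''GGHMLKJOIF'', ''ADHMLKJOIF'', ''AACDE@AGBN'', ''EEHMLKJOIF'',
    ''AAHMLKJOIF'', ''E@@AGBCDEF'', ''FK@AGBCDEF'', ''E@KJOIHMLN'', ''@AKJIHMLNG'', ''CBKJIHMLNG'',
    ''DICBGNLMHI'', ''AHKJIHMLNG'', ''DGGBDE@ANK'', ''CKCDE@ABGN'', ''HHCDE@ABNG'', ''AFGHIFDCBE'',
    ''FCCDE@ABGN'', ''JGCDE@ABNG'', ''GDGHIFDCEB'', ''EHCBNLMGHI'', ''DIGHIFEDCB'']"
  by code_simp

lemma chk_exts_7_6: "chk_exts 7 reps8 (table_of 7 ''OOOOOOON@'') [
    ''GBG@ABCDEF'', ''GJKJIHOMLN'', ''JB@ABCDEFG'', ''JA@ABCDEFG'', ''F@CDE@ABON'', ''BJKLNOBA@E'',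
    ''FB@ABCDEFG'', ''HA@ABCDEFG'', ''CA@ABCDEFG'', ''BKKLNOBA@E'', ''EH@ABCDEFG'', ''BKHIGFEDCB'',
    ''BH@ABCDEFG'', ''CCHIGFEDCB'', ''@I@ABCDEFG'', ''DEHIGFEDCB'', ''CACDE@ABON'', ''EJ@ABCDEFG'',
    ''DC@ABCDEFG'', ''@F@ABCDEFG'', ''ED@ABCDEFG'', ''FAHMLKJIGF'', ''BFHMLKJIGF'', ''EIHMLKJIGF'',
    ''ABCDE@OABN'', ''GB@OABCDEF'', ''FKHOMLKJIF'', ''EE@ABCDEGF'', ''GG@ABCDEGF'', ''F@@ABCDEGF'',
    ''BI@ABCDEGF'', ''CACDE@ABNO'', ''GACDEG@ABN'', ''BJ@ABCDEGF'', ''HC@ABCDEGF'', ''BJHIFGEDCB'',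
    ''FGHIFGEDCB'', ''FE@ABCDEGF'', ''BKHIFGEDCB'', ''EH@ABCDEGF'', ''@K@ABCDEGF'', ''BKKLONBA@E'',
    ''CA@ABCDEGF'', ''HA@ABCDEGF'', ''@FCDE@ABNO'', ''GK@ABCDEGF'', ''DBGIMLKJF@'', ''FH@ABCDEGF'',
    ''BHCDE@ABNO'', ''DA@ABCDEGF'', ''CCKLONBA@E'', ''EJCDE@ABNO'', ''GKCDE@ABON'', ''EDKJIHMLON'',
    ''II@ABCDEGF'', ''HEHMLKJIFG'', ''BFKJIHMLON'', ''ICHMLKJIFG'', ''IFHMLKJIFG'', ''CCCDE@OABN'',
    ''FKCDE@OABN'', ''CBHOLKJIFE'', ''FH@ABCDGEF'', ''FE@ABCDGEF'', ''FGHIFEGDCB'', ''HC@ABCDGEF'',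
    ''BJ@ABCDGEF'', ''GACDGE@ABN'', ''@ICDE@ABNO'', ''CF@ABCDGEF'', ''AB@ABCDGEF'', ''GBCDGE@ABN'',
    ''DEKLONBA@E'', ''DCCDE@ABNO'', ''DBOLJIHMNC'', ''FAKJIHMLON'', ''HEKJIHMLNO'', ''DDO@EFJKLI'',
    ''EIKJIHMLON'', ''IFKJIHMLNO'', ''GIO@EFJKIL'', ''BHKLNBAO@E'', ''CBGHLKJIFE'', ''BHG@LMNABC'',
    ''GIABCDEGF@'', ''IFGEFJK@LA'', ''J@KLNBA@GE'', ''JCKLNBA@GE'', ''ECKJIHMOLN'', ''IHKLNBA@GE'',
    ''EIKJIHMOLN'', ''EIGEFJK@AL'', ''IGJOMNLKA@'', ''JDKLNBA@GE'', ''BGKJIHMOLN'', ''JFKLNBA@GE'',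
    ''FAKJIHMOLN'', ''HFLOJIHMCN'', ''FHJFDGCIHM'', ''DCCGE@ABNL'', ''DEKOLNBA@E'', ''GBCGDE@ABN'',
    ''AB@ABCGDEF'', ''FK@ABCGDEF'', ''CC@ABCGDEF'', ''CBOKIHMLNB'', ''BHHIFEDGCB'', ''BHCGIJFDE@'',
    ''@HHIFEDGCB'', ''BDHMLOKJIF'', ''BH@OLMNABC'', ''FHMNAG@LKJ'', ''HFIOMLKJ@F'', ''JFHIFEDCGB'',
    ''JDHIFEDCGB'', ''IGMOJFIHDC'', ''EIGBNMHCDI'', ''IHHIFEDCGB'', ''JCHIFEDCGB'', ''J@HIFEDCGB'',
    ''IFGBNMHCID'', ''GIDE@ABGNC'', ''BHGCIJFDE@'', ''CFCDE@AGBN'', ''HCCDE@AGBN'', ''FGKLNBGA@E'',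
    ''FECDE@AGBN'', ''FHCDE@AGBN'', ''CBKOIHMLNB'', ''GA@ABGCDEF'', ''FK@ABGCDEF'', ''GBGCDE@ABN'',
    ''DEOKLNBA@E'', ''FHJFDCGIHM'', ''AGJFDCGIHM'', ''BJCDE@ABGN'', ''EEHMLKOJIF'', ''GJHMLKOJIF'',
    ''GDFDCGHIMJ'', ''GINA@OKLJM'', ''FHMNA@OLKJ'', ''DEHOIFEDCB'', ''DC@GBCDEFI'', ''FAHMLKJOIF'',
    ''BGHMLKJOIF'', ''EIHMLKJOIF'', ''ECHMLKJOIF'', ''ABCDE@AGBN'', ''BJCDE@AGBN'', ''GB@AGBCDEF'',
    ''GA@AGBCDEF'', ''DACDE@ABGN'', ''FHCDE@ABGN'', ''@KCDE@ABGN'', ''FECDE@ABGN'', ''FGKLNGBA@E'',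
    ''BICDE@ABGN'', ''FBCDE@ABNG'', ''@JGHIFDCBE'', ''HCCDE@ABGN'', ''GGCDE@ABGN'', ''JBCDE@ABNG'',
    ''IBNA@OKLJM'', ''GDNA@OKLJM'', ''DEGHIFEDCB'']"
  by code_simp

lemma chk_exts_7_7: "chk_exts 7 reps8 (table_of 7 ''OOOOOOOO@'') [
    ''CEG@ABCDEF'', ''AJKJIHOMLN'', ''CIJIHONMLK'', ''DJJIHONMLK'', ''@CJIHONMLK'', ''@BKLNOBA@E'',
    ''BBHIGFEDCB'', ''@BHIGFEDCB'', ''BJHIGFEDCB'', ''ABHIGFEDCB'', ''@DHIGFEDCB'', ''@CMLKFGJIH'',
    ''F@@ABCDEFG'', ''EK@ABCDEFG'', ''B@@ABCDEFG'', ''@G@ABCDEFG'', ''BF@ABCDEFG'', ''A@@ABCDEFG'',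
    ''@J@ABCDEFG'', ''AFHMLKJIGF'', ''@DCDE@OABN'', ''CE@OABCDEF'', ''E@CDEG@ABN'', ''AA@ABCDEGF'',
    ''AD@ABCDEGF'', ''@CMLKGFJIH'', ''GBCDEG@ABN'', ''AB@ABCDEGF'', ''CF@ABCDEGF'', ''@BHIFGEDCB'',
    ''CECDEG@ABN'', ''@D@ABCDEGF'', ''EA@ABCDEGF'', ''@C@ABCDEGF'', ''BBHIFGEDCB'', ''@BKLONBA@E'',
    ''@CJIHNOMLK'', ''DJJIHNOMLK'', ''AC@ABCDEGF'', ''BJKLONBA@E'', ''F@CDE@ABNO'', ''JA@ABCDEGF'',
    ''@GCDE@ABNO'', ''IE@ABCDEGF'', ''CGGIMLKJF@'', ''AHFJMOLK@A'', ''ABKLONBA@E'', ''EKCDE@ABNO'',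
    ''IECDE@ABON'', ''BFCDE@ABNO'', ''IC@ABCDEGF'', ''EF@ABCDEGF'', ''@JKJIHMLON'', ''IB@ABCDEGF'',
    ''GDHMLKJIFG'', ''DECDE@OABN'', ''E@CDE@OABN'', ''@AHOLKJIFE'', ''DA@ABCDGEF'', ''AHFJOMLK@A'',
    ''@K@ABCDGEF'', ''AC@ABCDGEF'', ''@C@ABCDGEF'', ''EA@ABCDGEF'', ''@D@ABCDGEF'', ''CECDGE@ABN'',
    ''@DKLONBA@E'', ''B@CDE@ABNO'', ''CGOLJIHMNC'', ''A@CDE@ABNO'', ''EFCDE@ABON'', ''@@JIHNMLKO'',
    ''AFKJIHMLON'', ''GDKJIHMLNO'', ''BDJIHNMLKO'', ''@IKLNBAO@E'', ''@AGHLKJIFE'', ''AIG@LMNABC'',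
    ''HFABCDEGF@'', ''DCFJOMLK@A'', ''HBMLKFJOIH'', ''EJFJOMLK@A'', ''F@NMOJIHCD'', ''HHOMNBAL@K'',
    ''AFKJIHMOLN'', ''CKOJFEDIHC'', ''CAMLKFJOIH'', ''EKNMOJIHCD'', ''IKJIHNMOLK'', ''A@CGE@ABNL'',
    ''B@NMOJIHCD'', ''I@DE@ABGNC'', ''DKFDGCHIJM'', ''B@CGE@ABNL'', ''@DKOLNBA@E'', ''CECGDE@ABN'',
    ''@D@ABCGDEF'', ''E@@ABCGDEF'', ''DE@ABCGDEF'', ''@AOKIHMLNB'', ''@IHIFEDGCB'', ''AICGIJFDE@'',
    ''AG@OLMNABC'', ''@@HMLOKJIF'', ''AI@OLMNABC'', ''DKNAG@KLMJ'', ''I@ABCDEGF@'', ''B@FJOMLK@A'',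
    ''IKMLKFJOIH'', ''EKFJOMLK@A'', ''CAJIHNMOLK'', ''CKOMNBALK@'', ''HHOJFEDICH'', ''F@FJOMLK@A'',
    ''EJNMOJIHCD'', ''HBJIHNMOLK'', ''DCNMOJIHCD'', ''HFDE@ABGNC'', ''AIGCIJFDE@'', ''EACDE@AGBN'',
    ''@CCDE@AGBN'', ''ACCDE@AGBN'', ''@KCDE@AGBN'', ''AHNMOJIHCD'', ''DACDE@AGBN'', ''@AKOIHMLNB'',
    ''CE@ABGCDEF'', ''GB@ABGCDEF'', ''E@@ABGCDEF'', ''CEGCDE@ABN'', ''@DOKLNBA@E'', ''DKFDCGHIJM'',
    ''BANA@OKLMJ'', ''@DCDE@ABGN'', ''ABCDE@ABGN'', ''AACDE@ABGN'', ''AJHMLKOJIF'', ''AFFDCGHIJM'',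
    ''DDNA@OKLMJ'', ''DKNA@OKLMJ'', ''@DHOIFEDCB'', ''B@@GBCDEFI'', ''A@@GBCDEFI'', ''AFHMLKJOIF'',
    ''@DCDE@AGBN'', ''CE@AGBCDEF'', ''AHNMJOIHCD'', ''ACCDE@ABGN'', ''@CCDE@ABGN'', ''EACDE@ABGN'',
    ''CFCDE@ABGN'', ''ADCDE@ABGN'', ''CIMLKOFJIH'', ''@JNA@OKLMJ'', ''AFNA@OKLMJ'', ''@DGHIFEDCB'']"
  by code_simp

lemma chk_exts_7_8: "chk_exts 7 reps8 (table_of 7 ''OOOOOOOOH'') [
    ''GFG@ABCDEF'', ''HK@ABCDEFG'', ''AJG@ABCEFD'', ''HI@ABCDEFG'', ''CI@ABCDEFG'', ''DJ@ABCDEFG'',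
    ''G@@ABCDEFG'', ''@C@ABCDEFG'', ''EA@ABCDEFG'', ''CJ@ABCDEFG'', ''CF@ABCDEFG'', ''FG@ABCDEFG'',
    ''HC@ABCDEFG'', ''CFHIGFEDCB'', ''EAHIGFEDCB'', ''D@@ABCDEFG'', ''AD@ABCDEFG'', ''H@@ABCDEFG'',
    ''GG@ABCDEFG'', ''EC@ABCDEFG'', ''DB@ABCDEFG'', ''DF@ABCDEFG'', ''FC@ABCDEFG'', ''EI@ABCDEFG'',
    ''FI@ABCDEFG'', ''AF@ABCDEFG'', ''DD@ABCDEFG'', ''DKHMLKJIGF'', ''GF@OABCDEF'', ''GALKJIHOMN'',
    ''FF@ABCDEGF'', ''D@@ABCDEGF'', ''FK@ABCDEGF'', ''CC@ABCDEGF'', ''CJ@ABCDEGF'', ''E@@ABCDEGF'',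
    ''DE@ABCDEGF'', ''G@@ABCDEGF'', ''DJ@ABCDEGF'', ''CI@ABCDEGF'', ''HI@ABCDEGF'', ''CIJIHNOMLK'',
    ''FGLKJIHMON'', ''H@LKJIHMON'', ''KA@ABCDEGF'', ''JB@ABCDEGF'', ''GC@ABCDEGF'', ''DCGIMLKJF@'',
    ''BKLKJIHMON'', ''GJLKJIHMON'', ''JJABCDGEF@'', ''JG@ABCDEGF'', ''IF@ABCDEGF'', ''HF@ABCDEGF'',
    ''GD@ABCDEGF'', ''GI@ABCDEGF'', ''FHGHMLKIJF'', ''GALKJIGHMN'', ''AELKJIHOMN'', ''CCLKJIHOMN'',
    ''BKLKJIHOMN'', ''CJLKJIHOMN'', ''FGLKJIHOMN'', ''DJ@ABCDGEF'', ''G@@ABCDGEF'', ''DE@ABCDGEF'',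
    ''E@@ABCDGEF'', ''DI@ABCDGEF'', ''GB@ABCDGEF'', ''IA@ABCDGEF'', ''G@GDCNMHIJ'', ''FEEFKLO@AB'',
    ''AIEFKLO@AB'', ''EHLO@EFKJI'', ''BHEFKLO@AB'', ''CDDCNMHGIJ'', ''AELKJIGHMN'', ''FEG@LMNABC'',
    ''IFABCDEGF@'', ''GCABCDEGF@'', ''JFOHCBNMAL'', ''J@EGBNCDHI'', ''JAJIHNMOLK'', ''JGOMNBAL@K'',
    ''GDKJIHMONL'', ''EHEFKOL@AB'', ''FAOJFEDIHC'', ''GEEGBNCDHI'', ''IENMOJIHDC'', ''JHJIHNMOLK'',
    ''EFCGE@ABLN'', ''FEEFKOL@AB'', ''CGDE@ABGCN'', ''HJDE@ABGCN'', ''CGLOJIHMNC'', ''G@DGCNMHIJ'',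
    ''IA@ABCGDEF'', ''GB@ABCGDEF'', ''DI@ABCGDEF'', ''DHDE@ABCGN'', ''DAGDE@ACBN'', ''CBHIFEDGCB'',
    ''FIDE@ABCGN'', ''HFDE@ABCNG'', ''FH@OLMNABC'', ''A@DE@ABCGN'', ''EFDE@ABCNG'', ''FE@OLMNABC'',
    ''FJABCDEFG@'', ''HEABCDEGF@'', ''C@ABCDEGF@'', ''JILKJIOHMN'', ''IGF@ABGECD'', ''HAJIHNMOLK'',
    ''FCOMNBALK@'', ''HEOJFEDICH'', ''GHF@ABGECD'', ''GKNMOJIHDC'', ''HDJIHNMOLK'', ''DBDE@ABGCN'',
    ''FIDE@ABGCN'', ''FJMNBGA@LK'', ''CHF@ABGECD'', ''FDBGEF@AKL'', ''CHJIHNMOLK'', ''DGDE@ABGCN'',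
    ''DHDE@ABGCN'', ''GF@ABGCDEF'', ''IA@ABGCDEF'', ''AKOJIHNMKL'', ''G@DCGNMHIJ'', ''CGLKJIHMNG'',
    ''B@GCE@ABNL'', ''HJLKJIHMNG'', ''I@LKJIHMGN'', ''DKOLMNBA@C'', ''DKHMLKOJIF'', ''DHHMLKOJIF'',
    ''AILKJIHMNG'', ''CJDCGNMHIJ'', ''BGLKJIHMNG'', ''C@LKJIHMGN'', ''FALKJIHMNG'', ''HELKJIHMGN'',
    ''FJABCDEF@O'', ''EAHOIFEDCB'', ''DB@GBCDEFI'', ''FI@GBCDEFI'', ''DDHMLKJOIF'', ''DKHMLKJOIF'',
    ''GF@AGBCDEF'', ''DGDE@AGBCN'', ''FDNMJOIHDC'', ''ACLKJIHMNG'', ''CHF@AGBECD'', ''@KLKJIHMNG'',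
    ''FJJOFEDCIH'', ''CHGCDFEB@A'', ''FELKJIHMNG'', ''FGDCGNMHIJ'', ''BILKJIHMNG'', ''FBLKJIHMGN'',
    ''CKLKJIHMNG'', ''HHLKJIHMGN'', ''EAGHIFEDCB'']"
  by code_simp

lemma chk_exts_7_9: "chk_exts 7 reps8 (table_of 7 ''OOOOOOOOL'') [
    ''HGKJIHONML'', ''GFKJIHONML'', ''CEKJIHONML'', ''BE@ABCDEFG'', ''DI@ABCDEFG'', ''DE@ABCDEFG'',
    ''@D@ABCDEFG'', ''AE@ABCDEFG'', ''CC@ABCDEFG'', ''AB@ABCDEFG'', ''BK@ABCDEFG'', ''BJ@ABCDEFG'',
    ''@B@ABCDEFG'', ''BB@ABCDEFG'', ''AK@ABCDEFG'', ''FF@ABCDEFG'', ''AA@ABCDEFG'', ''GJ@ABCDEFG'',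
    ''EE@ABCDEFG'', ''BJKJIHNMLO'', ''DG@ABCDEFG'', ''AJ@ABCDEFG'', ''AAKJIHNMLO'', ''ABKJIHNMLO'',
    ''DH@ABCDEFG'', ''@DKJIHNMLO'', ''DK@ABCDEFG'', ''BA@ABCDEFG'', ''HG@OABCDEF'', ''EGHOMLKJIF'',
    ''AK@ABCDEGF'', ''GA@ABCDEGF'', ''AE@ABCDEGF'', ''GB@ABCDEGF'', ''DI@ABCDEGF'', ''CE@ABCDEGF'',
    ''BE@ABCDEGF'', ''CEKJIHNOML'', ''GFKJIHNOML'', ''AJF@ABCEGD'', ''HK@ABCDEGF'', ''AJKJIHNMLO'',
    ''DFLKJIHMON'', ''JJ@ABCDEGF'', ''GJKJIHNMLO'', ''BKKJIHNMLO'', ''AHGIMLKJF@'', ''AJLKJIHMON'',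
    ''HKABCDGEF@'', ''FFKJIHNMLO'', ''CCKJIHNMLO'', ''DAF@ABCEDG'', ''DEKJIHNMLO'', ''FHF@ABCEDG'',
    ''AGF@ABCEDG'', ''EGDE@OABCN'', ''AKLKJIHOMN'', ''FFLKJIHOMN'', ''GJLKJIHOMN'', ''AJLKJIHOMN'',
    ''D@LKJIHOMN'', ''H@LKJIHOMN'', ''DFLKJIHOMN'', ''CI@ABCDGEF'', ''AJF@ABCGED'', ''CEKJIHNMOL'',
    ''BE@ABCDGEF'', ''CE@ABCDGEF'', ''GF@ABCDGEF'', ''AKKJIHNMLO'', ''AEKJIHNMLO'', ''@ANMKJIHGD'',
    ''DIKJIHNMLO'', ''CBNMKJIHGD'', ''@INMKJIHGD'', ''AKLKJIGHMN'', ''G@FEDHOIJK'', ''JGABCDEGF@'',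
    ''JBABCDEGF@'', ''CIKJIHNOML'', ''JHLMNCBAG@'', ''K@LMNCBAG@'', ''H@F@ABCGED'', ''JBJIHNMOLK'',
    ''GJF@ABCGED'', ''GBKJIHNMOL'', ''DIKJIHNMOL'', ''HJGALMNBCH'', ''JHFEDHIJOK'', ''D@F@ABCGED'',
    ''JGJIHNMOLK'', ''FFF@ABCGED'', ''GAKJIHNMOL'', ''AEKJIHNMOL'', ''G@LMNCGBA@'', ''AKF@ABCGED'',
    ''EGCGEF@ABL'', ''AKKJIHNMOL'', ''HG@ABCGDEF'', ''GF@ABCGDEF'', ''CE@ABCGDEF'', ''BE@ABCGDEF'',
    ''BBDE@ABCGN'', ''DGDE@ABCGN'', ''AHNMKJIHGD'', ''DIFEDGHIJK'', ''EALMNGCBA@'', ''DBDE@ABCGN'',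
    ''DCNMKJIHGD'', ''DEFEDGHIJK'', ''@DLMNGCBA@'', ''B@DE@ABCGN'', ''CGNMKJIHGD'', ''G@FEDGHIJK'',
    ''EAFEDHOIJK'', ''HHABCDEGF@'', ''FBABCDEGF@'', ''IKLMNCBAG@'', ''IJLMNCBAG@'', ''FBJIHNMOLK'',
    ''I@GALMNBHC'', ''IKFEDHIJOK'', ''HHJIHNMOLK'', ''EALMNCGBA@'', ''DKKOIHNMLB'', ''DHKOIHNMLB'',
    ''DGKOIHNMLB'', ''BBKOIHNMLB'', ''HG@ABGCDEF'', ''EGNMKOJIHD'', ''AKF@ABGCED'', ''G@LMNGCBA@'',
    ''CGDE@ABCGN'', ''B@NMKJIHGD'', ''@DFEDGHIJK'', ''BA@BGCDEFI'', ''AGLKJIHMNG'', ''@IDE@ABCGN'',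
    ''DELMNGCBA@'', ''DCDE@ABCGN'', ''DBNMKJIHGD'', ''EAFEDGHIJK'', ''BB@GBCDEFI'', ''DG@GBCDEFI'',
    ''DH@GBCDEFI'', ''DK@GBCDEFI'', ''BAHMLKJOIF'', ''HG@AGBCDEF'', ''BBKJIHNMLG'', ''DGKJIHNMLG'',
    ''AHGBEF@ALK'', ''DHKJIHNMLG'', ''DALKJIHMNG'', ''@ADE@ABCGN'', ''DKKJIHNMLG'', ''FHLKJIHMNG'',
    ''CBDE@ABCGN'', ''DILMNGCBA@'', ''AHDE@ABCGN'', ''DGNMKJIHGD'', ''BBNMKJIHGD'']"
  by code_simp

lemma chk_exts_7_10: "chk_exts 7 reps8 (table_of 7 ''OOOOOOOON'') [
    ''JK@ABCDEFG'', ''HG@ABCDEFG'', ''GF@ABCDEFG'', ''CE@ABCDEFG'', ''IA@ABCDEFG'', ''GB@ABCDEFG'',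
    ''E@@ABCDEFG'', ''CECDEF@ABO'', ''GFMLKJIHNO'', ''GA@ABCDEFG'', ''FK@ABCDEFG'', ''GBCDEF@ABO'',
    ''E@LKJIHNMO'', ''GACDEF@ABO'', ''EG@ABCDEFG'', ''HGBCDEF@AO'', ''HGABCDEGF@'', ''EGHNMLKJIG'',
    ''GALKJIHNMO'', ''E@CDEF@ABO'', ''GBLKJIHNMO'', ''FKHNMLKJIG'', ''GAHNMLKJIG'', ''GFBCDEF@AO'',
    ''CELKJIHNMO'', ''E@HNMLKJIG'', ''GBHNMLKJIG'', ''IAHNMLKJIG'', ''CEHNMLKJIG'', ''GFHNMLKJIG'',
    ''HGHNMLKJIG'', ''JKHNMLKJIG'', ''HGABCDEFG@'', ''GFMLKJIHON'', ''IA@ABCDEGF'', ''GF@ABCDEGF'',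
    ''HG@ABCDEGF'', ''JK@ABCDEGF'', ''HGKJIHNOML'', ''GFF@ABCDEG'', ''CEF@ABCDEG'', ''IALKJIHNMO'',
    ''GBF@ABCDEG'', ''E@F@ABCDEG'', ''CEBCDEF@AO'', ''GFLKJIHNMO'', ''GAF@ABCDEG'', ''FKKJIHNMLO'',
    ''GBBCDEF@AO'', ''E@KJIHNMLO'', ''GABCDEF@AO'', ''EGJIHNMLKO'', ''HGABCDEF@O'', ''GFABCDEFG@'',
    ''HKBCDEFG@A'', ''JJABCDEGF@'', ''HKABCDEGF@'', ''GFLKJIHNOM'', ''HIBCDEFG@A'', ''KA@ABCDGEF'',
    ''JJ@ABCDGEF'', ''IALKJIHNOM'', ''HI@ABCDGEF'', ''HK@ABCDGEF'', ''GFF@ABCDGE'', ''GFKJIHNMOL'',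
    ''HGKJIHNMOL'', ''JK@ABCDGEF'', ''HG@ABCDGEF'', ''HGJIHNMOLK'', ''EGCDEF@ABO'', ''GFEF@ABCDG'',
    ''GAKJIHNMLO'', ''CEEF@ABCDG'', ''E@BCDEF@AO'', ''IAKJIHNMLO'', ''GBKJIHNMLO'', ''GBEF@ABCDG'',
    ''FKBCDEF@AO'', ''E@EF@ABCDG'', ''GANMLKJIHG'', ''CEABCDEF@O'', ''GFABCDEF@O'', ''IAABCDEFG@'',
    ''JJBCDEFG@A'', ''KAABCDEGF@'', ''HIABCDEGF@'', ''KABCDEFG@A'', ''KB@ABCGDEF'', ''KAKJIHNOML'',
    ''KAJIHNMOLK'', ''JJJIHNMOLK'', ''IAKJIHNMOL'', ''HIDEF@AGBC'', ''KAIHNMLOKJ'', ''HIIHNMLOKJ'',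
    ''JJIHNMLOKJ'', ''HKIHNMLOKJ'', ''GFEF@ABCGD'', ''IAJIHNMLOK'', ''GFJIHNMLOK'', ''HGJIHNMLOK'',
    ''JK@ABCGDEF'', ''HGKJIHNMLO'', ''GFKJIHNMLO'', ''CEKJIHNMLO'', ''HGIHNMLOKJ'', ''EGBCDEF@AO'',
    ''GAEF@ABCDG'', ''E@NMLKJIHG'', ''GFDEF@ABCG'', ''GAJIHNMLKO'', ''FKJIHNMLKO'', ''GBNMLKJIHG'',
    ''CEDEF@ABCG'', ''E@ABCDEF@O'', ''GBABCDEF@O'', ''IAABCDEF@O'', ''GFNMLKJIOH'', ''HKCDEF@GAB'',
    ''HICDEF@GAB'', ''JJCDEF@GAB'', ''KAHNMLKOJI'', ''HIHNMLKOJI'', ''HKDEF@AGBC'', ''JJHNMLKOJI'',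
    ''HKHNMLKOJI'', ''GFDEF@ABGC'', ''GFCDEF@AGB'', ''IAIHNMLKOJ'', ''GFIHNMLKOJ'', ''HGIHNMLKOJ'',
    ''JK@ABGCDEF'', ''HGJIHNMLKO'', ''GFJIHNMLKO'', ''CEJIHNMLKO'', ''IAJIHNMLKO'', ''GBJIHNMLKO'',
    ''E@JIHNMLKO'', ''CENMLKJIHG'', ''HGHNMLKOJI'', ''EGABCDEF@O'', ''GADEF@ABCG'', ''E@MLKJIHNG'',
    ''GBDEF@ABCG'', ''FKABCDEF@O'', ''GAABCDEF@O'', ''GFNMLKJIHG'', ''HGBCDEF@GA'', ''GFBCDEF@GA'',
    ''IAHNMLKJOI'', ''GFHNMLKJOI'', ''HGHNMLKJOI'', ''JK@AGBCDEF'', ''HGIHNMLKJO'', ''GFIHNMLKJO'',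
    ''CEIHNMLKJO'', ''IAIHNMLKJO'', ''GBIHNMLKJO'', ''E@IHNMLKJO'', ''CEMLKJIHNG'', ''GFCDEF@ABG'',
    ''GAIHNMLKJO'', ''FKIHNMLKJO'', ''GBMLKJIHNG'', ''E@DEF@ABCG'', ''GAMLKJIHNG'', ''EGIHNMLKJO'',
    ''HGBCDEFO@A'']"
  by code_simp

section \<open>Completeness of the lists for 2 to 8 elements\<close>

lemma complete_reps2: "complete_reps 2 reps2"
  by (rule complete_reps_2[of "''''" _ 0]) (simp add: reps2_def)

lemma complete_reps3: "complete_reps 3 reps3"
proof -
  have "complete_reps (Suc 2) reps3"
  proof (rule complete_reps_Suc[OF complete_reps2])
    fix i s assume "s \<in> set (reps2 i)"
    then show "\<exists>cs. chk_exts 2 reps3 (table_of 2 s) cs"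
      unfolding reps2_def list.set insert_iff empty_iff simp_thms
      by - (hypsubst, intro exI, rule chk_exts_2_0)
  qed simp
  then show ?thesis by simp
qed

lemma complete_reps4: "complete_reps 4 reps4"
proof -
  have "complete_reps (Suc 3) reps4"
  proof (rule complete_reps_Suc[OF complete_reps3])
    fix i s assume "s \<in> set (reps3 i)"
    then show "\<exists>cs. chk_exts 3 reps4 (table_of 3 s) cs"
      unfolding reps3_def list.set insert_iff empty_iff simp_thms
      by - (hypsubst, intro exI, rule chk_exts_3_0)
  qed simp
  then show ?thesis by simp
qed

lemma complete_reps5: "complete_reps 5 reps5"
proof -
  have "complete_reps (Suc 4) reps5"
  proof (rule complete_reps_Suc[OF complete_reps4])
    fix i s assume "s \<in> set (reps4 i)"
    then show "\<exists>cs. chk_exts 4 reps5 (table_of 4 s) cs"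
      unfolding reps4_def list.set insert_iff empty_iff simp_thms
      by - (hypsubst, intro exI, rule chk_exts_4_0)
  qed simp
  then show ?thesis by simp
qed

lemma complete_reps6: "complete_reps 6 reps6"
proof -
  have "complete_reps (Suc 5) reps6"
  proof (rule complete_reps_Suc[OF complete_reps5])
    fix i s assume "s \<in> set (reps5 i)"
    then show "\<exists>cs. chk_exts 5 reps6 (table_of 5 s) cs"
      unfolding reps5_def list.set insert_iff empty_iff simp_thms
      by - (hypsubst, intro exI, rule chk_exts_5_0)
  qed simp
  then show ?thesis by simp
qed

lemma complete_reps7: "complete_reps 7 reps7"
proof -
  have "complete_reps (Suc 6) reps7"
  proof (rule complete_reps_Suc[OF complete_reps6])
    fix i s assume "s \<in> set (reps6 i)"
    then show "\<exists>cs. chk_exts 6 reps7 (table_of 6 s) cs"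
      unfolding reps6_def list.set insert_iff empty_iff simp_thms
      by (elim disjE) (hypsubst, intro exI, rule chk_exts_6_0 chk_exts_6_1 chk_exts_6_2 chk_exts_6_3)+
  qed simp
  then show ?thesis by simp
qed

lemma complete_reps8: "complete_reps 8 reps8"
proof -
  have "complete_reps (Suc 7) reps8"
  proof (rule complete_reps_Suc[OF complete_reps7])
    fix i s assume "s \<in> set (reps7 i)"
    then show "\<exists>cs. chk_exts 7 reps8 (table_of 7 s) cs"
      unfolding reps7_def list.set insert_iff empty_iff simp_thms
      by (elim disjE) (hypsubst, intro exI, rule chk_exts_7_0 chk_exts_7_1 chk_exts_7_2 chk_exts_7_3 chk_exts_7_4 chk_exts_7_5 chk_exts_7_6 chk_exts_7_7 chk_exts_7_8 chk_exts_7_9 chk_exts_7_10)+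
  qed simp
  then show ?thesis by simp
qed

section \<open>Evaluation on the 135 representatives\<close>

definition trie_data :: "trie \<Rightarrow> int \<times> int" where
  "trie_data t = (trie_invariant 8 t, free 8 t Z)"

definition rep_data :: "string \<Rightarrow> bool \<times> int \<times> int" where
  "rep_data s = (chk_gp 8 (table_of 8 s), trie_data (conf_trie 8 (table_of 8 s)))"

text \<open>An entry records the test of the three-term relations, a quarter of
  \<open>edge_invariant\<close>, and the number of complete cells. The value 62 occurs once, at the
  end of the next to last group.\<close>

definition rep_table :: "(bool \<times> int \<times> int) list list" where
  "rep_table = [
    [(True, 100373528, 50), (True, 100646696, 50), (True, 100999664, 50), (True, 101185184, 50),
     (True, 101676728, 50), (True, 102094136, 50), (True, 102216328, 50), (True, 102223160, 50),
     (True, 102264208, 50), (True, 102451040, 50), (True, 102457664, 50), (True, 102507992, 50)],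
    [(True, 102600656, 50), (True, 102622040, 50), (True, 102642496, 50), (True, 102677840, 50),
     (True, 102678992, 50), (True, 102748784, 52), (True, 102787280, 50), (True, 102979816, 50),
     (True, 103072760, 50), (True, 103077224, 50), (True, 103247832, 52), (True, 103287248, 52)],
    [(True, 103461488, 50), (True, 103688344, 52), (True, 103865752, 52), (True, 103974280, 50),
     (True, 103989904, 50), (True, 104038912, 54), (True, 104193512, 50), (True, 104301576, 50),
     (True, 104342280, 50), (True, 104346376, 50), (True, 104449696, 50), (True, 104545008, 52)],
    [(True, 104550680, 52), (True, 104571536, 50), (True, 104590528, 50), (True, 104608144, 52),
     (True, 104623016, 50), (True, 104688240, 52), (True, 104760880, 50), (True, 104788672, 52),
     (True, 104806744, 52), (True, 104857664, 52), (True, 104859600, 52), (True, 104861480, 50)],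
    [(True, 104870624, 52), (True, 104880608, 50), (True, 104890688, 52), (True, 104959168, 50),
     (True, 104960472, 52), (True, 104998232, 52), (True, 105007656, 52), (True, 105017976, 52),
     (True, 105072912, 52), (True, 105085688, 52), (True, 105228160, 54), (True, 105790680, 52)],
    [(True, 105831840, 52), (True, 105880408, 52), (True, 106186848, 50), (True, 106218728, 50),
     (True, 106298872, 52), (True, 106314616, 50), (True, 106356576, 52), (True, 106369936, 52),
     (True, 106445704, 52), (True, 106553472, 50), (True, 106576760, 50), (True, 106620792, 50)],
    [(True, 106649216, 50), (True, 106650608, 52), (True, 106710824, 52), (True, 106736184, 52),
     (True, 106785040, 54), (True, 106810080, 52), (True, 106811512, 52), (True, 106824584, 52),
     (True, 106918728, 50), (True, 107040208, 52), (True, 107453216, 54), (True, 107456616, 52)],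
    [(True, 107621320, 54), (True, 107755728, 52), (True, 107901528, 52), (True, 108188920, 52),
     (True, 108204544, 52), (True, 108243352, 52), (True, 108265040, 56), (True, 108445448, 52),
     (True, 108476952, 52), (True, 108527992, 50), (True, 108659480, 52), (True, 108662472, 54)],
    [(True, 108695464, 52), (True, 108706224, 54), (True, 108755080, 50), (True, 108762936, 52),
     (True, 108822136, 52), (True, 109024032, 54), (True, 109130560, 50), (True, 109228256, 56),
     (True, 109270808, 52), (True, 109318064, 56), (True, 109371360, 54), (True, 109616760, 56)],
    [(True, 110115440, 52), (True, 110161592, 56), (True, 110235472, 54), (True, 110334952, 54),
     (True, 110425296, 52), (True, 110442440, 54), (True, 110578448, 52), (True, 110618696, 52),
     (True, 110722456, 50), (True, 110743896, 56), (True, 110775264, 52), (True, 111256728, 52)],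
    [(True, 112604920, 52), (True, 112626096, 54), (True, 112657688, 54), (True, 112665752, 52),
     (True, 112698568, 52), (True, 112729312, 54), (True, 112850152, 52), (True, 112896408, 54),
     (True, 112966968, 54), (True, 113061336, 54), (True, 113358616, 56), (True, 114065408, 62)],
    [(True, 114860416, 54), (True, 115289944, 56), (True, 119582848, 56)]]"

lemma rep_data_0: "map rep_data (reps8 0) = rep_table ! 0"
  by code_simp

lemma rep_data_1: "map rep_data (reps8 1) = rep_table ! 1"
  by code_simp

lemma rep_data_2: "map rep_data (reps8 2) = rep_table ! 2"
  by code_simp

lemma rep_data_3: "map rep_data (reps8 3) = rep_table ! 3"
  by code_simp

lemma rep_data_4: "map rep_data (reps8 4) = rep_table ! 4"
  by code_simp

lemma rep_data_5: "map rep_data (reps8 5) = rep_table ! 5"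
  by code_simp

lemma rep_data_6: "map rep_data (reps8 6) = rep_table ! 6"
  by code_simp

lemma rep_data_7: "map rep_data (reps8 7) = rep_table ! 7"
  by code_simp

lemma rep_data_8: "map rep_data (reps8 8) = rep_table ! 8"
  by code_simp

lemma rep_data_9: "map rep_data (reps8 9) = rep_table ! 9"
  by code_simp

lemma rep_data_10: "map rep_data (reps8 10) = rep_table ! 10"
  by code_simp

lemma rep_data_11: "map rep_data (reps8 11) = rep_table ! 11"
  by code_simp

definition all_reps :: "string list" where
  "all_reps = concat (map reps8 [0..<12])"

text \<open>Coverage speaks of arbitrary group numbers; from 12 on the groups are empty.\<close>

lemma reps8_subset: "set (reps8 i) \<subseteq> set all_reps"
proof (cases "i < 12")
  case True
  then show ?thesis by (auto simp: all_reps_def simp del: reps8.simps)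
next
  case False
  then have "reps8 i = []" by (cases i rule: reps8.cases) simp_all
  then show ?thesis by simp
qed

lemma rep_data_all: "map rep_data all_reps = concat rep_table"
proof -
  have row: "map rep_data (reps8 i) = rep_table ! i" if "i < 12" for i
  proof -
    have "i = 0 \<or> i = 1 \<or> i = 2 \<or> i = 3 \<or> i = 4 \<or> i = 5 \<or> i = 6 \<or> i = 7 \<or> i = 8 \<or> i = 9 \<or> i = 10 \<or> i = 11"
      using that by arith
    then show ?thesis
      by (elim disjE) (hypsubst, rule rep_data_0 rep_data_1 rep_data_2 rep_data_3 rep_data_4 rep_data_5
        rep_data_6 rep_data_7 rep_data_8 rep_data_9 rep_data_10 rep_data_11)+
  qed
  have "length rep_table = 12" by code_simp
  then have "map (\<lambda>i. map rep_data (reps8 i)) [0..<12] = rep_table"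
    using row by (intro nth_equalityI) simp_all
  then show ?thesis by (simp add: all_reps_def map_concat comp_def del: upt.simps)
qed

text \<open>The number of classes, their separation, the bound and the uniqueness of the maximum are
  all decided on this list of numbers.\<close>

lemma rep_table_checks:
  "length (concat rep_table) = 135"
  "sorted_wrt (<) (map (fst \<circ> snd) (concat rep_table))"
  "list_all (\<lambda>(gp, i, f). gp \<and> f \<le> 62) (concat rep_table)"
  "length (filter (\<lambda>d. snd (snd d) = 62) (concat rep_table)) = 1"
  by code_simp+

section \<open>Reorientation classes of the representatives\<close>

definition rep_circuits :: "string \<Rightarrow> nat sign_vector set" where
  "rep_circuits s = circuits E8 (shifted (table_of 8 s))"

lemma length_all_reps: "length all_reps = 135"
  using rep_table_checks(1) unfolding rep_data_all[symmetric] by simp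

lemma rep_checks:
  assumes "s \<in> set all_reps"
  shows "chirotope E8 (shifted (table_of 8 s))" and "free 8 (conf_trie 8 (table_of 8 s)) Z \<le> 62"
proof -
  have "chk_gp 8 (table_of 8 s) \<and> free 8 (conf_trie 8 (table_of 8 s)) Z \<le> 62"
    using rep_table_checks(3) assms
    unfolding rep_data_all[symmetric] list_all_iff by (auto simp: rep_data_def trie_data_def)
  then show "chirotope E8 (shifted (table_of 8 s))" and "free 8 (conf_trie 8 (table_of 8 s)) Z \<le> 62"
    using chirotope_shifted chk_gp_chirotope by blast+
qed

text \<open>Strict increase of the invariant along the list gives distinct values, hence also
  distinct strings.\<close>

lemma rep_invariant_inj: "inj_on (\<lambda>s. trie_invariant 8 (conf_trie 8 (table_of 8 s))) (set all_reps)"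
  and distinct_all_reps: "distinct all_reps"
proof -
  have "sorted_wrt (<) (map (\<lambda>s. trie_invariant 8 (conf_trie 8 (table_of 8 s))) all_reps)"
    using rep_table_checks(2)
    unfolding rep_data_all[symmetric] by (simp add: comp_def rep_data_def trie_data_def)
  then have "distinct (map (\<lambda>s. trie_invariant 8 (conf_trie 8 (table_of 8 s))) all_reps)"
    using strict_sorted_iff by blast
  then show "inj_on (\<lambda>s. trie_invariant 8 (conf_trie 8 (table_of 8 s))) (set all_reps)" "distinct all_reps"
    by (simp_all add: distinct_map)
qed

lemma rep_extremal_unique:
  assumes "s \<in> set all_reps" "free 8 (conf_trie 8 (table_of 8 s)) Z = 62"
    and "s' \<in> set all_reps" "free 8 (conf_trie 8 (table_of 8 s')) Z = 62"
  shows "s = s'"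
proof -
  have "length (filter (\<lambda>s. free 8 (conf_trie 8 (table_of 8 s)) Z = 62) all_reps) = 1"
    using rep_table_checks(4)
    unfolding rep_data_all[symmetric] by (simp add: filter_map comp_def rep_data_def trie_data_def)
  then obtain u where u: "filter (\<lambda>s. free 8 (conf_trie 8 (table_of 8 s)) Z = 62) all_reps = [u]"
    by (auto simp: length_Suc_conv)
  have "s \<in> set (filter (\<lambda>s. free 8 (conf_trie 8 (table_of 8 s)) Z = 62) all_reps)"
    "s' \<in> set (filter (\<lambda>s. free 8 (conf_trie 8 (table_of 8 s)) Z = 62) all_reps)"
    using assms by simp_all
  then show ?thesis unfolding u by simp
qed

lemma rep_complete_cells:
  assumes "s \<in> set all_reps" "C \<in> reorientation_class E8 (rep_circuits s)"
  shows "int (card (complete_cells E8 C)) = free 8 (conf_trie 8 (table_of 8 s)) Z"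
  using complete_cells_class[OF assms(2)] complete_cells_trie[OF rep_checks(1)[OF assms(1)]]
  by (simp add: rep_circuits_def)

text \<open>Duality together with completeness of the final list: there are at most 135
  classes.\<close>

lemma uniform_class_rep:
  assumes "uniform_oriented_matroid E8 5 C"
  shows "\<exists>s\<in>set all_reps. reorientation_class E8 C = reorientation_class E8 (rep_circuits s)"
proof -
  obtain \<chi> where \<chi>: "chirotope E8 \<chi>" "C = circuits E8 \<chi>"
    using assms uniform_oriented_matroid_iff_chirotope[of E8 5 C] by auto
  then obtain i s where "s \<in> set (reps8 i)" "rep_circuits s \<in> reorientation_class E8 C"
    using complete_reps_circuits[OF complete_reps8 \<chi>(1)] unfolding rep_circuits_def by blast
  then show ?thesis using reps8_subset reorientation_class_eq by blast
qed

text \<open>Every listed table passed the three-term test, so each of them does give the class of a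
  uniform oriented matroid.\<close>

lemma uniform_classes:
  "uniform_reorientation_classes E8 5 = (\<lambda>s. reorientation_class E8 (rep_circuits s)) ` set all_reps"
proof (intro subset_antisym subsetI)
  fix K assume "K \<in> uniform_reorientation_classes E8 5"
  then show "K \<in> (\<lambda>s. reorientation_class E8 (rep_circuits s)) ` set all_reps"
    using uniform_class_rep unfolding uniform_reorientation_classes_def by blast
next
  fix K assume "K \<in> (\<lambda>s. reorientation_class E8 (rep_circuits s)) ` set all_reps"
  then obtain s where s: "s \<in> set all_reps" and K: "K = reorientation_class E8 (rep_circuits s)" by blast
  have "uniform_oriented_matroid E8 5 (rep_circuits s)"
    unfolding rep_circuits_def by (rule circuits_uniform_oriented_matroid[OF rep_checks(1)[OF s]]) simp_all
  then show "K \<in> uniform_reorientation_classes E8 5"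
    unfolding K uniform_reorientation_classes_def by blast
qed

text \<open>Members of one class share the edge invariant, which separates the tables: there are at
  least 135 classes.\<close>

lemma inj_on_rep_class: "inj_on (\<lambda>s. reorientation_class E8 (rep_circuits s)) (set all_reps)"
proof (rule inj_onI)
  fix s s' assume s: "s \<in> set all_reps" "s' \<in> set all_reps"
    and eq: "reorientation_class E8 (rep_circuits s) = reorientation_class E8 (rep_circuits s')"
  have "rep_circuits s \<in> reorientation_class E8 (rep_circuits s')"
    using reorientation_class_refl eq by metis
  then have "edge_invariant E8 (rep_circuits s) = edge_invariant E8 (rep_circuits s')"
    by (rule edge_invariant_class)
  then have "trie_invariant 8 (conf_trie 8 (table_of 8 s)) = trie_invariant 8 (conf_trie 8 (table_of 8 s'))"
    using edge_invariant_trie[OF rep_checks(1)[OF s(1)]] edge_invariant_trie[OF rep_checks(1)[OF s(2)]]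
    by (simp add: rep_circuits_def)
  then show "s = s'" using inj_onD[OF rep_invariant_inj _ s] by blast
qed

text \<open>The count is made on the dual table itself, without relabelling it to a listed
  representative.\<close>

lemma alt_complete_cells: "card (complete_cells E8 alt_circuits) = 62"
proof -
  have "free 8 (conf_trie 8 alt_table) Z = 62" by code_simp
  then show ?thesis
    using complete_cells_trie[OF alt_chirotope] by (simp add: alt_circuits_def)
qed

theorem theorem1:
  shows "card (uniform_reorientation_classes {1..8::nat} 5) = 135 \<and>
    (\<forall>K \<in> uniform_reorientation_classes {1..8::nat} 5. \<forall>\<C>\<in>K.
        card (complete_cells {1..8} \<C>) \<le> 2 * cyclic_cells 4 8) \<and>
    (\<exists>A. is_alternating 8 5 A) \<and>
    (\<forall>A. is_alternating 8 5 A \<longrightarrow>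
        reorientation_class {1..8} A \<in> uniform_reorientation_classes {1..8} 5 \<and>
        (\<forall>K \<in> uniform_reorientation_classes {1..8} 5. \<forall>\<C>\<in>K.
            card (complete_cells {1..8} \<C>) = 2 * cyclic_cells 4 8 \<longleftrightarrow>
            K = reorientation_class {1..8} A))"
proof (intro conjI ballI allI impI)
  \<comment> \<open>The binomials give \<open>1 + 1 + (1 + 7 + 21) = 31\<close>, and twice 31 is
    62.\<close>
  have cells: "2 * cyclic_cells 4 8 = 62" by code_simp
  show "card (uniform_reorientation_classes E8 5) = 135"
    unfolding uniform_classes card_image[OF inj_on_rep_class]
    using distinct_card[OF distinct_all_reps] length_all_reps by simp
  show "card (complete_cells E8 \<C>) \<le> 2 * cyclic_cells 4 8"
    if K: "K \<in> uniform_reorientation_classes E8 5" "\<C> \<in> K" for K \<C>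
  proof -
    obtain s where s: "s \<in> set all_reps" "\<C> \<in> reorientation_class E8 (rep_circuits s)"
      using K unfolding uniform_classes by blast
    then show ?thesis using rep_complete_cells[OF s] rep_checks(2)[OF s(1)] cells by simp
  qed
  show "\<exists>A. is_alternating 8 5 A" using alt_is_alternating by blast
  fix A assume "is_alternating 8 5 A"
  then have A: "A = alt_circuits" by (rule alternating_eq_alt_circuits)
  then show "reorientation_class E8 A \<in> uniform_reorientation_classes E8 5"
    using alt_uniform unfolding uniform_reorientation_classes_def by blast
  \<comment> \<open>The representative \<open>a\<close> of the alternating class is not named; its
    62 complete cells single it out.\<close>
  obtain a where a: "a \<in> set all_reps" "reorientation_class E8 A = reorientation_class E8 (rep_circuits a)"
    using uniform_class_rep[OF alt_uniform] A by blast
  have A_rep: "A \<in> reorientation_class E8 (rep_circuits a)"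
    using reorientation_class_refl a(2) by metis
  have free_a: "free 8 (conf_trie 8 (table_of 8 a)) Z = 62"
    using rep_complete_cells[OF a(1) A_rep] alt_complete_cells A by simp
  fix K \<C> assume K: "K \<in> uniform_reorientation_classes E8 5" "\<C> \<in> K"
  obtain s where s: "s \<in> set all_reps" "K = reorientation_class E8 (rep_circuits s)"
    using K(1) unfolding uniform_classes by blast
  have cells_s: "int (card (complete_cells E8 \<C>)) = free 8 (conf_trie 8 (table_of 8 s)) Z"
    using rep_complete_cells[OF s(1)] K(2) s(2) by simp
  show "card (complete_cells E8 \<C>) = 2 * cyclic_cells 4 8 \<longleftrightarrow> K = reorientation_class E8 A"
  proof
    assume "card (complete_cells E8 \<C>) = 2 * cyclic_cells 4 8"
    then have "free 8 (conf_trie 8 (table_of 8 s)) Z = 62" using cells_s cells by simp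
    then have "s = a" using rep_extremal_unique s(1) a(1) free_a by blast
    then show "K = reorientation_class E8 A" using s(2) a(2) by simp
  next
    assume "K = reorientation_class E8 A"
    then have "\<C> \<in> reorientation_class E8 (rep_circuits a)" using K(2) a(2) by simp
    then show "card (complete_cells E8 \<C>) = 2 * cyclic_cells 4 8"
      using rep_complete_cells[OF a(1)] free_a cells by simp
  qed
qed

end
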